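(* Consider the one-dimensional impulse game described in the context. For $\tilde s\in\mathbb{R}$, let $\bar x_i=\bar x_i(\tilde s)$, $x_i^*=x_i^*(\tilde s)$ and $A_{ij}=A_{ij}(\tilde s)$, $i,j\in\{1,2\}$, be the numbers described in the context. Then, for every initial state $x\in\mathbb{R}$, a Nash equilibrium of the game is given by the strategies $(\mathcal{C}_1^*,\xi_1^* )$, $(\mathcal{C}_2^*,\xi_2^* )$ defined by $$\mathcal{C}_1^*=\,]\bar x_1,+\infty[,\quad \xi_1^*(y)=x_1^*-y,\qquad \mathcal{C}_2^*=\,]-\infty,\bar x_2[,\quad \xi_2^*(y)=x_2^*-y,\qquad y\in\mathbb{R}.$$ Moreover, the corresponding equilibrium payoff functions $V_i(x)=J^i\big(x;(\mathcal{C}_1^*,\xi_1^* ),(\mathcal{C}_2^*,\xi_2^* )\big)$, $i\in\{1,2\}$, satisfy $V_1\equiv\tilde V_1$ and $V_2\equiv\tilde V_2$ on $\mathbb{R}$, where $$\tilde V_1(x)=\begin{cases}\varphi_1(x_1^* )-c-\lambda(x_1^*-x),&x\in\,]-\infty,\bar x_1],\\ \varphi_1(x),&x\in\,]\bar x_1,\bar x_2[,\\ \varphi_1(x_2^* )+\tilde c+\tilde\lambda(x-x_2^* ),&x\in[\bar x_2,+\infty[,\end{cases}\qquad \tilde V_2(x)=\begin{cases}\varphi_2(x_1^* )+\tilde c+\tilde\lambda(x_1^*-x),&x\in\,]-\infty,\bar x_1],\\ \varphi_2(x),&x\in\,]\bar x_1,\bar x_2[,\\ \varphi_2(x_2^*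 )-c-\lambda(x-x_2^* ),&x\in[\bar x_2,+\infty[,\end{cases}$$ with $\varphi_1(x)=A_{11}e^{\theta x}+A_{12}e^{-\theta x}+(x-s_1)/\rho$ and $\varphi_2(x)=A_{21}e^{\theta x}+A_{22}e^{-\theta x}+(s_2-x)/\rho$.
   Context: Parameters. $\rho,\sigma>0$, $s_1<s_2$, $c\ge\tilde c\ge0$, $\lambda\ge\tilde\lambda\ge0$, $(c,\lambda)\ne(\tilde c,\tilde\lambda)$, $1-\lambda\rho>0$. Set $\theta=\sqrt{2\rho/\sigma^2}$ and $\eta=(1-\lambda\rho)/\rho>0$. The numbers $\bar x_i,x_i^*,A_{ij}$. They form an 8-uple $(A_{11},A_{12},A_{21},A_{22},\bar x_1,\bar x_2,x_1^*,x_2^* )$ satisfying $\bar x_1<x_1^*<\bar x_2$, $\bar x_1<x_2^*<\bar x_2$ and, with $\varphi_1,\varphi_2$ as in the claim, $$\begin{cases}\varphi_1'(x_1^* )=\lambda\ \text{ and }\ \varphi_1''(x_1^* )\le0,\\ \varphi_1'(\bar x_1)=\lambda,\\ \varphi_1(\bar x_1)=\varphi_1(x_1^* )-c-\lambda(x_1^*-\bar x_1),\\ \varphi_1(\bar x_2)=\varphi_1(x_2^* )+\tilde c+\tilde\lambda(\bar x_2-x_2^* ),\end{cases}\qquad \begin{cases}\varphi_2'(x_2^* )=-\lambda\ \text{ and }\ \varphi_2''(x_2^* )\le0,\\ \varphi_2'(\bar x_2)=-\lambda,\\ \varphi_2(\bar x_1)=\varphi_2(x_1^* )+\tilde c+\tilde\lambda(x_1^*-\bar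 x_1),\\ \varphi_2(\bar x_2)=\varphi_2(x_2^* )-c-\lambda(\bar x_2-x_2^* ).\end{cases}$$ The solutions are indexed by $\tilde s\in\mathbb{R}$ and given, for $i,j\in\{1,2\}$, by $$\bar x_i=\tilde s+\frac{(-1)^i}{\theta}\log\Big[\sqrt{\tfrac{\eta+\xi}{\eta-\xi}}\big(\sqrt{\Gamma+1}+\sqrt\Gamma\big)\Big],\qquad x_i^*=\tilde s+\frac{(-1)^i}{\theta}\log\Big[\sqrt{\tfrac{\eta-\xi}{\eta+\xi}}\big(\sqrt{\Gamma+1}+\sqrt\Gamma\big)\Big],$$ $$A_{ij}=e^{(-1)^j\theta\tilde s}\,\frac{\sqrt{\eta^2-\xi^2}}{2\theta}\Big((-1)^{i+j+1}\sqrt{\Gamma+1}-\sqrt\Gamma\Big),$$ where $\xi\in(0,\eta)$ is the unique zero in $(0,\eta)$ of $F(x)=2x+\theta c-\eta\log\frac{\eta+x}{\eta-x}$ and $$\Gamma=\frac{\theta(c-\tilde c)}{4\xi}+\frac{\theta c(\lambda-\tilde\lambda)}{4\eta\xi}+\frac{\lambda-\tilde\lambda}{2\eta}.$$ The game. $W$ is a standard one-dimensional Brownian motion on a filtered probability space satisfying the usual conditions. When no player intervenes the state evolves as $dX_s=\sigma\,dW_s$. Player 1 chooses impulses in $Z_1=[0,\infty[$, player 2 in $Z_2=]-\infty,0]$; an impulse $\delta$ moves the state from $x$ to $x+\delta$. A strategy for player $i$ is a pair $\pi_i=(\mathcal{C}_i,\xi_i)$ with $\mathcal{C}_i\subseteq\mathbb{R}$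 open and $\xi_i:\mathbb{R}\to Z_i$ continuous: player $i$ intervenes if and only if the process exits from $\mathcal{C}_i$, with impulse $\xi_i(y)$, where $y$ is the current state. Given $x\in\mathbb{R}$ and strategies $\pi_1,\pi_2$, set (with $\inf\emptyset=\infty$) $\widetilde\tau_0=0$, $x_0=x$, $\widetilde X^0_s=x+\sigma W_s$ and inductively for $k\ge1$ (as long as $\widetilde\tau_{k-1}<\infty$): $\alpha_k^{\mathcal{C}_i}=\inf\{s>\widetilde\tau_{k-1}:\widetilde X^{k-1}_s\notin\mathcal{C}_i\}$; $\widetilde\tau_k=\alpha_k^{\mathcal{C}_1}\wedge\alpha_k^{\mathcal{C}_2}$; $m_k=1$ if $\alpha_k^{\mathcal{C}_1}\le\alpha_k^{\mathcal{C}_2}$, $m_k=2$ otherwise (player 1 has priority); if $\widetilde\tau_k<\infty$, $\widetilde\delta_k=\xi_{m_k}(\widetilde X^{k-1}_{\widetilde\tau_k})$, $x_k=\widetilde X^{k-1}_{\widetilde\tau_k}+\widetilde\delta_k$, and $\widetilde X^k_s=\widetilde X^{k-1}_s$ for $s<\widetilde\tau_k$, $\widetilde X^k_s=x_k+\sigma(W_s-W_{\widetilde\tau_k})$ for $s\ge\widetilde\tau_k$. The times $\widetilde\tau_k$ are assumed not to accumulate at a finite time; $X=X^{x;\pi_1,\pi_2}$ is the resulting process (the last $\widetilde X^k$, or the limit of the $\widetilde X^k$ if there are infinitely many interventions). The impulse control $\{(\tau_{i,k},\delta_{i,k})\}_{k\ge1}$ of player $i$ lists, in order, the pairs $(\widetilde\tau_h,\widetilde\delta_h)$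 with $\widetilde\tau_h<\infty$, $m_h=i$, completed by $(\infty,0)$ if there are finitely many. Payoffs (terms with infinite intervention time are zero): $$J^1(x;\pi_1,\pi_2)=\mathbb{E}_x\Big[\int_0^\infty e^{-\rho s}(X_s-s_1)ds-\sum_{k\ge1}e^{-\rho\tau_{1,k}}(c+\lambda|\delta_{1,k}|)+\sum_{k\ge1}e^{-\rho\tau_{2,k}}(\tilde c+\tilde\lambda|\delta_{2,k}|)\Big],$$ $$J^2(x;\pi_1,\pi_2)=\mathbb{E}_x\Big[\int_0^\infty e^{-\rho s}(s_2-X_s)ds-\sum_{k\ge1}e^{-\rho\tau_{2,k}}(c+\lambda|\delta_{2,k}|)+\sum_{k\ge1}e^{-\rho\tau_{1,k}}(\tilde c+\tilde\lambda|\delta_{1,k}|)\Big].$$ Admissibility. $(\pi_1,\pi_2)\in\Phi_x$ ($x$-admissible) if for $i\in\{1,2\}$: $\int_0^\infty e^{-\rho s}|X_s-s_i|ds$, $\sum_ke^{-\rho\tau_{i,k}}(c+\lambda|\delta_{i,k}|)$ and $\sum_ke^{-\rho\tau_{i,k}}(\tilde c+\tilde\lambda|\delta_{i,k}|)$ are in $L^1(\Omega)$; $\mathbb{E}_x[\sup_{t\ge0}|X_t|^p]<\infty$ for every $p\in\mathbb{N}$; and $\lim_{k\to\infty}\tau_{i,k}=\infty$. Nash equilibrium (for initial state $x$): a pair $(\pi_1^*,\pi_2^* )\in\Phi_x$ with $J^1(x;\pi_1^*,\pi_2^* )\ge J^1(x;\pi_1,\pi_2^* )$ for all $\pi_1$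 with $(\pi_1,\pi_2^* )\in\Phi_x$ and $J^2(x;\pi_1^*,\pi_2^* )\ge J^2(x;\pi_1^*,\pi_2)$ for all $\pi_2$ with $(\pi_1^*,\pi_2)\in\Phi_x$.
   Formalization: Impulse functions ξ_i need take values in Z_i only outside C_i, since ξ_1^*(y)=x_1^*-y is not [0,∞[-valued on all of ℝ; and ξ is assumed to be a zero of F in (0,η), so the case c=0, where no such zero exists, is excluded. *)

theory Defs
  imports "HOL-Probability.Probability"
begin

section \<open>Brownian motion on a filtered probability space\<close>

text \<open>The index set of the filtration is \<open>[0, \<infinity>[\<close>; the values \<open>F t\<close>, \<open>W t\<close> for \<open>t < 0\<close> are unconstrained.\<close>

locale usual_filtered_prob_space = prob_space M + complete_measure M
  for M :: "'a measure" +
  fixes F :: "real \<Rightarrow> 'a measure"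
  assumes subalgebra_F: "0 \<le> t \<Longrightarrow> subalgebra M (F t)"
    and F_mono: "0 \<le> s \<Longrightarrow> s \<le> t \<Longrightarrow> sets (F s) \<subseteq> sets (F t)"
    and null_sets_F: "null_sets M \<subseteq> sets (F 0)"
    and F_right_continuous: "0 \<le> t \<Longrightarrow> sets (F t) = (\<Inter>u\<in>{t<..}. sets (F u))"

locale brownian_motion = usual_filtered_prob_space M F
  for M :: "'a measure" and F :: "real \<Rightarrow> 'a measure" +
  fixes W :: "real \<Rightarrow> 'a \<Rightarrow> real"
  assumes adapted: "0 \<le> t \<Longrightarrow> W t \<in> borel_measurable (F t)"
    and start_zero: "AE \<omega> in M. W 0 \<omega> = 0"
    and continuous_paths: "AE \<omega> in M. continuous_on {0..} (\<lambda>t. W t \<omega>)"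
    and independent_increments: "0 \<le> s \<Longrightarrow> s < t \<Longrightarrow>
      indep_set (sets (F s)) (sets (vimage_algebra (space M) (\<lambda>\<omega>. W t \<omega> - W s \<omega>) borel))"
    and normal_increments: "0 \<le> s \<Longrightarrow> s < t \<Longrightarrow>
      distributed M lborel (\<lambda>\<omega>. W t \<omega> - W s \<omega>) (normal_density 0 (sqrt (t - s)))"


section \<open>The impulse game\<close>

datatype player = Player1 | Player2

record game =
  rho :: real
  sigma :: real
  s1 :: real
  s2 :: real
  c :: real
  c_tilde :: real
  lambda :: real
  lambda_tilde :: real

definition admissible_parameters :: "game \<Rightarrow> bool" where
  "admissible_parameters G \<longleftrightarrow>
     0 < rho G \<and> 0 < sigma G \<and> s1 G < s2 G \<and>
     0 \<le> c_tilde G \<and> c_tilde G \<le> c G \<and>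
     0 \<le> lambda_tilde G \<and> lambda_tilde G \<le> lambda G \<and>
     (c G, lambda G) \<noteq> (c_tilde G, lambda_tilde G) \<and>
     0 < 1 - lambda G * rho G"

fun opponent :: "player \<Rightarrow> player" where
  "opponent Player1 = Player2"
| "opponent Player2 = Player1"

fun impulses :: "player \<Rightarrow> real set" where
  "impulses Player1 = {0..}"
| "impulses Player2 = {..0}"

fun target :: "game \<Rightarrow> player \<Rightarrow> real" where
  "target G Player1 = s1 G"
| "target G Player2 = s2 G"

fun running_payoff :: "game \<Rightarrow> player \<Rightarrow> real \<Rightarrow> real" where
  "running_payoff G Player1 y = y - s1 G"
| "running_payoff G Player2 y = s2 G - y"

text \<open>A strategy is a pair of a continuation region and an impulse function (state to impulse).\<close>

type_synonym strategy = "real set \<times> (real \<Rightarrow> real)"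

text \<open>
  The impulse function is required to take values in \<open>Z\<^sub>i\<close> only off the continuation region.
  These are the only points at which it is ever evaluated: the region is open and the
  trajectories are right-continuous, so the state at an exit time lies outside it. Requiring the
  values to be in \<open>Z\<^sub>i\<close> on the whole line would exclude \<open>y \<mapsto> x\<^sub>1\<^sup>* - y\<close>, which is negative for
  \<open>y > x\<^sub>1\<^sup>*\<close>; replacing an impulse function by its positive (negative) part shows that no new
  controls arise from the present condition.
\<close>

definition is_strategy :: "player \<Rightarrow> strategy \<Rightarrow> bool" where
  "is_strategy i p \<longleftrightarrow>
     open (fst p) \<and> continuous_on UNIV (snd p) \<and> (\<forall>y. y \<notin> fst p \<longrightarrow> snd p y \<in> impulses i)"


subsection \<open>The controlled trajectory\<close>

text \<open>
  Everything here is pathwise: \<open>w\<close> stands for the path \<open>s \<mapsto> W\<^sub>s(\<omega>)\<close>. The \<open>k\<close>-th stage holds the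
  intervention time, the intervening player and the impulse of the \<open>k\<close>-th intervention, and the
  trajectory after it. Only \<open>traj\<close> and \<open>time = 0\<close> are meaningful at stage 0. Once an intervention
  time is infinite, so are all later ones, and the trajectory no longer changes.
\<close>

record stage =
  time :: ereal
  who :: player
  impulse :: real
  traj :: "real \<Rightarrow> real"

definition exit_time :: "real set \<Rightarrow> (real \<Rightarrow> real) \<Rightarrow> ereal \<Rightarrow> ereal" where
  "exit_time C X t = Inf (ereal ` {s. t < ereal s \<and> X s \<notin> C})"

definition next_stage ::
  "real \<Rightarrow> (player \<Rightarrow> strategy) \<Rightarrow> (real \<Rightarrow> real) \<Rightarrow> stage \<Rightarrow> stage" where
  "next_stage sig \<pi> w S =
    (let Y = traj S;
         \<alpha>1 = exit_time (fst (\<pi> Player1)) Y (time S);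
         \<alpha>2 = exit_time (fst (\<pi> Player2)) Y (time S);
         \<tau> = min \<alpha>1 \<alpha>2;
         m = (if \<alpha>1 \<le> \<alpha>2 then Player1 else Player2)
     in if \<tau> = \<infinity> then \<lparr>time = \<infinity>, who = m, impulse = 0, traj = Y\<rparr>
        else let t = real_of_ereal \<tau>;
                 \<delta> = snd (\<pi> m) (Y t);
                 y = Y t + \<delta>
             in \<lparr>time = \<tau>, who = m, impulse = \<delta>,
                  traj = (\<lambda>s. if s < t then Y s else y + sig * (w s - w t))\<rparr>)"

primrec stages ::
  "real \<Rightarrow> (player \<Rightarrow> strategy) \<Rightarrow> real \<Rightarrow> (real \<Rightarrow> real) \<Rightarrow> nat \<Rightarrow> stage" where
  "stages sig \<pi> x w 0 =
     \<lparr>time = 0, who = Player1, impulse = 0, traj = (\<lambda>s. x + sig * w s)\<rparr>"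
| "stages sig \<pi> x w (Suc k) = next_stage sig \<pi> w (stages sig \<pi> x w k)"

text \<open>
  If the intervention times do not accumulate at a finite time, the sequence below is eventually
  constant for every \<open>s \<ge> 0\<close>.
\<close>

definition state :: "real \<Rightarrow> (player \<Rightarrow> strategy) \<Rightarrow> real \<Rightarrow> (real \<Rightarrow> real) \<Rightarrow> real \<Rightarrow> real" where
  "state sig \<pi> x w s = lim (\<lambda>k. traj (stages sig \<pi> x w k) s)"

definition interventions ::
  "real \<Rightarrow> (player \<Rightarrow> strategy) \<Rightarrow> real \<Rightarrow> (real \<Rightarrow> real) \<Rightarrow> player \<Rightarrow> nat set" where
  "interventions sig \<pi> x w i =
     {h. 1 \<le> h \<and> time (stages sig \<pi> x w h) < \<infinity> \<and> who (stages sig \<pi> x w h) = i}"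

text \<open>The impulse control of player \<open>i\<close>, numbered from 0.\<close>

definition control ::
  "real \<Rightarrow> (player \<Rightarrow> strategy) \<Rightarrow> real \<Rightarrow> (real \<Rightarrow> real) \<Rightarrow> player \<Rightarrow> nat \<Rightarrow> ereal \<times> real" where
  "control sig \<pi> x w i k =
    (let H = interventions sig \<pi> x w i
     in if infinite H \<or> k < card H
        then let S = stages sig \<pi> x w (enumerate H k) in (time S, impulse S)
        else (\<infinity>, 0))"


subsection \<open>Payoffs, admissibility, equilibria\<close>

definition discounted :: "real \<Rightarrow> real \<Rightarrow> real \<Rightarrow> ereal \<times> real \<Rightarrow> real" where
  "discounted r a b u =
    (if fst u = \<infinity> then 0 else exp (- r * real_of_ereal (fst u)) * (a + b * \<bar>snd u\<bar>))"

text \<open>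
  The series have nonnegative terms; for admissible strategies they converge almost surely and
  the integrand is integrable.
\<close>

definition payoff ::
  "game \<Rightarrow> 'a measure \<Rightarrow> (real \<Rightarrow> 'a \<Rightarrow> real) \<Rightarrow> player \<Rightarrow> real \<Rightarrow> (player \<Rightarrow> strategy) \<Rightarrow> real" where
  "payoff G M W i x \<pi> =
    (LINT \<omega>|M.
       (LINT s:{0..}|lborel.
          exp (- rho G * s) * running_payoff G i (state (sigma G) \<pi> x (\<lambda>t. W t \<omega>) s))
       - (\<Sum>k. discounted (rho G) (c G) (lambda G)
                 (control (sigma G) \<pi> x (\<lambda>t. W t \<omega>) i k))
       + (\<Sum>k. discounted (rho G) (c_tilde G) (lambda_tilde G)
                 (control (sigma G) \<pi> x (\<lambda>t. W t \<omega>) (opponent i) k)))"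

definition integrable_nonneg :: "'a measure \<Rightarrow> ('a \<Rightarrow> ennreal) \<Rightarrow> bool" where
  "integrable_nonneg M f \<longleftrightarrow> f \<in> borel_measurable M \<and> (\<integral>\<^sup>+ \<omega>. f \<omega> \<partial>M) < \<infinity>"

text \<open>
  Integrals and series of nonnegative terms are formed in \<open>ennreal\<close>, so that their divergence is
  not masked by a default value. The last condition also excludes, almost surely, that the
  intervention times accumulate at a finite time.
\<close>

definition admissible ::
  "game \<Rightarrow> 'a measure \<Rightarrow> (real \<Rightarrow> 'a \<Rightarrow> real) \<Rightarrow> real \<Rightarrow> (player \<Rightarrow> strategy) \<Rightarrow> bool" where
  "admissible G M W x \<pi> \<longleftrightarrow>
    (\<forall>i. is_strategy i (\<pi> i)) \<and>
    (\<forall>i. integrable_nonneg M (\<lambda>\<omega>. \<integral>\<^sup>+ s\<in>{0..}.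
           ennreal (exp (- rho G * s) * \<bar>state (sigma G) \<pi> x (\<lambda>t. W t \<omega>) s - target G i\<bar>) \<partial>lborel)) \<and>
    (\<forall>i. integrable_nonneg M (\<lambda>\<omega>. \<Sum>k.
           ennreal (discounted (rho G) (c G) (lambda G)
             (control (sigma G) \<pi> x (\<lambda>t. W t \<omega>) i k)))) \<and>
    (\<forall>i. integrable_nonneg M (\<lambda>\<omega>. \<Sum>k.
           ennreal (discounted (rho G) (c_tilde G) (lambda_tilde G)
             (control (sigma G) \<pi> x (\<lambda>t. W t \<omega>) i k)))) \<and>
    (\<forall>p::nat. integrable_nonneg M (\<lambda>\<omega>. \<Squnion>t\<in>{0..}.
           ennreal (\<bar>state (sigma G) \<pi> x (\<lambda>t. W t \<omega>) t\<bar> ^ p))) \<and>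
    (\<forall>i. AE \<omega> in M. (\<lambda>k. fst (control (sigma G) \<pi> x (\<lambda>t. W t \<omega>) i k)) \<longlonglongrightarrow> \<infinity>)"

definition nash_equilibrium ::
  "game \<Rightarrow> 'a measure \<Rightarrow> (real \<Rightarrow> 'a \<Rightarrow> real) \<Rightarrow> real \<Rightarrow> (player \<Rightarrow> strategy) \<Rightarrow> bool" where
  "nash_equilibrium G M W x \<pi> \<longleftrightarrow>
    admissible G M W x \<pi> \<and>
    (\<forall>i p. admissible G M W x (\<pi>(i := p)) \<longrightarrow>
       payoff G M W i x (\<pi>(i := p)) \<le> payoff G M W i x \<pi>)"


section \<open>The candidate equilibrium\<close>

definition theta :: "game \<Rightarrow> real" where
  "theta G = sqrt (2 * rho G / (sigma G)\<^sup>2)"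

definition eta :: "game \<Rightarrow> real" where
  "eta G = (1 - lambda G * rho G) / rho G"

definition xi_fun :: "game \<Rightarrow> real \<Rightarrow> real" where
  "xi_fun G y = 2 * y + theta G * c G - eta G * ln ((eta G + y) / (eta G - y))"

text \<open>
  The function above has at most one zero in \<open>]0, \<eta>[\<close>, and has one exactly if \<open>c > 0\<close>;
  hence the zero is a parameter of what follows and not obtained by a choice operator.
\<close>

definition is_xi :: "game \<Rightarrow> real \<Rightarrow> bool" where
  "is_xi G \<xi> \<longleftrightarrow> 0 < \<xi> \<and> \<xi> < eta G \<and> xi_fun G \<xi> = 0"

definition Gam :: "game \<Rightarrow> real \<Rightarrow> real" where
  "Gam G \<xi> =
     theta G * (c G - c_tilde G) / (4 * \<xi>)
     + theta G * c G * (lambda G - lambda_tilde G) / (4 * eta G * \<xi>)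
     + (lambda G - lambda_tilde G) / (2 * eta G)"

text \<open>The indices \<open>i\<close>, \<open>j\<close> range over 1 and 2; \<open>st\<close> is the index of the solution.\<close>

definition x_bar :: "game \<Rightarrow> real \<Rightarrow> real \<Rightarrow> nat \<Rightarrow> real" where
  "x_bar G \<xi> st i = st + (- 1) ^ i / theta G *
     ln (sqrt ((eta G + \<xi>) / (eta G - \<xi>)) * (sqrt (Gam G \<xi> + 1) + sqrt (Gam G \<xi>)))"

definition x_star :: "game \<Rightarrow> real \<Rightarrow> real \<Rightarrow> nat \<Rightarrow> real" where
  "x_star G \<xi> st i = st + (- 1) ^ i / theta G *
     ln (sqrt ((eta G - \<xi>) / (eta G + \<xi>)) * (sqrt (Gam G \<xi> + 1) + sqrt (Gam G \<xi>)))"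

definition A_coeff :: "game \<Rightarrow> real \<Rightarrow> real \<Rightarrow> nat \<Rightarrow> nat \<Rightarrow> real" where
  "A_coeff G \<xi> st i j =
     exp ((- 1) ^ j * theta G * st) * (sqrt ((eta G)\<^sup>2 - \<xi>\<^sup>2) / (2 * theta G)) *
     ((- 1) ^ (i + j + 1) * sqrt (Gam G \<xi> + 1) - sqrt (Gam G \<xi>))"

definition phi1 :: "game \<Rightarrow> real \<Rightarrow> real \<Rightarrow> real \<Rightarrow> real" where
  "phi1 G \<xi> st x =
     A_coeff G \<xi> st 1 1 * exp (theta G * x) + A_coeff G \<xi> st 1 2 * exp (- theta G * x)
     + (x - s1 G) / rho G"

definition phi2 :: "game \<Rightarrow> real \<Rightarrow> real \<Rightarrow> real \<Rightarrow> real" where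
  "phi2 G \<xi> st x =
     A_coeff G \<xi> st 2 1 * exp (theta G * x) + A_coeff G \<xi> st 2 2 * exp (- theta G * x)
     + (s2 G - x) / rho G"

definition V1_tilde :: "game \<Rightarrow> real \<Rightarrow> real \<Rightarrow> real \<Rightarrow> real" where
  "V1_tilde G \<xi> st x =
    (if x \<le> x_bar G \<xi> st 1 then
       phi1 G \<xi> st (x_star G \<xi> st 1) - c G - lambda G * (x_star G \<xi> st 1 - x)
     else if x < x_bar G \<xi> st 2 then phi1 G \<xi> st x
     else phi1 G \<xi> st (x_star G \<xi> st 2) + c_tilde G + lambda_tilde G * (x - x_star G \<xi> st 2))"

definition V2_tilde :: "game \<Rightarrow> real \<Rightarrow> real \<Rightarrow> real \<Rightarrow> real" where
  "V2_tilde G \<xi> st x =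
    (if x \<le> x_bar G \<xi> st 1 then
       phi2 G \<xi> st (x_star G \<xi> st 1) + c_tilde G + lambda_tilde G * (x_star G \<xi> st 1 - x)
     else if x < x_bar G \<xi> st 2 then phi2 G \<xi> st x
     else phi2 G \<xi> st (x_star G \<xi> st 2) - c G - lambda G * (x - x_star G \<xi> st 2))"

fun candidate :: "game \<Rightarrow> real \<Rightarrow> real \<Rightarrow> player \<Rightarrow> strategy" where
  "candidate G \<xi> st Player1 = ({x_bar G \<xi> st 1 <..}, \<lambda>y. x_star G \<xi> st 1 - y)"
| "candidate G \<xi> st Player2 = ({..< x_bar G \<xi> st 2}, \<lambda>y. x_star G \<xi> st 2 - y)"

end

theory Submission
  imports Defs
begin

text \<open>
  Ito's formula is not needed. On the region where the other player does not intervene, each value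
  function is the lower envelope of a family of functions
  \<open>a exp (\<theta> y) + b exp (- \<theta> y) + running_payoff y / \<rho>\<close>, one touching it at each point. Discounted
  and augmented by the accrued running payoff, such a function of \<open>x + \<sigma> W\<close> is a martingale built
  from \<open>exp (\<plusminus> \<theta> \<sigma> W t - \<rho> t)\<close> and \<open>W\<close>, so optional stopping between consecutive interventions
  makes the value function a supermartingale along every admissible play; the quasi-variational
  inequalities take care of the interventions themselves. Against the candidate strategies the
  envelope is a single function between the two thresholds, and all inequalities become equalities.
\<close>

text \<open>Three obstacles shape the argument. A deviation is arbitrary, so several interventions
  may share one instant, and the positions between them are not values of the state. The growth of
  the value function is therefore measured in units of \<open>lambda G * \<bar>y\<bar>\<close>, a
  quantity controlled by the integrable intervention costs, also when \<open>lambda G = 0\<close>.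
  Next, a stage may begin outside the region where the envelope is available; some player then acts
  at once, so the stage has length zero and contributes nothing. Finally, admissibility of the
  candidate pair is itself a claim: the expected discounted number of interventions is bounded by
  means of a second test function, which drops by a fixed amount at each intervention. The lower
  bound on the candidate payoff is the same verification inequality, applied to the negated value
  function. Completeness makes it possible to work with a version of the Brownian motion all of
  whose paths are continuous, so that every construction on paths holds without exceptional
  sets.\<close>

section \<open>Almost sure equality on a complete measure space\<close>

lemma (in complete_measure) borel_measurable_AE_cong:
  fixes f g :: "'a \<Rightarrow> 'b::topological_space"
  assumes f: "f \<in> borel_measurable M" and ae: "AE \<omega> in M. f \<omega> = g \<omega>"
  shows "g \<in> borel_measurable M"
proof (rule borel_measurableI)
  fix S :: "'b set" assume "open S"
  then have "f -` S \<inter> space M \<in> sets M" using f by (auto intro: measurable_sets)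
  moreover have "AE \<omega> in M. \<omega> \<in> f -` S \<inter> space M \<longleftrightarrow> \<omega> \<in> g -` S \<inter> space M"
    using ae by eventually_elim auto
  ultimately show "g -` S \<inter> space M \<in> sets M"
    using in_sets_AE by blast
qed

lemma (in complete_measure) borel_measurable_AE_cong_iff:
  assumes "AE \<omega> in M. f \<omega> = g \<omega>"
  shows "f \<in> borel_measurable M \<longleftrightarrow> g \<in> borel_measurable M"
proof -
  have "AE \<omega> in M. g \<omega> = f \<omega>" using assms by eventually_elim auto
  then show ?thesis using assms borel_measurable_AE_cong by blast
qed

text \<open>By completeness \<open>f\<close> and \<open>g\<close> are both measurable or both not,
  and in the second case both integrals have the default value 0. Payoffs can thus be compared
  before anything is known about the measurability of their integrands.\<close>

lemma (in complete_measure) integral_cong_AE_complete: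
  fixes f g :: "'a \<Rightarrow> real"
  assumes ae: "AE \<omega> in M. f \<omega> = g \<omega>"
  shows "integral\<^sup>L M f = integral\<^sup>L M g"
proof (cases "f \<in> borel_measurable M")
  case True
  then show ?thesis using ae borel_measurable_AE_cong[OF True ae] by (intro integral_cong_AE) auto
next
  case False
  then have "g \<notin> borel_measurable M" using borel_measurable_AE_cong_iff[OF ae] by simp
  with False have "\<not> integrable M f" "\<not> integrable M g" by auto
  then show ?thesis by (simp add: not_integrable_integral_eq)
qed

section \<open>Right-continuous processes and stopping times\<close>

text \<open>Joint measurability, by discretising time from the right. Applied to a process frozen at
  time \<open>t\<close> and to \<open>N = F t\<close>, it is progressive measurability. The maximum
  discards negative times, where nothing is assumed about \<open>Z\<close>.\<close>

lemma measurable_right_continuous_process: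
  fixes Z :: "real \<Rightarrow> 'a \<Rightarrow> real"
  assumes Z: "\<And>s. 0 \<le> s \<Longrightarrow> Z s \<in> borel_measurable N"
    and rc: "\<And>\<omega> s. \<omega> \<in> space N \<Longrightarrow> 0 \<le> s \<Longrightarrow> ((\<lambda>u. Z u \<omega>) \<longlongrightarrow> Z s \<omega>) (at_right s)"
  shows "(\<lambda>(\<omega>, s). Z (max 0 s) \<omega>) \<in> borel_measurable (N \<Otimes>\<^sub>M borel)"
proof -
  \<comment> \<open>The added 1 makes \<open>q n s\<close> strictly larger than
    \<open>max 0 s\<close>, also at grid points, so that right limits apply everywhere.\<close>
  define q where "q n s = real_of_int (\<lfloor>real (Suc n) * max 0 s\<rfloor> + 1) / real (Suc n)" for n and s :: real
  have q_gt: "max 0 s < q n s" and q_le: "q n s \<le> max 0 s + 1 / real (Suc n)" for n s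
  proof -
    have "real (Suc n) * max 0 s < real_of_int (\<lfloor>real (Suc n) * max 0 s\<rfloor> + 1)"
      "real_of_int (\<lfloor>real (Suc n) * max 0 s\<rfloor> + 1) \<le> real (Suc n) * max 0 s + 1" by linarith+
    then show "max 0 s < q n s" unfolding q_def
      by (metis mult.commute of_nat_0_less_iff pos_less_divide_eq zero_less_Suc)
    show "q n s \<le> max 0 s + 1 / real (Suc n)" unfolding q_def
      using \<open>_ \<le> real (Suc n) * max 0 s + 1\<close>
      by (simp add: pos_divide_le_eq mult.commute[of _ "real (Suc n)"] distrib_left del: of_nat_Suc of_int_add)
  qed
  have "(\<lambda>(\<omega>, s). Z (q n s) \<omega>) \<in> borel_measurable (N \<Otimes>\<^sub>M borel)" for n
  proof -
    have "Z (max 0 (real_of_int (i + 1) / real (Suc n))) \<in> borel_measurable N" for i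
      by (rule Z) simp
    then have "(\<lambda>p. Z (max 0 (real_of_int (i + 1) / real (Suc n))) (fst p)) \<in> borel_measurable (N \<Otimes>\<^sub>M borel)" for i
      by measurable
    moreover have "(\<lambda>p. \<lfloor>real (Suc n) * max 0 (snd p)\<rfloor>) \<in> measurable (N \<Otimes>\<^sub>M borel) (count_space UNIV)"
      by measurable
    ultimately have "(\<lambda>p. Z (max 0 (real_of_int (\<lfloor>real (Suc n) * max 0 (snd p)\<rfloor> + 1) / real (Suc n))) (fst p))
        \<in> borel_measurable (N \<Otimes>\<^sub>M borel)"
      by (rule measurable_compose_countable)
    moreover have "max 0 (q n s) = q n s" for s using q_gt[of s n] by auto
    ultimately show ?thesis unfolding q_def by (simp add: split_beta)
  qed
  moreover have "(\<lambda>n. (\<lambda>(\<omega>, s). Z (q n s) \<omega>) p) \<longlonglongrightarrow> (\<lambda>(\<omega>, s). Z (max 0 s) \<omega>) p"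
    if "p \<in> space (N \<Otimes>\<^sub>M borel)" for p
  proof -
    obtain \<omega> s where p: "p = (\<omega>, s)" "\<omega> \<in> space N"
      using \<open>p \<in> space (N \<Otimes>\<^sub>M borel)\<close> by (auto simp: space_pair_measure)
    have "(\<lambda>n. max 0 s + 1 / real (Suc n)) \<longlonglongrightarrow> max 0 s"
      using tendsto_add[OF tendsto_const LIMSEQ_inverse_real_of_nat, of "max 0 s"]
      by (simp add: inverse_eq_divide)
    then have "(\<lambda>n. q n s) \<longlonglongrightarrow> max 0 s"
      by (rule tendsto_sandwich[OF _ _ tendsto_const[of "max 0 s"], rotated 2])
        (intro always_eventually allI less_imp_le[OF q_gt] q_le)+
    then have "filterlim (\<lambda>n. q n s) (at_right (max 0 s)) sequentially"
      unfolding filterlim_at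
    proof (intro conjI always_eventually allI)
      show "q n s \<in> {max 0 s<..}" "q n s \<noteq> max 0 s" for n using q_gt[of s n] by auto
    qed
    from filterlim_compose[OF rc[OF p(2)] this] show ?thesis by (simp add: p)
  qed
  ultimately show ?thesis by (rule borel_measurable_LIMSEQ_real[rotated])
qed

text \<open>Truncation at the horizon turns a possibly infinite time into a real one, at which
  processes can be evaluated.\<close>

definition capped :: "ereal \<Rightarrow> real \<Rightarrow> real" where
  "capped u T = real_of_ereal (min u (ereal T))"

lemma ereal_capped: "0 \<le> u \<Longrightarrow> ereal (capped u T) = min u (ereal T)"
  unfolding capped_def by (cases u) (auto simp: min_def)

lemma capped_le: "0 \<le> u \<Longrightarrow> capped u T \<le> T"
  by (cases u) (auto simp: capped_def min_def)

lemma capped_nonneg: "0 \<le> u \<Longrightarrow> 0 \<le> T \<Longrightarrow> 0 \<le> capped u T"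
  by (cases u) (auto simp: capped_def min_def)

lemma capped_mono: "0 \<le> u \<Longrightarrow> u \<le> v \<Longrightarrow> capped u T \<le> capped v T"
  by (cases u; cases v) (auto simp: capped_def min_def)

lemma capped_finite: "0 \<le> u \<Longrightarrow> u \<le> ereal T \<Longrightarrow> ereal (capped u T) = u"
  by (simp add: ereal_capped min_def)

lemma capped_ge: "ereal T \<le> u \<Longrightarrow> capped u T = T"
  by (simp add: capped_def min_def)

section \<open>Stopping times and quantities known at them\<close>

context usual_filtered_prob_space
begin

lemma space_F [simp]: "0 \<le> t \<Longrightarrow> space (F t) = space M"
  using subalgebra_F by (auto simp: subalgebra_def)

lemma sets_F_subset: "0 \<le> t \<Longrightarrow> sets (F t) \<subseteq> sets M"
  using subalgebra_F by (auto simp: subalgebra_def)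

lemma subalgebra_F_mono: "0 \<le> s \<Longrightarrow> s \<le> t \<Longrightarrow> subalgebra (F t) (F s)"
  using F_mono by (auto simp: subalgebra_def)

lemma measurable_F_mono: "f \<in> measurable (F s) N \<Longrightarrow> 0 \<le> s \<Longrightarrow> s \<le> t \<Longrightarrow> f \<in> measurable (F t) N"
  using measurable_from_subalg[OF subalgebra_F_mono] by blast

lemma measurable_F_M: "f \<in> measurable (F s) N \<Longrightarrow> 0 \<le> s \<Longrightarrow> f \<in> measurable M N"
  using measurable_from_subalg[OF subalgebra_F] by blast

definition stopping :: "('a \<Rightarrow> ereal) \<Rightarrow> bool" where
  "stopping \<tau> \<longleftrightarrow> (\<forall>\<omega>. 0 \<le> \<tau> \<omega>) \<and> (\<forall>t\<ge>0. {\<omega> \<in> space M. \<tau> \<omega> \<le> ereal t} \<in> sets (F t))"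

text \<open>Measurability with respect to the stopped sigma-algebra, written without forming that
  algebra. Values where \<tau> is infinite are unconstrained, so default values there do no
  harm.\<close>

definition known_at :: "('a \<Rightarrow> ereal) \<Rightarrow> ('a \<Rightarrow> real) \<Rightarrow> bool" where
  "known_at \<tau> \<zeta> \<longleftrightarrow> (\<forall>t\<ge>0. (\<lambda>\<omega>. if \<tau> \<omega> \<le> ereal t then \<zeta> \<omega> else 0) \<in> borel_measurable (F t))"

lemma stopping_nonneg: "stopping \<tau> \<Longrightarrow> 0 \<le> \<tau> \<omega>"
  by (simp add: stopping_def)

lemma stoppingD: "stopping \<tau> \<Longrightarrow> 0 \<le> t \<Longrightarrow> {\<omega> \<in> space M. \<tau> \<omega> \<le> ereal t} \<in> sets (F t)"
  by (simp add: stopping_def)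

lemma stopping_pred: "stopping \<tau> \<Longrightarrow> 0 \<le> t \<Longrightarrow> Measurable.pred (F t) (\<lambda>\<omega>. \<tau> \<omega> \<le> ereal t)"
  using stoppingD by (simp add: pred_def)

lemma known_atD: "known_at \<tau> \<zeta> \<Longrightarrow> 0 \<le> t \<Longrightarrow>
    (\<lambda>\<omega>. if \<tau> \<omega> \<le> ereal t then \<zeta> \<omega> else 0) \<in> borel_measurable (F t)"
  by (simp add: known_at_def)

lemma capped_measurable:
  assumes \<tau>: "stopping \<tau>" and t: "0 \<le> t"
  shows "(\<lambda>\<omega>. capped (\<tau> \<omega>) t) \<in> borel_measurable (F t)"
proof (rule borel_measurableI_le)
  fix a
  have eq: "capped (\<tau> \<omega>) t \<le> a \<longleftrightarrow> t \<le> a \<or> (0 \<le> a \<and> \<tau> \<omega> \<le> ereal a)" for \<omega>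
    using stopping_nonneg[OF \<tau>, of \<omega>] t
    by (cases "\<tau> \<omega>") (auto simp: capped_def min_def)
  show "{\<omega> \<in> space (F t). capped (\<tau> \<omega>) t \<le> a} \<in> sets (F t)"
  proof (cases "t \<le> a \<or> a < 0")
    case True
    then show ?thesis
    proof
      assume "t \<le> a"
      then show ?thesis using sets.top[of "F t"] by (simp add: eq)
    qed (use t in \<open>auto simp: eq\<close>)
  next
    case False
    then have "{\<omega> \<in> space (F t). capped (\<tau> \<omega>) t \<le> a} = {\<omega> \<in> space M. \<tau> \<omega> \<le> ereal a}"
      using t by (auto simp: eq)
    also have "\<dots> \<in> sets (F a)" using False by (intro stoppingD \<tau>) auto
    finally show ?thesis using False F_mono[of a t] by auto
  qed
qed

lemma stopping_measurable_M:
  assumes \<tau>: "stopping \<tau>"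
  shows "\<tau> \<in> borel_measurable M"
proof -
  have le: "{\<omega> \<in> space M. \<tau> \<omega> \<le> ereal a} \<in> sets M" if "0 \<le> a" for a
    using stoppingD[OF \<tau> that] sets_F_subset[OF that] by blast
  have "{\<omega> \<in> space M. \<tau> \<omega> \<le> b} \<in> sets M" for b
  proof (cases "0 \<le> b")
    case False
    then have "{\<omega> \<in> space M. \<tau> \<omega> \<le> b} = {}"
      using stopping_nonneg[OF \<tau>] order_trans by blast
    then show ?thesis by (metis sets.empty_sets)
  qed (use le in \<open>cases b; auto\<close>)
  then show ?thesis by (intro borel_measurableI_le) auto
qed

lemma known_at_mult: "known_at \<tau> \<zeta> \<Longrightarrow> known_at \<tau> \<psi> \<Longrightarrow> known_at \<tau> (\<lambda>\<omega>. \<zeta> \<omega> * \<psi> \<omega>)"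
  unfolding known_at_def
proof safe
  fix t :: real assume t: "0 \<le> t"
  assume "\<forall>t\<ge>0. (\<lambda>\<omega>. if \<tau> \<omega> \<le> ereal t then \<zeta> \<omega> else 0) \<in> borel_measurable (F t)"
    "\<forall>t\<ge>0. (\<lambda>\<omega>. if \<tau> \<omega> \<le> ereal t then \<psi> \<omega> else 0) \<in> borel_measurable (F t)"
  with t have "(\<lambda>\<omega>. (if \<tau> \<omega> \<le> ereal t then \<zeta> \<omega> else 0) * (if \<tau> \<omega> \<le> ereal t then \<psi> \<omega> else 0))
      \<in> borel_measurable (F t)" by (intro borel_measurable_times) auto
  then show "(\<lambda>\<omega>. if \<tau> \<omega> \<le> ereal t then \<zeta> \<omega> * \<psi> \<omega> else 0) \<in> borel_measurable (F t)"
    by (rule measurable_cong[THEN iffD1, rotated]) auto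
qed

lemma known_at_compose:
  assumes \<tau>: "stopping \<tau>" and k: "known_at \<tau> \<zeta>" and [measurable]: "h \<in> borel_measurable borel"
  shows "known_at \<tau> (\<lambda>\<omega>. h (\<zeta> \<omega>))"
  unfolding known_at_def
proof safe
  fix t :: real assume t: "0 \<le> t"
  note [measurable] = stopping_pred[OF \<tau> t] known_atD[OF k t]
  have "(\<lambda>\<omega>. if \<tau> \<omega> \<le> ereal t then h (if \<tau> \<omega> \<le> ereal t then \<zeta> \<omega> else 0) else 0) \<in> borel_measurable (F t)"
    by measurable
  then show "(\<lambda>\<omega>. if \<tau> \<omega> \<le> ereal t then h (\<zeta> \<omega>) else 0) \<in> borel_measurable (F t)"
    by (rule measurable_cong[THEN iffD1, rotated]) auto
qed

text \<open>Progressive measurability: the process frozen at \<open>t\<close> is jointly measurable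
  over \<open>F t\<close>, and the capped time is \<open>F t\<close>-measurable, so their
  composition is too.\<close>

lemma known_at_process:
  assumes \<tau>: "stopping \<tau>"
    and Y: "\<And>s. 0 \<le> s \<Longrightarrow> Y s \<in> borel_measurable (F s)"
    and rc: "\<And>\<omega> s. \<omega> \<in> space M \<Longrightarrow> 0 \<le> s \<Longrightarrow> ((\<lambda>u. Y u \<omega>) \<longlongrightarrow> Y s \<omega>) (at_right s)"
  shows "known_at \<tau> (\<lambda>\<omega>. Y (real_of_ereal (\<tau> \<omega>)) \<omega>)"
  unfolding known_at_def
proof safe
  fix t :: real assume t: "0 \<le> t"
  note [measurable] = stopping_pred[OF \<tau> t] capped_measurable[OF \<tau> t]
  have [measurable]: "(\<lambda>(\<omega>, s). Y (min (max 0 s) t) \<omega>) \<in> borel_measurable (F t \<Otimes>\<^sub>M borel)"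
  proof (rule measurable_right_continuous_process[where Z = "\<lambda>s. Y (min s t)"])
    show "Y (min s t) \<in> borel_measurable (F t)" if "0 \<le> s" for s
      using Y[of "min s t"] t that by (auto intro: measurable_F_mono)
    fix \<omega> s assume \<omega>: "\<omega> \<in> space (F t)" and s: "(0::real) \<le> s"
    show "((\<lambda>u. Y (min u t) \<omega>) \<longlongrightarrow> Y (min s t) \<omega>) (at_right s)"
    proof (cases "s < t")
      case True
      then have "\<forall>\<^sub>F u in at_right s. Y (min u t) \<omega> = Y u \<omega>"
        using eventually_at_right_less[of s] eventually_at_right_field
        by (auto simp: eventually_at_right_field intro!: exI[of _ t])
      then show ?thesis using rc[of \<omega> s] \<omega> s t True by (simp add: tendsto_cong)
    next
      case False
      have "\<forall>\<^sub>F u in at_right s. Y (min u t) \<omega> = Y (min s t) \<omega>"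
        using eventually_at_right_less[of s] by eventually_elim (use False in \<open>auto simp: min_def\<close>)
      then show ?thesis by (rule tendsto_eventually)
    qed
  qed
  have "(\<lambda>\<omega>. (\<lambda>(\<omega>, s). Y (min (max 0 s) t) \<omega>) (\<omega>, capped (\<tau> \<omega>) t)) \<in> borel_measurable (F t)"
    by measurable
  then have [measurable]: "(\<lambda>\<omega>. Y (min (max 0 (capped (\<tau> \<omega>) t)) t) \<omega>) \<in> borel_measurable (F t)"
    by simp
  have "(\<lambda>\<omega>. if \<tau> \<omega> \<le> ereal t then Y (min (max 0 (capped (\<tau> \<omega>) t)) t) \<omega> else 0) \<in> borel_measurable (F t)"
    by measurable
  moreover have "min (max 0 (capped (\<tau> \<omega>) t)) t = real_of_ereal (\<tau> \<omega>)" if "\<tau> \<omega> \<le> ereal t" for \<omega>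
    using that stopping_nonneg[OF \<tau>, of \<omega>] by (cases "\<tau> \<omega>") (auto simp: capped_def min_def)
  ultimately show "(\<lambda>\<omega>. if \<tau> \<omega> \<le> ereal t then Y (real_of_ereal (\<tau> \<omega>)) \<omega> else 0) \<in> borel_measurable (F t)"
    by (simp cong: if_cong)
qed

text \<open>The event \<open>\<tau> \<le> t\<close> is a countable intersection of events
  \<open>\<tau> < r n\<close> with \<open>r n\<close> decreasing to \<open>t\<close>. It therefore
  lies in every \<open>F u\<close> with \<open>u > t\<close>, hence in \<open>F t\<close> by
  right-continuity of the filtration.\<close>

lemma stoppingI_less:
  assumes nn: "\<And>\<omega>. 0 \<le> \<tau> \<omega>" and less: "\<And>t. 0 < t \<Longrightarrow> {\<omega> \<in> space M. \<tau> \<omega> < ereal t} \<in> sets (F t)"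
  shows "stopping \<tau>"
  unfolding stopping_def
proof safe
  fix t :: real assume t: "0 \<le> t"
  have "{\<omega> \<in> space M. \<tau> \<omega> \<le> ereal t} \<in> sets (F u)" if u: "t < u" for u
  proof -
    define r where "r n = t + (u - t) / real (Suc n)" for n
    have r: "t < r n" "r n \<le> u" for n
      using u divide_left_mono[of 1 "real (Suc n)" "u - t"] unfolding r_def by auto
    have r_lim: "r \<longlonglongrightarrow> t"
      unfolding r_def using tendsto_add[OF tendsto_const tendsto_mult[OF tendsto_const LIMSEQ_inverse_real_of_nat], of t "u - t"]
      by (simp add: field_simps inverse_eq_divide)
    have "{\<omega> \<in> space M. \<tau> \<omega> \<le> ereal t} = (\<Inter>n. {\<omega> \<in> space M. \<tau> \<omega> < ereal (r n)})"
    proof safe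
      fix \<omega> n assume "\<tau> \<omega> \<le> ereal t"
      then show "\<tau> \<omega> < ereal (r n)" using r(1)[of n] by (meson ereal_less(5) le_less_trans less_ereal.simps(1))
    next
      fix \<omega> assume "\<omega> \<in> (\<Inter>n. {\<omega> \<in> space M. \<tau> \<omega> < ereal (r n)})"
      then have "\<And>n. \<tau> \<omega> \<le> ereal (r n)" by (auto intro: less_imp_le)
      moreover have "(\<lambda>n. ereal (r n)) \<longlonglongrightarrow> ereal t" using r_lim by simp
      ultimately show "\<tau> \<omega> \<le> ereal t" by (intro LIMSEQ_le_const[of "\<lambda>n. ereal (r n)"]) auto
    qed auto
    moreover have "{\<omega> \<in> space M. \<tau> \<omega> < ereal (r n)} \<in> sets (F u)" for n
      using less[of "r n"] F_mono[of "r n" u] r[of n] t by auto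
    ultimately show ?thesis by auto
  qed
  then show "{\<omega> \<in> space M. \<tau> \<omega> \<le> ereal t} \<in> sets (F t)"
    unfolding F_right_continuous[OF t] by auto
qed (rule nn)

lemma known_at_if:
  assumes \<tau>: "stopping \<tau>" and k: "known_at \<tau> \<zeta>" "known_at \<tau> \<psi>"
    and P: "\<And>t. 0 \<le> t \<Longrightarrow> {\<omega> \<in> space M. P \<omega> \<and> \<tau> \<omega> \<le> ereal t} \<in> sets (F t)"
  shows "known_at \<tau> (\<lambda>\<omega>. if P \<omega> then \<zeta> \<omega> else \<psi> \<omega>)"
  unfolding known_at_def
proof safe
  fix t :: real assume t: "0 \<le> t"
  note [measurable] = stopping_pred[OF \<tau> t] known_atD[OF k(1) t] known_atD[OF k(2) t]
  have [measurable]: "Measurable.pred (F t) (\<lambda>\<omega>. P \<omega> \<and> \<tau> \<omega> \<le> ereal t)"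
    using P[OF t] t by (simp add: pred_def)
  have "(\<lambda>\<omega>. if P \<omega> \<and> \<tau> \<omega> \<le> ereal t then (if \<tau> \<omega> \<le> ereal t then \<zeta> \<omega> else 0)
      else (if \<tau> \<omega> \<le> ereal t then \<psi> \<omega> else 0)) \<in> borel_measurable (F t)" by measurable
  then show "(\<lambda>\<omega>. if \<tau> \<omega> \<le> ereal t then if P \<omega> then \<zeta> \<omega> else \<psi> \<omega> else 0) \<in> borel_measurable (F t)"
    by (rule measurable_cong[THEN iffD1, rotated]) auto
qed

lemma stopping_min:
  assumes "stopping \<tau>" "stopping \<sigma>"
  shows "stopping (\<lambda>\<omega>. min (\<tau> \<omega>) (\<sigma> \<omega>))"
  unfolding stopping_def
proof safe
  fix t :: real assume t: "0 \<le> t"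
  have "{\<omega> \<in> space M. min (\<tau> \<omega>) (\<sigma> \<omega>) \<le> ereal t} =
    {\<omega> \<in> space M. \<tau> \<omega> \<le> ereal t} \<union> {\<omega> \<in> space M. \<sigma> \<omega> \<le> ereal t}" by (auto simp: min_le_iff_disj)
  then show "{\<omega> \<in> space M. min (\<tau> \<omega>) (\<sigma> \<omega>) \<le> ereal t} \<in> sets (F t)"
    using stoppingD[OF assms(1) t] stoppingD[OF assms(2) t] by simp
qed (use assms in \<open>auto simp: stopping_nonneg\<close>)

lemma stopping_le_event:
  assumes "stopping \<tau>" "stopping \<sigma>" and t: "0 \<le> t"
  shows "{\<omega> \<in> space M. \<tau> \<omega> \<le> \<sigma> \<omega> \<and> min (\<tau> \<omega>) (\<sigma> \<omega>) \<le> ereal t} \<in> sets (F t)"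
proof -
  note [measurable] = capped_measurable[OF assms(1) t] capped_measurable[OF assms(2) t]
    stopping_pred[OF assms(1) t]
  have "{\<omega> \<in> space (F t). capped (\<tau> \<omega>) t \<le> capped (\<sigma> \<omega>) t \<and> \<tau> \<omega> \<le> ereal t} \<in> sets (F t)"
    by measurable
  moreover have "\<tau> \<omega> \<le> \<sigma> \<omega> \<and> min (\<tau> \<omega>) (\<sigma> \<omega>) \<le> ereal t \<longleftrightarrow> capped (\<tau> \<omega>) t \<le> capped (\<sigma> \<omega>) t \<and> \<tau> \<omega> \<le> ereal t" for \<omega>
    using stopping_nonneg[OF assms(1), of \<omega>] stopping_nonneg[OF assms(2), of \<omega>]
    by (cases "\<tau> \<omega>"; cases "\<sigma> \<omega>") (auto simp: capped_def min_def)
  ultimately show ?thesis using t by simp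
qed

text \<open>A continuous path meets the closed complement of \<open>C\<close> during a compact
  interval iff its distance to the complement gets arbitrarily small at rational times there. Strict
  inequality in time leaves room for rational endpoints, which is why the criterion with
  \<open><\<close> is used.\<close>

lemma stopping_exit_time:
  assumes \<tau>: "stopping \<tau>"
    and Y: "\<And>s. 0 \<le> s \<Longrightarrow> Y s \<in> borel_measurable (F s)"
    and cont: "\<And>\<omega>. \<omega> \<in> space M \<Longrightarrow> continuous_on {s. \<tau> \<omega> \<le> ereal s} (\<lambda>s. Y s \<omega>)"
    and C: "open C"
  shows "stopping (\<lambda>\<omega>. exit_time C (\<lambda>s. Y s \<omega>) (\<tau> \<omega>))"
proof (rule stoppingI_less)
  show "0 \<le> exit_time C (\<lambda>s. Y s \<omega>) (\<tau> \<omega>)" for \<omega>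
    unfolding exit_time_def using stopping_nonneg[OF \<tau>, of \<omega>]
    by (intro Inf_greatest) (auto intro: less_imp_le le_less_trans)
next
  fix t :: real assume t: "0 < t"
  show "{\<omega> \<in> space M. exit_time C (\<lambda>s. Y s \<omega>) (\<tau> \<omega>) < ereal t} \<in> sets (F t)"
  \<comment> \<open>The case is separate because \<open>infdist\<close> to the empty set is 0 by
    convention.\<close>
  proof (cases "C = UNIV")
    case True
    then show ?thesis by (simp add: exit_time_def top_ereal_def)
  next
    case False
    define d where "d y = infdist y (- C)" for y
    have d0: "d y = 0 \<longleftrightarrow> y \<notin> C" for y
      unfolding d_def using False in_closed_iff_infdist_zero[of "- C" y] C by (auto simp: closed_Compl)
    have [measurable]: "d \<in> borel_measurable borel"
      unfolding d_def by (intro borel_measurable_continuous_onI continuous_intros)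
    \<comment> \<open>Clamping turns every rational \<open>q\<close> into a time of
      \<open>{a..b}\<close>, so the union below may run over all rationals.\<close>
    define k where "k a b q = max a (min b q)" for a b q :: real
    define E where "E a b = (\<Inter>n. \<Union>q\<in>\<rat>. {\<omega> \<in> space M. \<tau> \<omega> \<le> ereal a \<and> d (Y (k a b q) \<omega>) < 1 / real (Suc n)})" for a b
    have E_sets: "E a b \<in> sets (F t)" if ab: "0 \<le> a" "a \<le> b" "b < t" for a b
    proof -
      have "{\<omega> \<in> space M. \<tau> \<omega> \<le> ereal a \<and> d (Y (k a b q) \<omega>) < 1 / real (Suc n)} \<in> sets (F t)" for q n
      proof -
        have k: "a \<le> k a b q" "k a b q \<le> b" using ab by (auto simp: k_def)
        have [measurable]: "Y (k a b q) \<in> borel_measurable (F t)"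
          using Y[of "k a b q"] k ab by (auto intro: measurable_F_mono)
        have [measurable]: "Measurable.pred (F t) (\<lambda>\<omega>. \<tau> \<omega> \<le> ereal a)"
          using stopping_pred[OF \<tau>, of a] ab by (auto intro: measurable_F_mono)
        have "{\<omega> \<in> space (F t). \<tau> \<omega> \<le> ereal a \<and> d (Y (k a b q) \<omega>) < 1 / real (Suc n)} \<in> sets (F t)"
          by measurable
        then show ?thesis using t by simp
      qed
      then have "(\<Union>q\<in>\<rat>. {\<omega> \<in> space M. \<tau> \<omega> \<le> ereal a \<and> d (Y (k a b q) \<omega>) < 1 / real (Suc n)}) \<in> sets (F t)" for n
        by (intro sets.countable_UN' countable_rat) auto
      then show ?thesis unfolding E_def by (intro sets.countable_INT) auto
    qed
    have E_iff: "\<omega> \<in> E a b \<longleftrightarrow> \<tau> \<omega> \<le> ereal a \<and> (\<exists>s\<in>{a..b}. Y s \<omega> \<notin> C)"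
      if \<omega>: "\<omega> \<in> space M" and ab: "a \<le> b" for \<omega> a b
    proof (cases "\<tau> \<omega> \<le> ereal a")
      case True
      have co: "continuous_on {a..b} (\<lambda>s. d (Y s \<omega>))"
        unfolding d_def
        by (intro continuous_intros continuous_on_subset[OF cont[OF \<omega>]])
          (use True in \<open>auto intro: order_trans\<close>)
      show ?thesis
      proof (intro iffI conjI True)
        assume "\<omega> \<in> E a b"
        obtain s where s: "s \<in> {a..b}" "\<And>u. u \<in> {a..b} \<Longrightarrow> d (Y s \<omega>) \<le> d (Y u \<omega>)"
          using continuous_attains_inf[OF _ _ co] ab by auto
        have "d (Y s \<omega>) < 1 / real (Suc n)" for n
        proof -
          obtain q where "d (Y (k a b q) \<omega>) < 1 / real (Suc n)"
            using \<open>\<omega> \<in> E a b\<close> unfolding E_def by auto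
          moreover have "k a b q \<in> {a..b}" using ab by (auto simp: k_def)
          ultimately show ?thesis using s(2) by fastforce
        qed
        then have "d (Y s \<omega>) \<le> 0"
          using reals_Archimedean[of "d (Y s \<omega>)"]
          by (metis inverse_eq_divide less_asym not_le)
        then have "d (Y s \<omega>) = 0" by (simp add: d_def infdist_nonneg antisym)
        then show "\<exists>s\<in>{a..b}. Y s \<omega> \<notin> C" using s d0 by blast
      next
        assume "\<tau> \<omega> \<le> ereal a \<and> (\<exists>s\<in>{a..b}. Y s \<omega> \<notin> C)"
        then obtain s where s: "s \<in> {a..b}" "d (Y s \<omega>) = 0" using d0 by auto
        have co': "continuous_on UNIV (\<lambda>q. d (Y (k a b q) \<omega>))"
          by (rule continuous_on_compose2[OF co])
            (use ab in \<open>auto simp: k_def intro!: continuous_intros\<close>)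
        have "\<exists>q\<in>\<rat>. d (Y (k a b q) \<omega>) < 1 / real (Suc n)" for n
        proof -
          have op: "open {q. d (Y (k a b q) \<omega>) < 1 / real (Suc n)}"
            by (rule open_Collect_less[OF co']) (intro continuous_intros)
          moreover have "s \<in> {q. d (Y (k a b q) \<omega>) < 1 / real (Suc n)}"
            using s by (auto simp: k_def max_def min_def)
          ultimately obtain e where e: "e > 0" "ball s e \<subseteq> {q. d (Y (k a b q) \<omega>) < 1 / real (Suc n)}"
            by (meson openE)
          obtain q where q: "q \<in> \<rat>" "s < q" "q < s + e"
            using Rats_dense_in_real[of s "s + e"] e by auto
          then have "q \<in> ball s e" by (auto simp: dist_real_def)
          then show ?thesis using e q by blast
        qed
        then show "\<omega> \<in> E a b" unfolding E_def using \<omega> True by auto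
      qed
    qed (auto simp: E_def)
    \<comment> \<open>The infimum only counts times strictly after \<tau>, so a visit to the
      complement at \<tau> itself is irrelevant. The rational \<open>a\<close>, strictly between
      \<tau> and the exit, encodes this.\<close>
    have "{\<omega> \<in> space M. exit_time C (\<lambda>s. Y s \<omega>) (\<tau> \<omega>) < ereal t} =
      (\<Union>a\<in>\<rat> \<inter> {0..<t}. \<Union>b\<in>\<rat> \<inter> {a..<t}. {\<omega> \<in> E a b. \<tau> \<omega> < ereal a})"
    proof (intro set_eqI iffI)
      fix \<omega> assume "\<omega> \<in> {\<omega> \<in> space M. exit_time C (\<lambda>s. Y s \<omega>) (\<tau> \<omega>) < ereal t}"
      then obtain s where \<omega>: "\<omega> \<in> space M" and s: "\<tau> \<omega> < ereal s" "Y s \<omega> \<notin> C" "s < t"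
        by (auto simp: exit_time_def Inf_less_iff)
      obtain r where r: "\<tau> \<omega> = ereal r" "0 \<le> r" "r < s"
        using s(1) stopping_nonneg[OF \<tau>, of \<omega>] by (cases "\<tau> \<omega>") auto
      obtain a b where ab: "a \<in> \<rat>" "r < a" "a < s" "b \<in> \<rat>" "s < b" "b < t"
        using Rats_dense_in_real[OF r(3)] Rats_dense_in_real[OF s(3)] by blast
      have "\<omega> \<in> E a b" using E_iff[OF \<omega>, of a b] ab r s by auto
      then show "\<omega> \<in> (\<Union>a\<in>\<rat> \<inter> {0..<t}. \<Union>b\<in>\<rat> \<inter> {a..<t}. {\<omega> \<in> E a b. \<tau> \<omega> < ereal a})"
        using ab r by (intro UN_I[of a] UN_I[of b]) auto
    next
      fix \<omega> assume "\<omega> \<in> (\<Union>a\<in>\<rat> \<inter> {0..<t}. \<Union>b\<in>\<rat> \<inter> {a..<t}. {\<omega> \<in> E a b. \<tau> \<omega> < ereal a})"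
      then obtain a b where ab: "0 \<le> a" "a \<le> b" "b < t" "\<omega> \<in> E a b" "\<tau> \<omega> < ereal a" by auto
      have \<omega>: "\<omega> \<in> space M" using ab(4) by (auto simp: E_def)
      obtain s where "s \<in> {a..b}" "Y s \<omega> \<notin> C" using E_iff[OF \<omega> ab(2)] ab(4) by auto
      then show "\<omega> \<in> {\<omega> \<in> space M. exit_time C (\<lambda>s. Y s \<omega>) (\<tau> \<omega>) < ereal t}"
        using ab \<omega> by (auto simp: exit_time_def Inf_less_iff intro!: exI[of _ s] intro: less_le_trans)
    qed
    also have "\<dots> \<in> sets (F t)"
    proof (intro sets.countable_UN' countable_Int1 countable_rat image_subsetI, safe)
      fix a b assume "a \<in> {0..<t}" "b \<in> {a..<t}"
      then have ab: "0 \<le> a" "a \<le> b" "b < t" "a \<le> t" by auto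
      have "(\<lambda>\<omega>. capped (\<tau> \<omega>) t) \<in> borel_measurable (F t)" using capped_measurable[OF \<tau>, of t] t by simp
      then have "{\<omega> \<in> space (F t). capped (\<tau> \<omega>) t < a} \<in> sets (F t)" by measurable
      moreover have "{\<omega> \<in> E a b. \<tau> \<omega> < ereal a} = E a b \<inter> {\<omega> \<in> space (F t). capped (\<tau> \<omega>) t < a}"
      proof -
        have "\<tau> \<omega> < ereal a \<longleftrightarrow> capped (\<tau> \<omega>) t < a" for \<omega>
          using stopping_nonneg[OF \<tau>, of \<omega>] ab
          by (cases "\<tau> \<omega>") (auto simp: capped_def min_def)
        then show ?thesis using t by (auto simp: E_def)
      qed
      ultimately show "{\<omega> \<in> E a b. \<tau> \<omega> < ereal a} \<in> sets (F t)" using E_sets[OF ab(1-3)] by simp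
    qed
    finally show ?thesis .
  qed
qed

end

section \<open>Martingales of Brownian motion\<close>

text \<open>Completing the square: exponential tilting shifts the mean of a Gaussian and keeps its
  variance.\<close>

lemma normal_density_times_exp:
  assumes "0 < \<sigma>"
  shows "normal_density 0 \<sigma> x * exp (a * x) = exp (a\<^sup>2 * \<sigma>\<^sup>2 / 2) * normal_density (a * \<sigma>\<^sup>2) \<sigma> x"
proof -
  have "- (x\<^sup>2 / (2 * \<sigma>\<^sup>2)) + a * x = a\<^sup>2 * \<sigma>\<^sup>2 / 2 - (x - a * \<sigma>\<^sup>2)\<^sup>2 / (2 * \<sigma>\<^sup>2)"
    using assms by (simp add: field_simps power2_eq_square)
  then have "exp (- (x\<^sup>2 / (2 * \<sigma>\<^sup>2))) * exp (a * x) = exp (a\<^sup>2 * \<sigma>\<^sup>2 / 2) * exp (- ((x - a * \<sigma>\<^sup>2)\<^sup>2 / (2 * \<sigma>\<^sup>2)))"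
    by (simp add: exp_add[symmetric])
  then show ?thesis unfolding normal_density_def by (simp add: field_simps)
qed

lemma
  assumes "0 < \<sigma>"
  shows integrable_normal_density_exp: "integrable lborel (\<lambda>x. normal_density 0 \<sigma> x * exp (a * x))"
    and integral_normal_density_exp:
      "(LINT x|lborel. normal_density 0 \<sigma> x * exp (a * x)) = exp (a\<^sup>2 * \<sigma>\<^sup>2 / 2)"
  using assms unfolding normal_density_times_exp[OF assms] by simp_all

text \<open>Continuity and the starting value hold here for every \<omega>, so that exit times and
  stages are well behaved on the whole space. Such a process is supplied by
  \<open>continuous_version\<close> below.\<close>

locale continuous_brownian_motion = brownian_motion M F W
  for M :: "'a measure" and F and W +
  assumes continuous_path: "\<omega> \<in> space M \<Longrightarrow> continuous_on {0..} (\<lambda>t. W t \<omega>)"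
    and path_zero: "\<omega> \<in> space M \<Longrightarrow> W 0 \<omega> = 0"
begin

lemma W_measurable_M [measurable]: "0 \<le> t \<Longrightarrow> W t \<in> borel_measurable M"
  using adapted measurable_F_M by blast

lemma indep_var_increment:
  assumes st: "0 \<le> s" "s < t" and X: "X \<in> borel_measurable (F s)"
  shows "indep_var borel X borel (\<lambda>\<omega>. W t \<omega> - W s \<omega>)"
  unfolding indep_var_eq
proof (intro conjI)
  show "random_variable borel X" using X st by (auto intro: measurable_F_M)
  show "random_variable borel (\<lambda>\<omega>. W t \<omega> - W s \<omega>)"
    using st by (intro borel_measurable_diff W_measurable_M) auto
  have 1: "sigma_sets (space M) {X -` A \<inter> space M |A. A \<in> sets borel} \<subseteq> sets (F s)"
  proof -
    have "{X -` A \<inter> space M |A. A \<in> sets borel} \<subseteq> sets (F s)"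
      using measurable_sets[OF X] st by auto
    then show ?thesis using sets.sigma_sets_subset[of _ "F s"] st by simp
  qed
  show "indep_set (sigma_sets (space M) {X -` A \<inter> space M |A. A \<in> sets borel})
     (sigma_sets (space M) {(\<lambda>\<omega>. W t \<omega> - W s \<omega>) -` A \<inter> space M |A. A \<in> sets borel})"
    using independent_increments[OF st] unfolding indep_set_def
    by (rule indep_sets_mono_sets) (use 1 in \<open>auto split: bool.split simp: sets_vimage_algebra\<close>)
qed

lemma increment_expectation:
  fixes g :: "real \<Rightarrow> real"
  assumes st: "0 \<le> s" "s < t" and X: "X \<in> borel_measurable (F s)" "integrable M X"
    and g: "g \<in> borel_measurable borel" "integrable M (\<lambda>\<omega>. g (W t \<omega> - W s \<omega>))"
  shows "integrable M (\<lambda>\<omega>. X \<omega> * g (W t \<omega> - W s \<omega>))"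
    "expectation (\<lambda>\<omega>. X \<omega> * g (W t \<omega> - W s \<omega>)) = expectation X * expectation (\<lambda>\<omega>. g (W t \<omega> - W s \<omega>))"
proof -
  have "indep_var borel (id \<circ> X) borel (g \<circ> (\<lambda>\<omega>. W t \<omega> - W s \<omega>))"
    by (rule indep_var_compose[OF indep_var_increment[OF st X(1)]]) (use g in auto)
  then have ind: "indep_var borel X borel (\<lambda>\<omega>. g (W t \<omega> - W s \<omega>))" by (simp add: comp_def)
  show "integrable M (\<lambda>\<omega>. X \<omega> * g (W t \<omega> - W s \<omega>))"
    by (rule indep_var_integrable[OF ind X(2) g(2)])
  show "expectation (\<lambda>\<omega>. X \<omega> * g (W t \<omega> - W s \<omega>)) = expectation X * expectation (\<lambda>\<omega>. g (W t \<omega> - W s \<omega>))"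
    by (rule indep_var_lebesgue_integral[OF ind X(2) g(2)])
qed

lemma increment_exp:
  assumes st: "0 \<le> s" "s < t"
  shows "integrable M (\<lambda>\<omega>. exp (a * (W t \<omega> - W s \<omega>)))"
    "expectation (\<lambda>\<omega>. exp (a * (W t \<omega> - W s \<omega>))) = exp (a\<^sup>2 * (t - s) / 2)"
proof -
  have \<sigma>: "0 < sqrt (t - s)" using st by simp
  show "integrable M (\<lambda>\<omega>. exp (a * (W t \<omega> - W s \<omega>)))"
    using distributed_integrable[OF normal_increments[OF st], of "\<lambda>x. exp (a * x)"]
      integrable_normal_density_exp[OF \<sigma>] by simp
  show "expectation (\<lambda>\<omega>. exp (a * (W t \<omega> - W s \<omega>))) = exp (a\<^sup>2 * (t - s) / 2)"
    using distributed_integral[OF normal_increments[OF st], of "\<lambda>x. exp (a * x)"]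
      integral_normal_density_exp[OF \<sigma>, of a] st by simp
qed

lemma increment_mean:
  assumes st: "0 \<le> s" "s < t"
  shows "integrable M (\<lambda>\<omega>. W t \<omega> - W s \<omega>)" "expectation (\<lambda>\<omega>. W t \<omega> - W s \<omega>) = 0"
proof -
  have \<sigma>: "0 < sqrt (t - s)" using st by simp
  show "integrable M (\<lambda>\<omega>. W t \<omega> - W s \<omega>)"
    using distributed_integrable[OF normal_increments[OF st], of "\<lambda>x. x"]
      integrable_normal_moment_nz_1[OF \<sigma>] by simp
  show "expectation (\<lambda>\<omega>. W t \<omega> - W s \<omega>) = 0"
    using distributed_integral[OF normal_increments[OF st], of "\<lambda>x. x"]
      integral_normal_moment_nz_1[OF \<sigma>, of 0] st by simp
qed

text \<open>The Wald martingale. For \<open>a\<^sup>2 / 2 = r\<close> it equals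
  \<open>exp (- r * t) * exp (a * W t)\<close>, so that for
  \<open>a = \<plusminus> sig * \<theta>\<close> the discounting is already built in.\<close>

definition exp_mart :: "real \<Rightarrow> real \<Rightarrow> 'a \<Rightarrow> real" where
  "exp_mart a t \<omega> = exp (a * W t \<omega> - a\<^sup>2 * t / 2)"

lemma exp_mart_adapted: "0 \<le> t \<Longrightarrow> exp_mart a t \<in> borel_measurable (F t)"
  using adapted[of t] unfolding exp_mart_def by measurable

lemma exp_mart_integrable:
  assumes t: "0 \<le> t" shows "integrable M (exp_mart a t)" "expectation (exp_mart a t) = 1"
proof -
  have "integrable M (exp_mart a t) \<and> expectation (exp_mart a t) = 1"
  proof (cases "t = 0")
    case True
    have 1: "integrable M (exp_mart a 0) \<longleftrightarrow> integrable M (\<lambda>_. 1::real)"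
      by (rule Bochner_Integration.integrable_cong) (auto simp: exp_mart_def path_zero)
    have 2: "expectation (exp_mart a 0) = expectation (\<lambda>_. 1)"
      by (rule Bochner_Integration.integral_cong) (auto simp: exp_mart_def path_zero)
    show ?thesis using True 1 2 by (simp add: prob_space)
  next
    case False
    have eq: "exp_mart a t \<omega> = exp (- (a\<^sup>2 * t / 2)) * exp (a * (W t \<omega> - W 0 \<omega>))"
      if "\<omega> \<in> space M" for \<omega>
      using that by (simp add: exp_mart_def path_zero exp_add[symmetric])
    have 1: "integrable M (exp_mart a t) \<longleftrightarrow> integrable M (\<lambda>\<omega>. exp (- (a\<^sup>2 * t / 2)) * exp (a * (W t \<omega> - W 0 \<omega>)))"
      by (rule Bochner_Integration.integrable_cong) (auto simp: eq)
    have 2: "expectation (exp_mart a t) = expectation (\<lambda>\<omega>. exp (- (a\<^sup>2 * t / 2)) * exp (a * (W t \<omega> - W 0 \<omega>)))"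
      by (rule Bochner_Integration.integral_cong) (auto simp: eq)
    show ?thesis unfolding 1 2 using increment_exp[of 0 t a] t False by (simp add: exp_minus)
  qed
  then show "integrable M (exp_mart a t)" "expectation (exp_mart a t) = 1" by auto
qed

lemma integrable_bounded_mult:
  fixes X Z :: "'a \<Rightarrow> real"
  assumes Z: "Z \<in> borel_measurable M" "\<And>\<omega>. \<omega> \<in> space M \<Longrightarrow> \<bar>Z \<omega>\<bar> \<le> K" and X: "integrable M X"
  shows "integrable M (\<lambda>\<omega>. Z \<omega> * X \<omega>)"
proof (rule Bochner_Integration.integrable_bound)
  show "integrable M (\<lambda>\<omega>. K * \<bar>X \<omega>\<bar>)" using X by auto
  show "(\<lambda>\<omega>. Z \<omega> * X \<omega>) \<in> borel_measurable M" using Z X by auto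
  show "AE \<omega> in M. norm (Z \<omega> * X \<omega>) \<le> norm (K * \<bar>X \<omega>\<bar>)"
    using Z(2) by (intro AE_I2) (auto simp: abs_mult intro!: mult_right_mono order_trans[OF Z(2) abs_ge_self])
qed

text \<open>The martingale property is expressed by testing against bounded variables of the past,
  which avoids conditional expectations. It follows by splitting off the independent increment,
  whose exponential moment is explicit.\<close>

lemma exp_mart_martingale:
  assumes st: "0 \<le> s" "s \<le> t" and Z: "Z \<in> borel_measurable (F s)" "\<And>\<omega>. \<omega> \<in> space M \<Longrightarrow> \<bar>Z \<omega>\<bar> \<le> K"
  shows "expectation (\<lambda>\<omega>. Z \<omega> * exp_mart a t \<omega>) = expectation (\<lambda>\<omega>. Z \<omega> * exp_mart a s \<omega>)"
proof (cases "s = t")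
  case False
  with st have st': "0 \<le> s" "s < t" by auto
  have X: "(\<lambda>\<omega>. Z \<omega> * exp_mart a s \<omega>) \<in> borel_measurable (F s)"
    using Z exp_mart_adapted[OF st(1)] by measurable
  have X': "integrable M (\<lambda>\<omega>. Z \<omega> * exp_mart a s \<omega>)"
    using Z st exp_mart_integrable(1)[OF st(1)] by (intro integrable_bounded_mult[of Z K]) (auto intro: measurable_F_M)
  have eq: "exp_mart a t \<omega> = exp (- (a\<^sup>2 * (t - s) / 2)) * exp_mart a s \<omega> * exp (a * (W t \<omega> - W s \<omega>))" for \<omega>
  proof -
    have "a * W t \<omega> - a\<^sup>2 * t / 2 = - (a\<^sup>2 * (t - s) / 2) + (a * W s \<omega> - a\<^sup>2 * s / 2) + a * (W t \<omega> - W s \<omega>)"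
      by (simp add: field_simps)
    then show ?thesis unfolding exp_mart_def by (simp only: exp_add)
  qed
  have "expectation (\<lambda>\<omega>. Z \<omega> * exp_mart a t \<omega>) =
    expectation (\<lambda>\<omega>. exp (- (a\<^sup>2 * (t - s) / 2)) * ((Z \<omega> * exp_mart a s \<omega>) * exp (a * (W t \<omega> - W s \<omega>))))"
    by (rule Bochner_Integration.integral_cong) (simp_all add: eq mult_ac)
  also have "\<dots> = exp (- (a\<^sup>2 * (t - s) / 2)) * (expectation (\<lambda>\<omega>. Z \<omega> * exp_mart a s \<omega>) * exp (a\<^sup>2 * (t - s) / 2))"
    using increment_expectation(2)[OF st' X X', of "\<lambda>x. exp (a * x)"] increment_exp[OF st', of a] by simp
  finally show ?thesis by (simp add: exp_minus)
qed simp

lemma W_integrable: "0 \<le> t \<Longrightarrow> integrable M (W t)"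
proof (cases "t = 0")
  case True
  have "integrable M (W 0) \<longleftrightarrow> integrable M (\<lambda>_. 0::real)"
    by (rule Bochner_Integration.integrable_cong) (auto simp: path_zero)
  then show ?thesis using True by simp
next
  case False
  assume "0 \<le> t"
  have "integrable M (W t) \<longleftrightarrow> integrable M (\<lambda>\<omega>. W t \<omega> - W 0 \<omega>)"
    by (rule Bochner_Integration.integrable_cong) (auto simp: path_zero)
  then show ?thesis using increment_mean(1)[of 0 t] False \<open>0 \<le> t\<close> by simp
qed

lemma W_martingale:
  assumes st: "0 \<le> s" "s \<le> t" and Z: "Z \<in> borel_measurable (F s)" "\<And>\<omega>. \<omega> \<in> space M \<Longrightarrow> \<bar>Z \<omega>\<bar> \<le> K"
  shows "expectation (\<lambda>\<omega>. Z \<omega> * W t \<omega>) = expectation (\<lambda>\<omega>. Z \<omega> * W s \<omega>)"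
proof (cases "s = t")
  case False
  with st have st': "0 \<le> s" "s < t" by auto
  have ZM: "Z \<in> borel_measurable M" using Z st by (auto intro: measurable_F_M)
  have Zi: "integrable M Z" by (rule integrable_const_bound[of _ K]) (use Z ZM in auto)
  have "expectation (\<lambda>\<omega>. Z \<omega> * W t \<omega>) - expectation (\<lambda>\<omega>. Z \<omega> * W s \<omega>)
    = expectation (\<lambda>\<omega>. Z \<omega> * W t \<omega> - Z \<omega> * W s \<omega>)"
    using W_integrable st by (intro Bochner_Integration.integral_diff[symmetric] integrable_bounded_mult[OF ZM Z(2)]) auto
  also have "\<dots> = expectation (\<lambda>\<omega>. Z \<omega> * (W t \<omega> - W s \<omega>))" by (simp add: right_diff_distrib)
  also have "\<dots> = 0"
    using increment_expectation(2)[OF st' Z(1) Zi, of "\<lambda>x. x"] increment_mean[OF st'] by simp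
  finally show ?thesis by simp
qed simp

section \<open>An integrable bound for the exponential of the path\<close>

text \<open>Doob's maximal inequality on a finite grid. The event \<open>C j\<close>, that the level
  is exceeded at index \<open>j\<close> for the first time, belongs to \<open>F (u j)\<close>. There
  the martingale property moves the time from \<open>u j\<close> to \<open>T\<close>, and the total
  mass at \<open>T\<close> is 1.\<close>

lemma exp_mart_maximal:
  fixes u :: "nat \<Rightarrow> real"
  assumes u: "\<And>j. j \<le> N \<Longrightarrow> 0 \<le> u j \<and> u j \<le> T" "\<And>i j. i \<le> j \<Longrightarrow> u i \<le> u j" and l: "0 < l"
  shows "prob {\<omega> \<in> space M. \<exists>j\<le>N. l < exp_mart a (u j) \<omega>} \<le> 1 / l"
proof -
  define C where "C j = {\<omega> \<in> space M. l < exp_mart a (u j) \<omega> \<and> (\<forall>i<j. exp_mart a (u i) \<omega> \<le> l)}" for j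
  have T: "0 \<le> T" using u(1)[of 0] by auto
  have C_F: "C j \<in> sets (F (u j))" if j: "j \<le> N" for j
  proof -
    have m: "exp_mart a (u i) \<in> borel_measurable (F (u j))" if "i \<le> j" for i
      using exp_mart_adapted[of "u i" a] u(1)[of i] u(2)[OF that] that j by (auto intro: measurable_F_mono)
    have le: "{\<omega> \<in> space (F (u j)). exp_mart a (u i) \<omega> \<le> l} \<in> sets (F (u j))" if "i \<in> {..<j}" for i
    proof -
      have [measurable]: "exp_mart a (u i) \<in> borel_measurable (F (u j))" using m that by simp
      show ?thesis by measurable
    qed
    have gt: "{\<omega> \<in> space (F (u j)). l < exp_mart a (u j) \<omega>} \<in> sets (F (u j))"
      using m[of j] by simp
    have "{\<omega> \<in> space (F (u j)). l < exp_mart a (u j) \<omega> \<and> (\<forall>i\<in>{..<j}. exp_mart a (u i) \<omega> \<le> l)} \<in> sets (F (u j))"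
      by (intro sets.sets_Collect_conj sets.sets_Collect_finite_All le gt) auto
    then show ?thesis unfolding C_def using u(1)[OF j] by (simp add: Ball_def)
  qed
  have C_M: "C j \<in> events" if "j \<le> N" for j
    using C_F[OF that] sets_F_subset u(1)[OF that] by blast
  have disj: "disjoint_family_on C {..N}"
    unfolding disjoint_family_on_def C_def
  proof safe
    fix i j \<omega> assume "i \<noteq> j" "l < exp_mart a (u i) \<omega>" "\<forall>k<i. exp_mart a (u k) \<omega> \<le> l"
      "l < exp_mart a (u j) \<omega>" "\<forall>k<j. exp_mart a (u k) \<omega> \<le> l"
    then show "\<omega> \<in> {}" by (metis linorder_neqE_nat not_le)
  qed
  have un: "{\<omega> \<in> space M. \<exists>j\<le>N. l < exp_mart a (u j) \<omega>} = (\<Union>j\<le>N. C j)"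
  proof safe
    fix \<omega> j assume \<omega>: "\<omega> \<in> space M" and j: "j \<le> N" "l < exp_mart a (u j) \<omega>"
    define k where "k = (LEAST k. l < exp_mart a (u k) \<omega>)"
    have "l < exp_mart a (u k) \<omega>" "k \<le> j" using j unfolding k_def by (auto intro: LeastI Least_le)
    moreover have "exp_mart a (u i) \<omega> \<le> l" if "i < k" for i
      using not_less_Least that unfolding k_def by (metis not_le)
    ultimately have "\<omega> \<in> C k" "k \<le> N" using \<omega> j unfolding C_def by auto
    then show "\<omega> \<in> (\<Union>j\<le>N. C j)" by auto
  qed (auto simp: C_def)
  have int_T: "integrable M (\<lambda>\<omega>. indicator (C j) \<omega> * exp_mart a s \<omega>)" if "j \<le> N" "0 \<le> s" for j s
    by (rule integrable_bounded_mult[of _ 1])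
      (use that C_M exp_mart_integrable in \<open>auto simp: indicator_def\<close>)
  have "l * prob (\<Union>j\<le>N. C j) = (\<Sum>j\<le>N. l * prob (C j))"
  proof -
    have "prob (\<Union>j\<le>N. C j) = (\<Sum>j\<le>N. prob (C j))"
      by (rule finite_measure_finite_Union[OF _ _ disj]) (use C_M in auto)
    then show ?thesis by (simp add: sum_distrib_left)
  qed
  also have "\<dots> \<le> (\<Sum>j\<le>N. expectation (\<lambda>\<omega>. indicator (C j) \<omega> * exp_mart a T \<omega>))"
  proof (rule sum_mono)
    fix j assume "j \<in> {..N}"
    then have j: "j \<le> N" "0 \<le> u j" "u j \<le> T" using u(1) by auto
    have "l * prob (C j) = expectation (\<lambda>\<omega>. l * indicator (C j) \<omega>)"
      using C_M[OF j(1)] by simp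
    also have "\<dots> \<le> expectation (\<lambda>\<omega>. indicator (C j) \<omega> * exp_mart a (u j) \<omega>)"
    proof (rule integral_mono)
      show "integrable M (\<lambda>\<omega>. l * indicator (C j) \<omega>)"
        using C_M[OF j(1)] by (simp add: emeasure_eq_measure)
      show "l * indicator (C j) \<omega> \<le> indicator (C j) \<omega> * exp_mart a (u j) \<omega>" for \<omega>
        by (cases "\<omega> \<in> C j") (auto simp: C_def)
    qed (rule int_T[OF j(1,2)])
    also have "\<dots> = expectation (\<lambda>\<omega>. indicator (C j) \<omega> * exp_mart a T \<omega>)"
      using C_F[OF j(1)] j
      by (intro exp_mart_martingale[symmetric, where K = 1]) (auto simp: indicator_def)
    finally show "l * prob (C j) \<le> expectation (\<lambda>\<omega>. indicator (C j) \<omega> * exp_mart a T \<omega>)" .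
  qed
  also have "\<dots> = expectation (\<lambda>\<omega>. \<Sum>j\<le>N. indicator (C j) \<omega> * exp_mart a T \<omega>)"
    using int_T T by (intro Bochner_Integration.integral_sum[symmetric]) auto
  also have "\<dots> \<le> expectation (exp_mart a T)"
  proof (rule integral_mono)
    fix \<omega> assume "\<omega> \<in> space M"
    have "(\<Sum>j\<le>N. indicator (C j) \<omega> * exp_mart a T \<omega>) = indicator (\<Union>j\<le>N. C j) \<omega> * exp_mart a T \<omega>"
      by (simp add: sum_distrib_right[symmetric] indicator_UN_disjoint[OF _ disj])
    also have "\<dots> \<le> exp_mart a T \<omega>" by (auto simp: indicator_def exp_mart_def)
    finally show "(\<Sum>j\<le>N. indicator (C j) \<omega> * exp_mart a T \<omega>) \<le> exp_mart a T \<omega>" .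
  next
    show "integrable M (\<lambda>\<omega>. \<Sum>j\<le>N. indicator (C j) \<omega> * exp_mart a T \<omega>)"
      using int_T T by (intro Bochner_Integration.integrable_sum) auto
    show "integrable M (exp_mart a T)" by (rule exp_mart_integrable(1)[OF T])
  qed
  finally show ?thesis using exp_mart_integrable(2)[OF T] l un by (simp add: field_simps)
qed

text \<open>An exponential tail bound with free parameter \<open>b\<close>. A large absolute value
  of \<open>W\<close> makes one of the Wald martingales for \<open>b\<close> and \<open>- b\<close>
  large, so the maximal inequality applies twice on each dyadic grid. The grids are nested, and the
  bound survives the increasing limit.\<close>

lemma path_sup_prob:
  fixes b r :: real
  assumes T: "0 < T" and b: "0 < b"
  defines "A \<equiv> {\<omega> \<in> space M. \<exists>m. \<exists>j\<le>(2::nat)^m. r < \<bar>W (T * real j / 2^m) \<omega>\<bar>}"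
  shows "A \<in> events" "prob A \<le> 2 * exp (b\<^sup>2 * T / 2 - b * r)"
proof -
  define B where "B m = {\<omega> \<in> space M. \<exists>j\<in>{..(2::nat)^m}. r < \<bar>W (T * real j / 2^m) \<omega>\<bar>}" for m
  have [measurable]: "W (T * real j / 2 ^ m) \<in> borel_measurable M" for j m using T by auto
  have B_M: "B m \<in> events" for m unfolding B_def by measurable
  have A: "A = (\<Union>m. B m)" unfolding A_def B_def by auto
  show "A \<in> events" unfolding A using B_M by auto
  have inc: "incseq B"
  proof (rule incseq_SucI, safe)
    fix m \<omega> assume "\<omega> \<in> B m"
    then obtain j where "\<omega> \<in> space M" "j \<le> 2^m" "r < \<bar>W (T * real j / 2^m) \<omega>\<bar>" by (auto simp: B_def)
    then show "\<omega> \<in> B (Suc m)" unfolding B_def by (auto intro!: bexI[of _ "2 * j"])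
  qed
  define l where "l = exp (b * r - b\<^sup>2 * T / 2)"
  have bound: "prob (B m) \<le> 2 * exp (b\<^sup>2 * T / 2 - b * r)" for m
  proof -
    define u where "u j = T * real (min j (2^m)) / 2^m" for j
    have u: "0 \<le> u j \<and> u j \<le> T" "i \<le> j \<Longrightarrow> u i \<le> u j" for i j
    proof -
      have "real (min j (2^m)) \<le> 2^m" by (metis min.cobounded2 of_nat_le_iff of_nat_numeral of_nat_power)
      then show "0 \<le> u j \<and> u j \<le> T" using T unfolding u_def by (auto simp: field_simps)
      show "i \<le> j \<Longrightarrow> u i \<le> u j" using T unfolding u_def
        by (intro divide_right_mono mult_left_mono) auto
    qed
    let ?P = "\<lambda>a. {\<omega> \<in> space M. \<exists>j\<le>2^m. l < exp_mart a (u j) \<omega>}"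
    have [measurable]: "exp_mart a (u j) \<in> borel_measurable M" for a j
      using exp_mart_adapted[of "u j" a] u(1)[of j] by (auto intro: measurable_F_M)
    have P_M: "?P a \<in> events" for a
    proof -
      have "{\<omega> \<in> space M. \<exists>j\<in>{..2^m}. l < exp_mart a (u j) \<omega>} \<in> events" by measurable
      then show ?thesis by (simp add: Bex_def)
    qed
    have "B m \<subseteq> ?P b \<union> ?P (- b)"
    proof
      fix \<omega> assume "\<omega> \<in> B m"
      then obtain j where \<omega>: "\<omega> \<in> space M" "j \<le> 2^m" "r < \<bar>W (u j) \<omega>\<bar>" by (auto simp: B_def u_def)
      have "b\<^sup>2 * u j \<le> b\<^sup>2 * T" using u(1)[of j] by (intro mult_left_mono) auto
      moreover have "b * r < b * \<bar>W (u j) \<omega>\<bar>" using \<omega>(3) b by simp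
      ultimately have "l < exp_mart b (u j) \<omega> \<or> l < exp_mart (- b) (u j) \<omega>"
        unfolding l_def exp_mart_def by (auto simp: abs_if split: if_splits)
      then show "\<omega> \<in> ?P b \<union> ?P (- b)" using \<omega> by auto
    qed
    then have "prob (B m) \<le> prob (?P b) + prob (?P (- b))"
      using P_M by (intro order_trans[OF finite_measure_mono measure_Un_le]) auto
    also have "\<dots> \<le> 1 / l + 1 / l"
      using u by (intro add_mono exp_mart_maximal[where T = T]) (auto simp: l_def)
    also have "\<dots> = 2 * exp (b\<^sup>2 * T / 2 - b * r)" unfolding l_def by (simp add: exp_diff)
    finally show ?thesis .
  qed
  have "(\<lambda>m. prob (B m)) \<longlonglongrightarrow> prob A" unfolding A
    by (rule finite_Lim_measure_incseq[OF _ inc]) (use B_M in auto)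
  then show "prob A \<le> 2 * exp (b\<^sup>2 * T / 2 - b * r)"
    by (rule LIMSEQ_le_const2) (use bound in auto)
qed

text \<open>The bound \<open>D\<close> adds up the exponentials of all integer levels that the path
  reaches. Compactness makes the sum finite on each path, and the tail bound makes it integrable.
  This majorant takes the place of uniform integrability in optional stopping.\<close>

lemma exp_path_dominated:
  assumes T: "0 < T" and a: "0 < a"
  obtains D where "integrable M D" "\<And>\<omega> t. \<omega> \<in> space M \<Longrightarrow> 0 \<le> t \<Longrightarrow> t \<le> T \<Longrightarrow> exp (a * \<bar>W t \<omega>\<bar>) \<le> D \<omega>"
proof -
  \<comment> \<open>The slack of 1 is needed because
    \<open>real n \<le> \<bar>W t \<omega>\<bar>\<close> at an arbitrary time only yields a value
    above \<open>real n - 1\<close> at nearby dyadic times.\<close>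
  define A where "A n = {\<omega> \<in> space M. \<exists>m. \<exists>j\<le>(2::nat)^m. real n - 1 < \<bar>W (T * real j / 2^m) \<omega>\<bar>}" for n
  \<comment> \<open>The surplus over \<open>a\<close> makes the expectations of the summands of
    \<open>D\<close> decay like \<open>exp (- 1) ^ n\<close>.\<close>
  define b where "b = a + 1"
  have b: "0 < b" using a by (simp add: b_def)
  note A = path_sup_prob[OF T b, of "real n - 1" for n, folded A_def]
  define D where "D \<omega> = (\<Sum>n. exp (a * (real n + 1)) * indicator (A n) \<omega>)" for \<omega>
  have summ: "summable (\<lambda>n. exp (a * (real n + 1)) * indicator (A n) \<omega> :: real)" if \<omega>: "\<omega> \<in> space M" for \<omega>
  proof -
    have "compact ((\<lambda>t. W t \<omega>) ` {0..T})"
      by (intro compact_continuous_image continuous_on_subset[OF continuous_path[OF \<omega>]]) auto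
    then obtain R where R: "\<And>t. t \<in> {0..T} \<Longrightarrow> \<bar>W t \<omega>\<bar> \<le> R"
      unfolding bounded_real[symmetric] using compact_imp_bounded bounded_real by (metis imageI)
    obtain N :: nat where N: "R + 1 \<le> real N" using real_arch_simple by blast
    have "\<omega> \<notin> A n" if "n \<ge> N" for n
    proof
      assume "\<omega> \<in> A n"
      then obtain m j where mj: "j \<le> (2::nat)^m" "real n - 1 < \<bar>W (T * real j / 2^m) \<omega>\<bar>" by (auto simp: A_def)
      have "real j \<le> 2^m" using mj(1) by (metis of_nat_le_iff of_nat_numeral of_nat_power)
      then have "T * real j / 2^m \<in> {0..T}" using T by (auto simp: field_simps)
      then show False using R mj(2) N that by fastforce
    qed
    then show ?thesis by (intro summable_finite[of "{..<N}"]) (auto simp: not_less)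
  qed
  show ?thesis
  proof (rule that)
    show "integrable M D" unfolding D_def
    proof (rule integrable_suminf)
      show "integrable M (\<lambda>\<omega>. exp (a * (real n + 1)) * indicator (A n) \<omega>)" for n
        using A(1)[of n] by (simp add: emeasure_eq_measure)
      show "AE \<omega> in M. summable (\<lambda>n. norm (exp (a * (real n + 1)) * indicator (A n) \<omega>))"
        using summ by (intro AE_I2) simp
      show "summable (\<lambda>n. expectation (\<lambda>\<omega>. norm (exp (a * (real n + 1)) * indicator (A n) \<omega>)))"
      proof (rule summable_comparison_test')
        show "summable (\<lambda>n. (2 * exp (b\<^sup>2 * T / 2 + a + b)) * exp (- 1) ^ n)"
          by (intro summable_mult summable_geometric) simp
        fix n :: nat
        have "expectation (\<lambda>\<omega>. norm (exp (a * (real n + 1)) * indicator (A n) \<omega>)) = exp (a * (real n + 1)) * prob (A n)"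
          using A(1)[of n] by (simp add: abs_mult)
        also have "\<dots> \<le> exp (a * (real n + 1)) * (2 * exp (b\<^sup>2 * T / 2 - b * (real n - 1)))"
          using A(2)[of n] by (intro mult_left_mono) auto
        also have "\<dots> = (2 * exp (b\<^sup>2 * T / 2 + a + b)) * exp (- 1) ^ n"
          unfolding exp_of_nat_mult[symmetric] by (simp add: exp_add[symmetric] b_def algebra_simps)
        finally show "norm (expectation (\<lambda>\<omega>. norm (exp (a * (real n + 1)) * indicator (A n) \<omega>)))
          \<le> (2 * exp (b\<^sup>2 * T / 2 + a + b)) * exp (- 1) ^ n" by simp
      qed
    qed
    fix \<omega> t assume \<omega>: "\<omega> \<in> space M" and t: "0 \<le> t" "t \<le> T"
    define n where "n = nat \<lfloor>\<bar>W t \<omega>\<bar>\<rfloor>"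
    have n: "real n \<le> \<bar>W t \<omega>\<bar>" "\<bar>W t \<omega>\<bar> \<le> real n + 1" unfolding n_def by linarith+
    have "\<omega> \<in> A n"
    proof -
      \<comment> \<open>Dyadic approximation of \<open>t\<close> from below; path continuity carries
        the strict inequality over to some \<open>v m\<close>.\<close>
      define v where "v m = T * real (nat \<lfloor>2^m * (t / T)\<rfloor>) / 2^m" for m :: nat
      have fl: "nat \<lfloor>2^m * (t / T)\<rfloor> \<le> (2::nat)^m" for m
      proof -
        have "2^m * (t / T) \<le> 2^m" using t T by (simp add: field_simps)
        then show ?thesis by (simp add: nat_le_iff floor_le_iff)
      qed
      have v0: "0 \<le> v m" for m using T by (simp add: v_def)
      have v1: "t - T / 2^m \<le> v m" "v m \<le> t" for m
      proof -
        have "0 \<le> 2^m * (t / T)" using t T by simp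
        then have "real (nat \<lfloor>2^m * (t / T)\<rfloor>) \<le> 2^m * (t / T)" "2^m * (t / T) - 1 \<le> real (nat \<lfloor>2^m * (t / T)\<rfloor>)"
          by linarith+
        then have "T * real (nat \<lfloor>2^m * (t / T)\<rfloor>) \<le> T * (2^m * (t / T))" "T * (2^m * (t / T) - 1) \<le> T * real (nat \<lfloor>2^m * (t / T)\<rfloor>)"
          using T by (auto intro: mult_left_mono simp del: times_divide_eq_right)
        moreover have "T * (2^m * (t / T)) = 2^m * t" using T by simp
        ultimately have "T * real (nat \<lfloor>2^m * (t / T)\<rfloor>) \<le> 2^m * t" "2^m * t - T \<le> T * real (nat \<lfloor>2^m * (t / T)\<rfloor>)"
          by (auto simp: right_diff_distrib)
        note X = this[THEN divide_right_mono, of "2^m"]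
        have Y: "2^m * t / 2^m = t" "(2^m * t - T) / 2^m = t - T / 2^m"
          by (simp_all add: diff_divide_distrib)
        show "t - T / 2^m \<le> v m" using X(2) unfolding Y v_def by simp
        show "v m \<le> t" using X(1) unfolding Y v_def by simp
      qed
      have "(\<lambda>m. t - T * (1/2)^m) \<longlonglongrightarrow> t - T * 0"
        by (intro tendsto_intros LIMSEQ_realpow_zero) auto
      moreover have "t - T * (1/2)^m \<le> v m" for m using v1(1)[of m] by (simp add: power_divide)
      ultimately have "v \<longlonglongrightarrow> t"
        using v1(2) by (intro tendsto_sandwich[of "\<lambda>m. t - T * (1/2)^m" v _ "\<lambda>_. t"]) auto
      then have "(\<lambda>m. \<bar>W (v m) \<omega>\<bar>) \<longlonglongrightarrow> \<bar>W t \<omega>\<bar>"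
        by (intro tendsto_rabs continuous_on_tendsto_compose[OF continuous_path[OF \<omega>]]) (use t v0 in auto)
      then have "\<forall>\<^sub>F m in sequentially. real n - 1 < \<bar>W (v m) \<omega>\<bar>"
        by (rule order_tendstoD) (use n in auto)
      then obtain m where "real n - 1 < \<bar>W (v m) \<omega>\<bar>" by (auto simp: eventually_sequentially)
      then show ?thesis unfolding A_def v_def using \<omega> fl by blast
    qed
    then have "exp (a * \<bar>W t \<omega>\<bar>) \<le> exp (a * (real n + 1)) * indicator (A n) \<omega>"
      using n a by simp
    also have "\<dots> \<le> D \<omega>"
    proof -
      define h where "h = (\<lambda>n. exp (a * (real n + 1)) * indicat_real (A n) \<omega>)"
      have "sum h {n} \<le> suminf h"
        using summ[OF \<omega>] by (intro sum_le_suminf) (auto simp: h_def)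
      then have "h n \<le> suminf h" by simp
      then show ?thesis unfolding h_def D_def .
    qed
    finally show "exp (a * \<bar>W t \<omega>\<bar>) \<le> D \<omega>" .
  qed
qed

section \<open>Optional stopping\<close>

text \<open>A continuous martingale on \<open>{0..T}\<close>, in tested form, together with an
  integrable majorant of its path: exactly the data of an optional stopping argument by
  discretisation and dominated convergence.\<close>

definition stop_mart :: "real \<Rightarrow> (real \<Rightarrow> 'a \<Rightarrow> real) \<Rightarrow> ('a \<Rightarrow> real) \<Rightarrow> bool" where
  "stop_mart T H D \<longleftrightarrow>
    (\<forall>t\<in>{0..T}. H t \<in> borel_measurable (F t)) \<and>
    (\<forall>t\<in>{0..T}. \<forall>Z K. Z \<in> borel_measurable (F t) \<longrightarrow> (\<forall>\<omega>\<in>space M. \<bar>Z \<omega>\<bar> \<le> K) \<longrightarrow>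
       expectation (\<lambda>\<omega>. Z \<omega> * H t \<omega>) = expectation (\<lambda>\<omega>. Z \<omega> * H T \<omega>)) \<and>
    (\<forall>\<omega>\<in>space M. continuous_on {0..T} (\<lambda>t. H t \<omega>)) \<and>
    integrable M D \<and> (\<forall>\<omega>\<in>space M. \<forall>t\<in>{0..T}. \<bar>H t \<omega>\<bar> \<le> D \<omega>)"

lemma stop_mart_exp:
  assumes T: "0 < T" obtains D where "stop_mart T (exp_mart a) D"
proof -
  obtain D where D: "integrable M D" "\<And>\<omega> t. \<omega> \<in> space M \<Longrightarrow> 0 \<le> t \<Longrightarrow> t \<le> T \<Longrightarrow> exp ((\<bar>a\<bar> + 1) * \<bar>W t \<omega>\<bar>) \<le> D \<omega>"
    by (rule exp_path_dominated[OF T, of "\<bar>a\<bar> + 1"]) auto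
  have "stop_mart T (exp_mart a) D" unfolding stop_mart_def
  proof (intro conjI ballI allI impI D(1))
    fix \<omega> t assume \<omega>: "\<omega> \<in> space M" and t: "t \<in> {0..T}"
    have "a * W t \<omega> \<le> \<bar>a\<bar> * \<bar>W t \<omega>\<bar>" by (metis abs_ge_self abs_mult)
    moreover have "0 \<le> a\<^sup>2 * t" using t by simp
    ultimately have "a * W t \<omega> - a\<^sup>2 * t / 2 \<le> (\<bar>a\<bar> + 1) * \<bar>W t \<omega>\<bar>" by (simp add: distrib_right)
    then have "exp_mart a t \<omega> \<le> exp ((\<bar>a\<bar> + 1) * \<bar>W t \<omega>\<bar>)" by (simp add: exp_mart_def)
    also have "\<dots> \<le> D \<omega>" using D(2) \<omega> t by auto
    finally show "\<bar>exp_mart a t \<omega>\<bar> \<le> D \<omega>" by (simp add: exp_mart_def)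
  next
    fix \<omega> assume "\<omega> \<in> space M"
    then show "continuous_on {0..T} (\<lambda>t. exp_mart a t \<omega>)"
      unfolding exp_mart_def by (intro continuous_intros continuous_on_subset[OF continuous_path]) auto
  qed (auto intro: exp_mart_adapted exp_mart_martingale[symmetric])
  then show ?thesis by (rule that)
qed

lemma stop_mart_W:
  assumes T: "0 < T" obtains D where "stop_mart T W D"
proof -
  obtain D where D: "integrable M D" "\<And>\<omega> t. \<omega> \<in> space M \<Longrightarrow> 0 \<le> t \<Longrightarrow> t \<le> T \<Longrightarrow> exp (1 * \<bar>W t \<omega>\<bar>) \<le> D \<omega>"
    by (rule exp_path_dominated[OF T, of 1]) auto
  have "stop_mart T W D" unfolding stop_mart_def
  proof (intro conjI ballI allI impI D(1))
    fix \<omega> t assume \<omega>: "\<omega> \<in> space M" and t: "t \<in> {0..T}"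
    have "\<bar>W t \<omega>\<bar> \<le> exp (1 * \<bar>W t \<omega>\<bar>)" using exp_ge_add_one_self[of "\<bar>W t \<omega>\<bar>"] by (simp only: mult_1)
    also have "\<dots> \<le> D \<omega>" using D(2) \<omega> t by auto
    finally show "\<bar>W t \<omega>\<bar> \<le> D \<omega>" .
  qed (auto intro: adapted W_martingale[symmetric] intro!: continuous_on_subset[OF continuous_path])
  then show ?thesis by (rule that)
qed

end

context usual_filtered_prob_space begin

lemma stopping_const: "0 \<le> T \<Longrightarrow> stopping (\<lambda>_. ereal T)"
  unfolding stopping_def
proof safe
  fix t :: real assume t: "0 \<le> t"
  show "{\<omega> \<in> space M. ereal T \<le> ereal t} \<in> sets (F t)"
    using sets.top[of "F t"] t by (cases "T \<le> t") auto
qed auto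

text \<open>Information persists. Once the minimum of \<tau>' and \<open>T\<close> is at most
  \<open>t\<close>, the event \<open>\<tau> \<le> T\<close> is already decided at the earlier of
  \<open>t\<close> and \<open>T\<close>: either \<open>\<tau> \<le> \<tau>' \<le> t\<close>, or
  \<open>T \<le> t\<close>.\<close>

lemma known_at_later:
  assumes \<tau>: "stopping \<tau>" and \<tau>': "stopping \<tau>'" and le: "\<And>\<omega>. \<omega> \<in> space M \<Longrightarrow> \<tau> \<omega> \<le> \<tau>' \<omega>"
    and T: "0 \<le> T" and Z: "known_at \<tau> Z"
  shows "known_at (\<lambda>\<omega>. min (\<tau>' \<omega>) (ereal T)) (\<lambda>\<omega>. if \<tau> \<omega> \<le> ereal T then Z \<omega> else 0)"
  unfolding known_at_def
proof safe
  fix t :: real assume t: "0 \<le> t"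
  define u where "u = min t T"
  have u: "0 \<le> u" "u \<le> t" using t T by (auto simp: u_def)
  have [measurable]: "(\<lambda>\<omega>. if \<tau> \<omega> \<le> ereal u then Z \<omega> else 0) \<in> borel_measurable (F t)"
    using known_atD[OF Z u(1)] u by (auto intro: measurable_F_mono)
  note [measurable] = stopping_pred[OF stopping_min[OF \<tau>' stopping_const[OF T]] t]
  have "(\<lambda>\<omega>. if min (\<tau>' \<omega>) (ereal T) \<le> ereal t then (if \<tau> \<omega> \<le> ereal u then Z \<omega> else 0) else 0) \<in> borel_measurable (F t)"
    by measurable
  then show "(\<lambda>\<omega>. if min (\<tau>' \<omega>) (ereal T) \<le> ereal t then if \<tau> \<omega> \<le> ereal T then Z \<omega> else 0 else 0) \<in> borel_measurable (F t)"
  proof (rule measurable_cong[THEN iffD1, rotated])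
    fix \<omega> assume "\<omega> \<in> space (F t)"
    then have "\<tau> \<omega> \<le> \<tau>' \<omega>" using le t by simp
    moreover have "ereal u = min (ereal t) (ereal T)" by (simp add: u_def min_def)
    ultimately show "(if min (\<tau>' \<omega>) (ereal T) \<le> ereal t then (if \<tau> \<omega> \<le> ereal u then Z \<omega> else 0) else 0)
      = (if min (\<tau>' \<omega>) (ereal T) \<le> ereal t then if \<tau> \<omega> \<le> ereal T then Z \<omega> else 0 else 0)"
      by (auto simp: min_def split: if_splits)
  qed
qed

end

context continuous_brownian_motion begin

text \<open>The stopping time is rounded up to a finite grid, where the martingale property can be
  used on each grid event separately. Refining the grid, path continuity and the majorant
  \<open>K * D\<close> allow dominated convergence.\<close>

lemma optional_stopping:
  assumes T: "0 < T" and H: "stop_mart T H D" and \<tau>: "stopping \<tau>" and Z: "known_at \<tau> Z"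
    and K: "\<And>\<omega>. \<omega> \<in> space M \<Longrightarrow> \<bar>Z \<omega>\<bar> \<le> K"
  shows "integrable M (\<lambda>\<omega>. if \<tau> \<omega> \<le> ereal T then Z \<omega> * H (capped (\<tau> \<omega>) T) \<omega> else 0)"
    and "expectation (\<lambda>\<omega>. if \<tau> \<omega> \<le> ereal T then Z \<omega> * H (capped (\<tau> \<omega>) T) \<omega> else 0) =
      expectation (\<lambda>\<omega>. if \<tau> \<omega> \<le> ereal T then Z \<omega> * H T \<omega> else 0)"
proof -
  have K0: "0 \<le> K" using K not_empty by (metis abs_ge_zero all_not_in_conv order_trans)
  have H_F: "H t \<in> borel_measurable (F t)" if "t \<in> {0..T}" for t using H that by (auto simp: stop_mart_def)
  have H_M: "H t \<in> borel_measurable M" if "t \<in> {0..T}" for t using H_F[OF that] that by (auto intro: measurable_F_M)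
  have H_mart: "expectation (\<lambda>\<omega>. Y \<omega> * H t \<omega>) = expectation (\<lambda>\<omega>. Y \<omega> * H T \<omega>)"
    if "t \<in> {0..T}" "Y \<in> borel_measurable (F t)" "\<And>\<omega>. \<omega> \<in> space M \<Longrightarrow> \<bar>Y \<omega>\<bar> \<le> K" for t Y
    using H that unfolding stop_mart_def by blast
  have H_cont: "continuous_on {0..T} (\<lambda>t. H t \<omega>)" if "\<omega> \<in> space M" for \<omega> using H that by (auto simp: stop_mart_def)
  have D: "integrable M D" "\<And>\<omega> t. \<omega> \<in> space M \<Longrightarrow> t \<in> {0..T} \<Longrightarrow> \<bar>H t \<omega>\<bar> \<le> D \<omega>" using H by (auto simp: stop_mart_def)
  have H_int: "integrable M (H t)" if "t \<in> {0..T}" for t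
    by (rule Bochner_Integration.integrable_bound[OF D(1) H_M[OF that]])
      (use D(2) that in \<open>auto intro!: AE_I2 intro: order_trans[OF _ abs_ge_self]\<close>)
  define u where "u n j = T * real j / real (Suc n)" for n j
  define ix where "ix n s = nat \<lceil>s * real (Suc n) / T\<rceil>" for n s
  have u_iff: "s \<le> u n j \<longleftrightarrow> ix n s \<le> j" if "0 \<le> s" for s n j
  proof -
    have "s \<le> u n j \<longleftrightarrow> s * real (Suc n) / T \<le> real j"
      using T unfolding u_def by (simp add: field_simps del: of_nat_Suc)
    also have "\<dots> \<longleftrightarrow> ix n s \<le> j" unfolding ix_def by (simp add: nat_le_iff ceiling_le_iff)
    finally show ?thesis .
  qed
  have u_T: "u n j \<in> {0..T}" if "j \<le> Suc n" for n j
  proof -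
    have "real j \<le> real (Suc n)" using that by simp
    then show ?thesis using T unfolding u_def by (auto simp: field_simps simp del: of_nat_Suc)
  qed
  have ix_le: "ix n s \<le> Suc n" if "0 \<le> s" "s \<le> T" for s n
    using that T u_iff[OF that(1), of n "Suc n"] by (simp add: u_def)
  \<comment> \<open>This is \<open>Z\<close> on the event that \<open>u n j\<close> is the first
    grid time not before \<tau>. The guard \<open>0 < j\<close> is needed since \<open>j - 1\<close>
    is 0 again at index 0.\<close>
  define P where "P n j \<omega> = (if \<tau> \<omega> \<le> ereal (u n j) then Z \<omega> else 0) * (if 0 < j \<and> \<tau> \<omega> \<le> ereal (u n (j - 1)) then 0 else 1)" for n j \<omega>
  have P_F: "P n j \<in> borel_measurable (F (u n j))" if j: "j \<le> Suc n" for n j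
  proof -
    have le: "0 \<le> u n (j - 1)" "u n (j - 1) \<le> u n j" "0 \<le> u n j"
      using u_T[of "j - 1" n] u_T[OF j] j T
      by (auto simp: u_def simp del: of_nat_Suc intro!: divide_right_mono mult_left_mono)
    have [measurable]: "Measurable.pred (F (u n j)) (\<lambda>\<omega>. \<tau> \<omega> \<le> ereal (u n (j - 1)))"
      using stopping_pred[OF \<tau> le(1)] le by (auto intro: measurable_F_mono)
    note [measurable] = known_atD[OF Z le(3)]
    show ?thesis unfolding P_def by measurable
  qed
  have P_K: "\<bar>P n j \<omega>\<bar> \<le> K" if "\<omega> \<in> space M" for n j \<omega>
    using K[OF that] K0 unfolding P_def by auto
  have P_eq: "P n j \<omega> = (if \<tau> \<omega> \<le> ereal T \<and> j = ix n (capped (\<tau> \<omega>) T) then Z \<omega> else 0)"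
    if j: "j \<le> Suc n" for n j \<omega>
  proof (cases "\<tau> \<omega> \<le> ereal T")
    case True
    have t: "\<tau> \<omega> = ereal (capped (\<tau> \<omega>) T)" "0 \<le> capped (\<tau> \<omega>) T"
      using stopping_nonneg[OF \<tau>] True T by (auto simp: capped_finite capped_nonneg)
    have 1: "\<tau> \<omega> \<le> ereal (u n i) \<longleftrightarrow> ix n (capped (\<tau> \<omega>) T) \<le> i" for i
      by (subst t(1)) (simp add: u_iff[OF t(2)])
    show ?thesis unfolding P_def 1 using True by (cases j) auto
  next
    case False
    then have "\<not> \<tau> \<omega> \<le> ereal (u n j)" using u_T[OF j] by (auto intro: order_trans)
    then show ?thesis using False by (simp add: P_def)
  qed
  define f where "f n \<omega> = (if \<tau> \<omega> \<le> ereal T then Z \<omega> * H (u n (ix n (capped (\<tau> \<omega>) T))) \<omega> else 0)" for n \<omega>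
  have sum_P: "(\<Sum>j\<le>Suc n. P n j \<omega> * h j) = (if \<tau> \<omega> \<le> ereal T then Z \<omega> * h (ix n (capped (\<tau> \<omega>) T)) else 0)" for n \<omega> and h :: "nat \<Rightarrow> real"
  proof -
    have "(\<Sum>j\<le>Suc n. P n j \<omega> * h j) = (\<Sum>j\<le>Suc n. if j = ix n (capped (\<tau> \<omega>) T) then (if \<tau> \<omega> \<le> ereal T then Z \<omega> * h j else 0) else 0)"
      by (intro sum.cong) (auto simp: P_eq)
    also have "\<dots> = (if \<tau> \<omega> \<le> ereal T then Z \<omega> * h (ix n (capped (\<tau> \<omega>) T)) else 0)"
      using ix_le[of "capped (\<tau> \<omega>) T" n] capped_nonneg[of "\<tau> \<omega>" T] capped_le[of "\<tau> \<omega>" T] stopping_nonneg[OF \<tau>] T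
      by (subst sum.delta) auto
    finally show ?thesis .
  qed
  have PH_int: "integrable M (\<lambda>\<omega>. P n j \<omega> * H t \<omega>)" if "j \<le> Suc n" "t \<in> {0..T}" for n j t
    using P_F[OF that(1)] u_T[OF that(1)] P_K H_int[OF that(2)]
    by (intro integrable_bounded_mult[of _ K]) (auto intro: measurable_F_M)
  have f_sum: "f n = (\<lambda>\<omega>. \<Sum>j\<le>Suc n. P n j \<omega> * H (u n j) \<omega>)" for n
    unfolding f_def by (simp add: sum_P del: sum.atMost_Suc)
  have f_int: "integrable M (f n)" for n
    unfolding f_sum using u_T by (intro Bochner_Integration.integrable_sum PH_int) auto
  have f_exp: "expectation (f n) = expectation (\<lambda>\<omega>. if \<tau> \<omega> \<le> ereal T then Z \<omega> * H T \<omega> else 0)" for n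
  proof -
    have "expectation (f n) = (\<Sum>j\<le>Suc n. expectation (\<lambda>\<omega>. P n j \<omega> * H (u n j) \<omega>))"
      unfolding f_sum using u_T by (intro Bochner_Integration.integral_sum PH_int) auto
    also have "\<dots> = (\<Sum>j\<le>Suc n. expectation (\<lambda>\<omega>. P n j \<omega> * H T \<omega>))"
      using u_T P_F P_K by (intro sum.cong H_mart) auto
    also have "\<dots> = expectation (\<lambda>\<omega>. \<Sum>j\<le>Suc n. P n j \<omega> * H T \<omega>)"
      using T by (intro Bochner_Integration.integral_sum[symmetric] PH_int) auto
    also have "\<dots> = expectation (\<lambda>\<omega>. if \<tau> \<omega> \<le> ereal T then Z \<omega> * H T \<omega> else 0)"
      by (simp add: sum_P del: sum.atMost_Suc)
    finally show ?thesis .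
  qed
  let ?g = "\<lambda>\<omega>. if \<tau> \<omega> \<le> ereal T then Z \<omega> * H (capped (\<tau> \<omega>) T) \<omega> else 0"
  have lim: "(\<lambda>n. f n \<omega>) \<longlonglongrightarrow> ?g \<omega>" if \<omega>: "\<omega> \<in> space M" for \<omega>
  proof (cases "\<tau> \<omega> \<le> ereal T")
    case True
    define s where "s = capped (\<tau> \<omega>) T"
    have s: "0 \<le> s" "s \<le> T" using stopping_nonneg[OF \<tau>] T by (auto simp: s_def capped_nonneg capped_le)
    have lo: "s \<le> u n (ix n s)" for n using u_iff[OF s(1)] by blast
    have up: "u n (ix n s) \<le> s + T / real (Suc n)" for n
    proof -
      have "0 \<le> s * real (Suc n) / T" using s T by simp
      then have "real (ix n s) \<le> s * real (Suc n) / T + 1" unfolding ix_def by linarith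
      then have "T * real (ix n s) \<le> T * (s * real (Suc n) / T + 1)" using T by (intro mult_left_mono) auto
      also have "\<dots> = s * real (Suc n) + T" using T by (simp add: distrib_left del: of_nat_Suc)
      finally have "T * real (ix n s) / real (Suc n) \<le> (s * real (Suc n) + T) / real (Suc n)"
        by (rule divide_right_mono) simp
      then show ?thesis unfolding u_def by (simp add: add_divide_distrib del: of_nat_Suc)
    qed
    have "(\<lambda>n. s + T * inverse (real (Suc n))) \<longlonglongrightarrow> s + T * 0"
      by (intro tendsto_intros LIMSEQ_inverse_real_of_nat)
    then have "(\<lambda>n. s + T / real (Suc n)) \<longlonglongrightarrow> s" by (simp add: divide_inverse)
    then have "(\<lambda>n. u n (ix n s)) \<longlonglongrightarrow> s"
      by (intro tendsto_sandwich[of "\<lambda>_. s" "\<lambda>n. u n (ix n s)" sequentially "\<lambda>n. s + T / real (Suc n)"])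
        (intro always_eventually allI lo up tendsto_const | assumption)+
    then have "(\<lambda>n. H (u n (ix n s)) \<omega>) \<longlonglongrightarrow> H s \<omega>"
      by (intro continuous_on_tendsto_compose[OF H_cont[OF \<omega>]]) (use s u_T ix_le in auto)
    then show ?thesis using True unfolding f_def s_def by (auto intro: tendsto_mult)
  qed (simp add: f_def)
  have g_M: "?g \<in> borel_measurable M"
    by (rule borel_measurable_LIMSEQ_real[of M f]) (use lim f_int in auto)
  have bound: "\<bar>f n \<omega>\<bar> \<le> K * D \<omega>" if \<omega>: "\<omega> \<in> space M" for n \<omega>
  proof -
    have D0: "0 \<le> D \<omega>" using D(2)[OF \<omega>, of 0] T by auto
    have "ix n (capped (\<tau> \<omega>) T) \<le> Suc n"
      using stopping_nonneg[OF \<tau>] T by (intro ix_le) (auto simp: capped_nonneg capped_le)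
    then have "\<bar>Z \<omega>\<bar> * \<bar>H (u n (ix n (capped (\<tau> \<omega>) T))) \<omega>\<bar> \<le> K * D \<omega>"
      using D(2) K u_T \<omega> K0 by (intro mult_mono) auto
    then show ?thesis using D0 K0 by (auto simp: f_def abs_mult)
  qed
  have KD: "integrable M (\<lambda>\<omega>. K * D \<omega>)" using D(1) by auto
  show "integrable M ?g"
    by (rule integrable_dominated_convergence[OF g_M _ KD, of f])
      (use f_int lim bound in \<open>auto intro!: AE_I2\<close>)
  have "(\<lambda>n. expectation (f n)) \<longlonglongrightarrow> expectation ?g"
    by (rule integral_dominated_convergence[OF g_M _ KD, of f])
      (use f_int lim bound in \<open>auto intro!: AE_I2\<close>)
  then show "expectation ?g = expectation (\<lambda>\<omega>. if \<tau> \<omega> \<le> ereal T then Z \<omega> * H T \<omega> else 0)"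
    unfolding f_exp by (simp add: LIMSEQ_const_iff)
qed

text \<open>The weight is known at \<tau> while the martingale is evaluated at the later time
  \<tau>'. The deterministic factor \<open>h\<close> will carry discounting; being continuous, it is
  known at \<tau>' and can be absorbed into the weight.\<close>

lemma optional_stopping_later:
  assumes T: "0 < T" and H: "stop_mart T H D" and \<tau>: "stopping \<tau>" and \<tau>': "stopping \<tau>'"
    and le: "\<And>\<omega>. \<omega> \<in> space M \<Longrightarrow> \<tau> \<omega> \<le> \<tau>' \<omega>" and Z: "known_at \<tau> Z"
    and K: "\<And>\<omega>. \<omega> \<in> space M \<Longrightarrow> \<bar>Z \<omega>\<bar> \<le> K"
    and h: "\<And>s. s \<in> {0..T} \<Longrightarrow> \<bar>h s\<bar> \<le> 1" and hc: "continuous_on UNIV h"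
  shows "integrable M (\<lambda>\<omega>. if \<tau> \<omega> \<le> ereal T then Z \<omega> * h (capped (\<tau>' \<omega>) T) * H (capped (\<tau>' \<omega>) T) \<omega> else 0)"
    and "expectation (\<lambda>\<omega>. if \<tau> \<omega> \<le> ereal T then Z \<omega> * h (capped (\<tau>' \<omega>) T) * H (capped (\<tau>' \<omega>) T) \<omega> else 0) =
      expectation (\<lambda>\<omega>. if \<tau> \<omega> \<le> ereal T then Z \<omega> * h (capped (\<tau>' \<omega>) T) * H T \<omega> else 0)"
proof -
  define \<sigma> where "\<sigma> \<omega> = min (\<tau>' \<omega>) (ereal T)" for \<omega>
  define Z' where "Z' \<omega> = (if \<tau> \<omega> \<le> ereal T then Z \<omega> else 0) * h (real_of_ereal (\<sigma> \<omega>))" for \<omega>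
  have \<sigma>: "stopping \<sigma>" unfolding \<sigma>_def using \<tau>' T by (intro stopping_min stopping_const) auto
  have K0: "0 \<le> K" using K not_empty by (metis abs_ge_zero all_not_in_conv order_trans)
  have cap: "real_of_ereal (\<sigma> \<omega>) = capped (\<tau>' \<omega>) T" "capped (\<sigma> \<omega>) T = capped (\<tau>' \<omega>) T" "\<sigma> \<omega> \<le> ereal T" for \<omega>
    unfolding \<sigma>_def capped_def by (auto simp: min_def)
  have Z'_known: "known_at \<sigma> Z'" unfolding Z'_def
  proof (rule known_at_mult)
    show "known_at \<sigma> (\<lambda>\<omega>. if \<tau> \<omega> \<le> ereal T then Z \<omega> else 0)"
      unfolding \<sigma>_def using known_at_later[OF \<tau> \<tau>' le _ Z, of T] T by simp
    show "known_at \<sigma> (\<lambda>\<omega>. h (real_of_ereal (\<sigma> \<omega>)))"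
    proof (rule known_at_process[OF \<sigma>])
      show "((\<lambda>u. h u) \<longlongrightarrow> h s) (at_right s)" for s
        using hc by (simp add: continuous_on_def filterlim_at_split)
    qed simp
  qed
  have Z'_K: "\<bar>Z' \<omega>\<bar> \<le> K" if "\<omega> \<in> space M" for \<omega>
  proof -
    have "\<bar>Z \<omega>\<bar> * \<bar>h (real_of_ereal (\<sigma> \<omega>))\<bar> \<le> K * 1"
      using K[OF that] K0 h[of "capped (\<tau>' \<omega>) T"] stopping_nonneg[OF \<tau>'] T
      by (intro mult_mono) (auto simp: cap capped_nonneg capped_le)
    then show ?thesis using K0 by (auto simp: Z'_def abs_mult)
  qed
  have eq: "(if \<sigma> \<omega> \<le> ereal T then Z' \<omega> * X else 0) = (if \<tau> \<omega> \<le> ereal T then Z \<omega> * h (capped (\<tau>' \<omega>) T) * X else 0)" for \<omega> X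
    unfolding Z'_def using cap by auto
  show "integrable M (\<lambda>\<omega>. if \<tau> \<omega> \<le> ereal T then Z \<omega> * h (capped (\<tau>' \<omega>) T) * H (capped (\<tau>' \<omega>) T) \<omega> else 0)"
    "expectation (\<lambda>\<omega>. if \<tau> \<omega> \<le> ereal T then Z \<omega> * h (capped (\<tau>' \<omega>) T) * H (capped (\<tau>' \<omega>) T) \<omega> else 0) =
      expectation (\<lambda>\<omega>. if \<tau> \<omega> \<le> ereal T then Z \<omega> * h (capped (\<tau>' \<omega>) T) * H T \<omega> else 0)"
    using optional_stopping[OF T H \<sigma> Z'_known Z'_K] unfolding eq cap by blast+
qed

lemma optional_stopping_increment:
  assumes T: "0 < T" and H: "stop_mart T H D" and \<tau>: "stopping \<tau>" and \<tau>': "stopping \<tau>'"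
    and le: "\<And>\<omega>. \<omega> \<in> space M \<Longrightarrow> \<tau> \<omega> \<le> \<tau>' \<omega>" and Z: "known_at \<tau> Z"
    and K: "\<And>\<omega>. \<omega> \<in> space M \<Longrightarrow> \<bar>Z \<omega>\<bar> \<le> K"
  shows "integrable M (\<lambda>\<omega>. if \<tau> \<omega> \<le> ereal T then Z \<omega> * (H (capped (\<tau>' \<omega>) T) \<omega> - H (capped (\<tau> \<omega>) T) \<omega>) else 0)"
    and "expectation (\<lambda>\<omega>. if \<tau> \<omega> \<le> ereal T then Z \<omega> * (H (capped (\<tau>' \<omega>) T) \<omega> - H (capped (\<tau> \<omega>) T) \<omega>) else 0) = 0"
proof -
  note 1 = optional_stopping[OF T H \<tau> Z K]
  have 2: "integrable M (\<lambda>\<omega>. if \<tau> \<omega> \<le> ereal T then Z \<omega> * H (capped (\<tau>' \<omega>) T) \<omega> else 0)"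
    "expectation (\<lambda>\<omega>. if \<tau> \<omega> \<le> ereal T then Z \<omega> * H (capped (\<tau>' \<omega>) T) \<omega> else 0)
      = expectation (\<lambda>\<omega>. if \<tau> \<omega> \<le> ereal T then Z \<omega> * H T \<omega> else 0)"
    using optional_stopping_later[OF T H \<tau> \<tau>' le Z K, of "\<lambda>_. 1"] by (simp_all cong: if_cong)
  have eq: "(if \<tau> \<omega> \<le> ereal T then Z \<omega> * (H (capped (\<tau>' \<omega>) T) \<omega> - H (capped (\<tau> \<omega>) T) \<omega>) else 0) =
    (if \<tau> \<omega> \<le> ereal T then Z \<omega> * H (capped (\<tau>' \<omega>) T) \<omega> else 0) - (if \<tau> \<omega> \<le> ereal T then Z \<omega> * H (capped (\<tau> \<omega>) T) \<omega> else 0)" for \<omega>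
    by (simp add: right_diff_distrib)
  show "integrable M (\<lambda>\<omega>. if \<tau> \<omega> \<le> ereal T then Z \<omega> * (H (capped (\<tau>' \<omega>) T) \<omega> - H (capped (\<tau> \<omega>) T) \<omega>) else 0)"
    "expectation (\<lambda>\<omega>. if \<tau> \<omega> \<le> ereal T then Z \<omega> * (H (capped (\<tau>' \<omega>) T) \<omega> - H (capped (\<tau> \<omega>) T) \<omega>) else 0) = 0"
    unfolding eq using 1 2 by (simp_all add: Bochner_Integration.integral_diff)
qed

lemma W_joint_measurable [measurable]: "(\<lambda>(\<omega>, s). W (max 0 s) \<omega>) \<in> borel_measurable (M \<Otimes>\<^sub>M borel)"
proof (rule measurable_right_continuous_process)
  fix \<omega> s assume "\<omega> \<in> space M" "(0::real) \<le> s"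
  then have "((\<lambda>u. W u \<omega>) \<longlongrightarrow> W s \<omega>) (at s within {0..})"
    using continuous_path by (auto simp: continuous_on_def)
  then show "((\<lambda>u. W u \<omega>) \<longlongrightarrow> W s \<omega>) (at_right s)"
    by (rule tendsto_within_subset) (use \<open>0 \<le> s\<close> in auto)
qed simp

lemma integral_exp_interval:
  fixes r :: real assumes r: "0 < r" and ab: "a \<le> b"
  shows "(LINT s:{a..<b}|lborel. exp (- r * s)) = (exp (- r * a) - exp (- r * b)) / r"
proof -
  have "(LINT s:{a..<b}|lborel. exp (- r * s)) = (LINT s:{a..b}|lborel. exp (- r * s))"
    unfolding set_lebesgue_integral_def
    by (rule integral_cong_AE, measurable)
      (use AE_lborel_singleton[of b] in \<open>eventually_elim, auto simp: indicator_def\<close>)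
  also have "\<dots> = (\<integral>s. exp (- r * s) * indicator {a..b} s \<partial>lborel)"
    unfolding set_lebesgue_integral_def by (simp add: mult.commute)
  also have "\<dots> = - exp (- r * b) / r - - exp (- r * a) / r"
    by (rule integral_FTC_Icc_real[OF ab])
      (use r in \<open>auto intro!: derivative_eq_intros continuous_intros\<close>)
  finally show ?thesis by (simp add: diff_divide_distrib)
qed

text \<open>Integration by parts: \<open>exp (- r * t) * W t\<close> plus \<open>r\<close> times the
  discounted integral of \<open>W\<close> is a martingale. In each of the three terms
  \<open>W\<close> may be replaced by \<open>W T\<close>, for the integral one time slice after
  another by Fubini. What remains is \<open>W T\<close> times factors that cancel.\<close>

lemma linear_increment:
  fixes \<tau> \<tau>' Z r T
  defines "I \<equiv> \<lambda>\<omega>. LINT s:{capped (\<tau> \<omega>) T..<capped (\<tau>' \<omega>) T}|lborel. exp (- r * s) * W s \<omega>"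
  defines "X \<equiv> \<lambda>\<omega>. exp (- r * capped (\<tau>' \<omega>) T) * W (capped (\<tau>' \<omega>) T) \<omega>
     - exp (- r * capped (\<tau> \<omega>) T) * W (capped (\<tau> \<omega>) T) \<omega> + r * I \<omega>"
  assumes T: "0 < T" and r: "0 < r" and \<tau>: "stopping \<tau>" and \<tau>': "stopping \<tau>'"
    and le: "\<And>\<omega>. \<omega> \<in> space M \<Longrightarrow> \<tau> \<omega> \<le> \<tau>' \<omega>" and Z: "known_at \<tau> Z"
    and K: "\<And>\<omega>. \<omega> \<in> space M \<Longrightarrow> \<bar>Z \<omega>\<bar> \<le> K"
  shows "integrable M (\<lambda>\<omega>. if \<tau> \<omega> \<le> ereal T then Z \<omega> * X \<omega> else 0)"
    and "expectation (\<lambda>\<omega>. if \<tau> \<omega> \<le> ereal T then Z \<omega> * X \<omega> else 0) = 0"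
proof -
  obtain D where D: "stop_mart T W D" using stop_mart_W[OF T] .
  have Di: "integrable M D" "\<And>\<omega> t. \<omega> \<in> space M \<Longrightarrow> t \<in> {0..T} \<Longrightarrow> \<bar>W t \<omega>\<bar> \<le> D \<omega>"
    using D by (auto simp: stop_mart_def)
  have K0: "0 \<le> K" using K not_empty by (metis abs_ge_zero all_not_in_conv order_trans)
  define t where "t \<omega> = capped (\<tau> \<omega>) T" for \<omega>
  define t' where "t' \<omega> = capped (\<tau>' \<omega>) T" for \<omega>
  define Y where "Y \<omega> = (if \<tau> \<omega> \<le> ereal T then Z \<omega> else 0)" for \<omega>
  have t_M [measurable]: "t \<in> borel_measurable M" "t' \<in> borel_measurable M"
    unfolding t_def t'_def using capped_measurable[OF \<tau>, of T] capped_measurable[OF \<tau>', of T] T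
    by (auto intro: measurable_F_M)
  have t: "0 \<le> t \<omega>" "t \<omega> \<le> T" "0 \<le> t' \<omega>" "t' \<omega> \<le> T" for \<omega>
    using stopping_nonneg[OF \<tau>] stopping_nonneg[OF \<tau>'] T by (auto simp: t_def t'_def capped_nonneg capped_le)
  have tt': "t \<omega> \<le> t' \<omega>" if "\<omega> \<in> space M" for \<omega>
    using le[OF that] stopping_nonneg[OF \<tau>] by (auto simp: t_def t'_def intro: capped_mono)
  have Y_M [measurable]: "Y \<in> borel_measurable M"
    using known_atD[OF Z, of T] T unfolding Y_def by (auto intro: measurable_F_M)
  have YK: "\<bar>Y \<omega>\<bar> \<le> K" if "\<omega> \<in> space M" for \<omega> using K[OF that] K0 by (auto simp: Y_def)
  have ex: "continuous_on UNIV (\<lambda>s. exp (- r * s))" "\<And>s. s \<in> {0..T} \<Longrightarrow> \<bar>exp (- r * s)\<bar> \<le> 1"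
    using r by (auto intro!: continuous_intros)
  note A = optional_stopping_later[OF T D \<tau> \<tau>' le Z K ex(2) ex(1), simplified]
  note B = optional_stopping_later[OF T D \<tau> \<tau> _ Z K ex(2) ex(1), simplified]
  \<comment> \<open>\<open>G\<close> is the integrand on the product space and \<open>G'\<close>
    below is the same with the terminal value \<open>W T\<close>. The maximum with 0 is harmless on
    the interval of integration and gives joint measurability.\<close>
  define G where "G q = indicator {t (fst q)..<t' (fst q)} (snd q) * exp (- r * snd q) * Y (fst q) * W (max 0 (snd q)) (fst q)" for q
  define G' where "G' q = indicator {t (fst q)..<t' (fst q)} (snd q) * exp (- r * snd q) * Y (fst q) * W T (fst q)" for q
  have W_T [measurable]: "W T \<in> borel_measurable M" using T by simp
  have [measurable]: "(\<lambda>q. W (max 0 (snd q)) (fst q)) \<in> borel_measurable (M \<Otimes>\<^sub>M borel)"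
    using W_joint_measurable by (simp add: split_beta')
  have ind: "indicator {t (fst q)..<t' (fst q)} (snd q) = (if t (fst q) \<le> snd q \<and> snd q < t' (fst q) then 1 else (0::real))" for q
    by (simp add: indicator_def)
  have G_M [measurable]: "G \<in> borel_measurable (M \<Otimes>\<^sub>M lborel)" "G' \<in> borel_measurable (M \<Otimes>\<^sub>M lborel)"
    unfolding G_def G'_def ind by measurable
  interpret P: pair_sigma_finite M lborel ..
  have D_pair: "integrable (M \<Otimes>\<^sub>M lborel) (\<lambda>q. K * D (fst q) * indicator {0..<T} (snd q))"
  proof (rule P.Fubini_integrable)
    show "(\<lambda>q. K * D (fst q) * indicator {0..<T} (snd q)) \<in> borel_measurable (M \<Otimes>\<^sub>M lborel)"
      using borel_measurable_integrable[OF Di(1)] by measurable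
    have I: "integrable lborel (indicat_real {0..<T})" using T by (simp add: integrable_indicator_iff emeasure_lborel_Ico)
    then show "AE \<omega> in M. integrable lborel (\<lambda>s. K * D (fst (\<omega>, s)) * indicator {0..<T} (snd (\<omega>, s)))"
      by simp
    have "integrable M (\<lambda>\<omega>. \<bar>K * D \<omega>\<bar> * T)" using Di(1) by auto
    then show "integrable M (\<lambda>\<omega>. \<integral>s. norm (K * D (fst (\<omega>, s)) * indicator {0..<T} (snd (\<omega>, s))) \<partial>lborel)"
      using T by (simp add: abs_mult)
  qed
  have G_bound: "\<bar>indicator {t \<omega>..<t' \<omega>} s * exp (- (r * s)) * Y \<omega> * w\<bar> \<le> \<bar>K * D \<omega> * indicator {0..<T} s\<bar>"
    if \<omega>: "\<omega> \<in> space M" and w: "s \<in> {0..T} \<Longrightarrow> \<bar>w\<bar> \<le> D \<omega>" for \<omega> s w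
  proof (cases "s \<in> {t \<omega>..<t' \<omega>}")
    case True
    then have s: "s \<in> {0..<T}" using t[of \<omega>] by auto
    have "exp (- (r * s)) * \<bar>Y \<omega>\<bar> * \<bar>w\<bar> \<le> 1 * K * D \<omega>"
      using s r YK[OF \<omega>] w K0 by (intro mult_mono) auto
    also have "\<dots> \<le> \<bar>K * D \<omega>\<bar>" by simp
    finally show ?thesis using True s by (simp add: abs_mult)
  qed simp
  have G_int: "integrable (M \<Otimes>\<^sub>M lborel) G"
    by (rule Bochner_Integration.integrable_bound[OF D_pair G_M(1)], rule AE_I2)
      (auto simp: G_def space_pair_measure intro!: G_bound Di(2))
  have G'_int: "integrable (M \<Otimes>\<^sub>M lborel) G'"
    by (rule Bochner_Integration.integrable_bound[OF D_pair G_M(2)], rule AE_I2)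
      (use T in \<open>auto simp: G'_def space_pair_measure intro!: G_bound Di(2)\<close>)
  have slice: "expectation (\<lambda>\<omega>. G (\<omega>, s)) = expectation (\<lambda>\<omega>. G' (\<omega>, s))" for s
  proof (cases "s \<in> {0..<T}")
    case True
    \<comment> \<open>On a slice the weight has to be expressed by events of time \<open>s\<close>.
      Since the interval is half-open, membership of \<open>s\<close> means that \<tau> has occurred
      and \<tau>' has not.\<close>
    define V where "V \<omega> = (if \<tau> \<omega> \<le> ereal s then Z \<omega> else 0) * (if \<tau>' \<omega> \<le> ereal s then 0 else 1)" for \<omega>
    have s: "0 \<le> s" "s \<le> T" using True by auto
    note [measurable] = known_atD[OF Z s(1)] stopping_pred[OF \<tau>' s(1)]
    have V_F: "V \<in> borel_measurable (F s)" unfolding V_def by measurable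
    have VK: "\<bar>V \<omega>\<bar> \<le> K" if "\<omega> \<in> space M" for \<omega> using K[OF that] K0 by (auto simp: V_def)
    have V_eq: "indicator {t \<omega>..<t' \<omega>} s * Y \<omega> = V \<omega>" for \<omega>
    proof -
      have "t \<omega> \<le> s \<longleftrightarrow> \<tau> \<omega> \<le> ereal s" "s < t' \<omega> \<longleftrightarrow> \<not> \<tau>' \<omega> \<le> ereal s"
        using stopping_nonneg[OF \<tau>, of \<omega>] stopping_nonneg[OF \<tau>', of \<omega>] True unfolding t_def t'_def capped_def
        by (cases "\<tau> \<omega>"; cases "\<tau>' \<omega>"; auto simp: min_def)+
      moreover have "\<tau> \<omega> \<le> ereal T" if "\<tau> \<omega> \<le> ereal s"
        using that s(2) by (meson ereal_less_eq(3) order_trans)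
      ultimately show ?thesis by (auto simp: indicator_def V_def Y_def)
    qed
    have "expectation (\<lambda>\<omega>. G (\<omega>, s)) = expectation (\<lambda>\<omega>. exp (- r * s) * (V \<omega> * W s \<omega>))"
      unfolding G_def V_eq[symmetric] using s by (simp add: mult_ac max_def)
    also have "\<dots> = expectation (\<lambda>\<omega>. exp (- r * s) * (V \<omega> * W T \<omega>))"
      using W_martingale[OF s V_F VK] by simp
    also have "\<dots> = expectation (\<lambda>\<omega>. G' (\<omega>, s))"
      unfolding G'_def V_eq[symmetric] by (simp add: mult_ac)
    finally show ?thesis .
  next
    case False
    then have "s \<notin> {t \<omega>..<t' \<omega>}" for \<omega> using t[of \<omega>] by auto
    then show ?thesis by (simp add: G_def G'_def)
  qed
  have fub: "integrable M (\<lambda>\<omega>. \<integral>s. G (\<omega>, s) \<partial>lborel)" "integrable M (\<lambda>\<omega>. \<integral>s. G' (\<omega>, s) \<partial>lborel)"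
    by (rule P.integrable_fst'[OF G_int], rule P.integrable_fst'[OF G'_int])
  have FE: "expectation (\<lambda>\<omega>. \<integral>s. G (\<omega>, s) \<partial>lborel) = expectation (\<lambda>\<omega>. \<integral>s. G' (\<omega>, s) \<partial>lborel)"
    using P.Fubini_integral[of "\<lambda>\<omega> s. G (\<omega>, s)"] P.Fubini_integral[of "\<lambda>\<omega> s. G' (\<omega>, s)"] G_int G'_int slice
    by (simp add: split_beta')
  have GI: "(\<integral>s. G (\<omega>, s) \<partial>lborel) = Y \<omega> * I \<omega>" for \<omega>
  proof -
    have "(\<integral>s. G (\<omega>, s) \<partial>lborel) = (\<integral>s. Y \<omega> * (indicator {t \<omega>..<t' \<omega>} s * (exp (- r * s) * W s \<omega>)) \<partial>lborel)"
      using t[of \<omega>] by (intro Bochner_Integration.integral_cong) (auto simp: G_def indicator_def max_def)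
    then show ?thesis by (simp add: I_def set_lebesgue_integral_def t_def t'_def)
  qed
  have G'I: "(\<integral>s. G' (\<omega>, s) \<partial>lborel) = Y \<omega> * ((exp (- r * t \<omega>) - exp (- r * t' \<omega>)) / r) * W T \<omega>"
    if "\<omega> \<in> space M" for \<omega>
  proof -
    have "(\<integral>s. G' (\<omega>, s) \<partial>lborel) = (\<integral>s. (Y \<omega> * W T \<omega>) * (indicator {t \<omega>..<t' \<omega>} s * exp (- r * s)) \<partial>lborel)"
      by (intro Bochner_Integration.integral_cong) (auto simp: G'_def)
    also have "\<dots> = (Y \<omega> * W T \<omega>) * (LINT s:{t \<omega>..<t' \<omega>}|lborel. exp (- r * s))"
      by (simp add: set_lebesgue_integral_def)
    also have "\<dots> = Y \<omega> * ((exp (- r * t \<omega>) - exp (- r * t' \<omega>)) / r) * W T \<omega>"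
      using integral_exp_interval[OF r tt'[OF that]] by simp
    finally show ?thesis .
  qed
  have Iint: "integrable M (\<lambda>\<omega>. Y \<omega> * I \<omega>)" using fub(1) unfolding GI .
  have Iexp: "expectation (\<lambda>\<omega>. Y \<omega> * I \<omega>) = expectation (\<lambda>\<omega>. Y \<omega> * ((exp (- r * t \<omega>) - exp (- r * t' \<omega>)) / r) * W T \<omega>)"
    using FE unfolding GI by (simp only: Bochner_Integration.integral_cong[OF refl G'I])
  have Yt: "(if \<tau> \<omega> \<le> ereal T then Z \<omega> * a * b else 0) = Y \<omega> * a * b" for \<omega> a b by (simp add: Y_def)
  note A' = A[unfolded Yt, folded t'_def] and B' = B[unfolded Yt, folded t_def]
  have YW: "integrable M (\<lambda>\<omega>. Y \<omega> * exp (- (r * t \<omega>)) * W T \<omega>)" "integrable M (\<lambda>\<omega>. Y \<omega> * exp (- (r * t' \<omega>)) * W T \<omega>)"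
  proof -
    have "\<bar>Y \<omega> * exp (- (r * u))\<bar> \<le> K" if "\<omega> \<in> space M" "0 \<le> u" for \<omega> u
    proof -
      have "\<bar>Y \<omega>\<bar> * exp (- (r * u)) \<le> K * 1" using YK that r K0 by (intro mult_mono) auto
      then show ?thesis by (simp add: abs_mult)
    qed
    then show "integrable M (\<lambda>\<omega>. Y \<omega> * exp (- (r * t \<omega>)) * W T \<omega>)" "integrable M (\<lambda>\<omega>. Y \<omega> * exp (- (r * t' \<omega>)) * W T \<omega>)"
      using t W_integrable[of T] T by (intro integrable_bounded_mult[of _ K]; simp)+
  qed
  have split: "(if \<tau> \<omega> \<le> ereal T then Z \<omega> * X \<omega> else 0) =
     Y \<omega> * exp (- (r * t' \<omega>)) * W (t' \<omega>) \<omega> - Y \<omega> * exp (- (r * t \<omega>)) * W (t \<omega>) \<omega> + r * (Y \<omega> * I \<omega>)" for \<omega>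
    by (simp add: Y_def X_def t_def t'_def algebra_simps)
  show "integrable M (\<lambda>\<omega>. if \<tau> \<omega> \<le> ereal T then Z \<omega> * X \<omega> else 0)"
    unfolding split using A' B' Iint by auto
  have "expectation (\<lambda>\<omega>. if \<tau> \<omega> \<le> ereal T then Z \<omega> * X \<omega> else 0) =
    expectation (\<lambda>\<omega>. Y \<omega> * exp (- (r * t' \<omega>)) * W T \<omega>) - expectation (\<lambda>\<omega>. Y \<omega> * exp (- (r * t \<omega>)) * W T \<omega>)
     + r * expectation (\<lambda>\<omega>. Y \<omega> * I \<omega>)"
    unfolding split using A' B' Iint by (simp add: Bochner_Integration.integral_diff Bochner_Integration.integral_add)
  also have "r * expectation (\<lambda>\<omega>. Y \<omega> * I \<omega>) = expectation (\<lambda>\<omega>. Y \<omega> * exp (- (r * t \<omega>)) * W T \<omega> - Y \<omega> * exp (- (r * t' \<omega>)) * W T \<omega>)"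
    unfolding Iexp integral_mult_right_zero[symmetric]
    using r by (intro Bochner_Integration.integral_cong) (auto simp: field_simps)
  also have "\<dots> = expectation (\<lambda>\<omega>. Y \<omega> * exp (- (r * t \<omega>)) * W T \<omega>) - expectation (\<lambda>\<omega>. Y \<omega> * exp (- (r * t' \<omega>)) * W T \<omega>)"
    using YW by (rule Bochner_Integration.integral_diff)
  finally show "expectation (\<lambda>\<omega>. if \<tau> \<omega> \<le> ereal T then Z \<omega> * X \<omega> else 0) = 0" by simp
qed

end

section \<open>The controlled trajectory\<close>

lemma exit_time_ge: "t \<le> exit_time C X t"
  unfolding exit_time_def by (intro Inf_greatest) (auto intro: less_imp_le)

lemma exit_time_less_mem: "t < ereal s \<Longrightarrow> ereal s < exit_time C X t \<Longrightarrow> X s \<in> C"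
  unfolding exit_time_def by (rule ccontr) (auto dest!: less_INF_D[of _ "\<lambda>s. ereal s"] simp: not_less[symmetric])

text \<open>The infimum is attained: if the path were in the open set at the exit time,
  right-continuity would keep it there for a while longer, and no exit could occur arbitrarily soon
  afterwards.\<close>

lemma exit_time_not_mem:
  assumes C: "open C" and rc: "(X \<longlongrightarrow> X t) (at_right t)" and t: "exit_time C X u = ereal t"
  shows "X t \<notin> C"
proof
  assume "X t \<in> C"
  then have "\<forall>\<^sub>F s in at_right t. X s \<in> C" using topological_tendstoD[OF rc C] by simp
  then obtain b where b: "t < b" "\<And>s. t < s \<Longrightarrow> s < b \<Longrightarrow> X s \<in> C"
    by (auto simp: eventually_at_right_field)
  have "Inf (ereal ` {s. u < ereal s \<and> X s \<notin> C}) < ereal b" using t b by (simp add: exit_time_def)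
  then obtain s where s: "u < ereal s" "X s \<notin> C" "s < b" by (auto simp: Inf_less_iff)
  have "exit_time C X u \<le> ereal s" unfolding exit_time_def using s by (intro Inf_lower) auto
  then have "t \<le> s" by (simp add: t)
  then show False using b s \<open>X t \<in> C\<close> by (cases "s = t") auto
qed

declare stages.simps(2) [simp del]

locale controlled_path =
  fixes sig x :: real and \<pi> :: "player \<Rightarrow> strategy" and w :: "real \<Rightarrow> real"
  assumes strategy: "is_strategy i (\<pi> i)"
    and path: "continuous_on {0..} w"
begin

abbreviation "S \<equiv> stages sig \<pi> x w"
abbreviation "tm k \<equiv> time (S k)"
abbreviation "pos k \<equiv> traj (S k)"
abbreviation "jump k \<equiv> impulse (S k)"
abbreviation "actor k \<equiv> who (S k)"

lemma open_region: "open (fst (\<pi> i))" using strategy[of i] by (simp add: is_strategy_def)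

lemma tm_Suc: "tm (Suc k) = min (exit_time (fst (\<pi> Player1)) (pos k) (tm k)) (exit_time (fst (\<pi> Player2)) (pos k) (tm k))"
  by (simp add: stages.simps(2) next_stage_def Let_def)

lemma actor_Suc: "actor (Suc k) =
   (if exit_time (fst (\<pi> Player1)) (pos k) (tm k) \<le> exit_time (fst (\<pi> Player2)) (pos k) (tm k) then Player1 else Player2)"
  by (simp add: stages.simps(2) next_stage_def Let_def)

lemma tm_le_Suc: "tm k \<le> tm (Suc k)"
  unfolding tm_Suc by (simp add: exit_time_ge)

lemma tm_mono: "i \<le> j \<Longrightarrow> tm i \<le> tm j"
  by (rule lift_Suc_mono_le[of tm, OF tm_le_Suc])

lemma tm_nonneg: "0 \<le> tm k"
  using tm_mono[of 0 k] by simp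

lemma jump_Suc: "tm (Suc k) = ereal t \<Longrightarrow> jump (Suc k) = snd (\<pi> (actor (Suc k))) (pos k t)"
  unfolding tm_Suc by (simp add: stages.simps(2) next_stage_def Let_def)

text \<open>A new stage restarts the path at the intervention; these facts say that this merely adds
  a constant jump from that time on. They depend on each other: the second at \<open>k\<close> needs
  the first at \<open>k\<close>, and the first at \<open>Suc k\<close> needs the second at
  \<open>k\<close>.\<close>

lemma pos_increment: "tm k \<le> ereal s \<Longrightarrow> tm k \<le> ereal u \<Longrightarrow> pos k u - pos k s = sig * (w u - w s)"
  and pos_Suc: "pos (Suc k) s = pos k s + (if tm (Suc k) \<le> ereal s then jump (Suc k) else 0)"
proof -
  have A: "pos (Suc k) s = pos k s + (if tm (Suc k) \<le> ereal s then jump (Suc k) else 0)"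
    if inc: "\<And>s u. tm k \<le> ereal s \<Longrightarrow> tm k \<le> ereal u \<Longrightarrow> pos k u - pos k s = sig * (w u - w s)" for k s
  proof (cases "tm (Suc k)")
    case (real t)
    have "tm k \<le> ereal t" using tm_le_Suc[of k] real by simp
    moreover have "tm k \<le> ereal s" if "t \<le> s" using calculation that by (meson ereal_less_eq(3) order_trans)
    ultimately have "pos k s - pos k t = sig * (w s - w t)" if "t \<le> s" using inc that by blast
    then show ?thesis
      using jump_Suc[OF real] real unfolding tm_Suc
      by (auto simp: stages.simps(2) next_stage_def Let_def)
  next
    case PInf
    then show ?thesis unfolding tm_Suc by (simp add: stages.simps(2) next_stage_def Let_def)
  next
    case MInf
    then show ?thesis using tm_nonneg[of "Suc k"] by simp
  qed
  have B: "tm k \<le> ereal s \<Longrightarrow> tm k \<le> ereal u \<Longrightarrow> pos k u - pos k s = sig * (w u - w s)" for k s u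
  proof (induction k arbitrary: s u)
    case 0
    then show ?case by (simp add: right_diff_distrib)
  next
    case (Suc k)
    then have "tm k \<le> ereal s" "tm k \<le> ereal u" using tm_le_Suc order_trans by blast+
    then show ?case using Suc A[of k] by simp
  qed
  show "tm k \<le> ereal s \<Longrightarrow> tm k \<le> ereal u \<Longrightarrow> pos k u - pos k s = sig * (w u - w s)" by (rule B)
  show "pos (Suc k) s = pos k s + (if tm (Suc k) \<le> ereal s then jump (Suc k) else 0)" by (rule A[OF B])
qed

lemma pos_continuous: "continuous_on {s. tm k \<le> ereal s} (pos k)"
proof (cases "tm k")
  case (real t)
  then have t: "0 \<le> t" using tm_nonneg[of k] by simp
  have "continuous_on {s. tm k \<le> ereal s} (\<lambda>s. pos k t + sig * (w s - w t))"
    by (intro continuous_intros continuous_on_subset[OF path]) (use real t in auto)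
  then show ?thesis
    by (rule continuous_on_eq) (use pos_increment[of k t] real in \<open>auto simp: algebra_simps\<close>)
qed (use tm_nonneg[of k] in auto)

lemma path_right_continuous: "0 \<le> s \<Longrightarrow> (w \<longlongrightarrow> w s) (at_right s)"
  using path by (auto simp: continuous_on_def intro: tendsto_within_subset)

lemma step_right_continuous: "((\<lambda>u. if t \<le> ereal u then d else 0) \<longlongrightarrow> (if t \<le> ereal s then d else 0 :: real)) (at_right s)"
proof (rule tendsto_eventually, cases "t \<le> ereal s")
  case True
  show "\<forall>\<^sub>F u in at_right s. (if t \<le> ereal u then d else 0) = (if t \<le> ereal s then d else 0)"
    using eventually_at_right_less[of s]
    by eventually_elim (use True in \<open>auto intro: order_trans\<close>)
next
  case False
  then obtain b where b: "s < b" "ereal b \<le> t"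
    using gt_ex[of s] by (cases t) (auto simp: not_le)
  have "\<forall>\<^sub>F u in at_right s. u < b" using b(1) by (auto simp: eventually_at_right_field)
  then show "\<forall>\<^sub>F u in at_right s. (if t \<le> ereal u then d else 0) = (if t \<le> ereal s then d else 0)"
    by eventually_elim (use False b in \<open>auto dest: order_trans simp: not_le\<close>)
qed

lemma pos_right_continuous: "0 \<le> s \<Longrightarrow> (pos k \<longlongrightarrow> pos k s) (at_right s)"
proof (induction k)
  case 0
  then show ?case by (auto intro!: tendsto_intros path_right_continuous)
next
  case (Suc k)
  have "((\<lambda>u. pos k u + (if tm (Suc k) \<le> ereal u then jump (Suc k) else 0)) \<longlongrightarrow>
      pos k s + (if tm (Suc k) \<le> ereal s then jump (Suc k) else 0)) (at_right s)"
    by (rule tendsto_add[OF Suc.IH[OF Suc.prems] step_right_continuous])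
  then show ?case unfolding pos_Suc[symmetric] .
qed

lemma pos_at_intervention: "tm (Suc k) = ereal t \<Longrightarrow> pos k t \<notin> fst (\<pi> (actor (Suc k)))"
  using exit_time_not_mem[OF open_region pos_right_continuous, of t _ k "tm k"] tm_nonneg[of "Suc k"]
  unfolding actor_Suc tm_Suc by (auto simp: min_def split: if_splits)

lemma pos_between: "tm k < ereal s \<Longrightarrow> ereal s < tm (Suc k) \<Longrightarrow> pos k s \<in> fst (\<pi> i)"
  using exit_time_less_mem[of "tm k" s _ "pos k"] unfolding tm_Suc by (cases i) auto

text \<open>Between two interventions the path is in both continuation regions, hence in
  \<open>D\<close>; but from a point off the closed set \<open>D\<close>, right-continuity keeps it
  off \<open>D\<close> for a positive time. So there can be no time between the
  interventions.\<close>

lemma immediate_intervention: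
  assumes D: "closed D" "fst (\<pi> Player1) \<inter> fst (\<pi> Player2) \<subseteq> D" and t: "tm k = ereal t" "pos k t \<notin> D"
  shows "tm (Suc k) = tm k"
proof (rule ccontr)
  assume "tm (Suc k) \<noteq> tm k"
  then have "ereal t < tm (Suc k)" using tm_le_Suc[of k] t by simp
  then obtain b where b: "t < b" "ereal b \<le> tm (Suc k)"
    using gt_ex[of t] by (cases "tm (Suc k)") auto
  have t0: "0 \<le> t" using tm_nonneg[of k] t by simp
  have "\<forall>\<^sub>F u in at_right t. pos k u \<notin> D"
    using topological_tendstoD[OF pos_right_continuous[OF t0], of "- D"] D(1) t by auto
  moreover have "\<forall>\<^sub>F u in at_right t. t < u \<and> u < b" using b(1) by (auto simp: eventually_at_right_field)
  ultimately have "\<forall>\<^sub>F u in at_right t. False"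
  proof eventually_elim
    case (elim u)
    then have "tm k < ereal u" "ereal u < tm (Suc k)" using t b(2) by (auto intro: less_le_trans[of _ "ereal b"])
    then show ?case using pos_between D(2) elim by blast
  qed
  then show False by simp
qed

text \<open>Closedness of \<open>D\<close> includes the time of the next intervention itself, when
  the position is no longer in both open continuation regions.\<close>

lemma stays_in_region:
  assumes D: "closed D" "fst (\<pi> Player1) \<inter> fst (\<pi> Player2) \<subseteq> D" and t: "tm k = ereal t" "pos k t \<in> D"
    and s: "t \<le> s" "ereal s \<le> tm (Suc k)"
  shows "pos k s \<in> D"
proof (cases "t = s")
  case False
  with s have ts: "t < s" by simp
  show ?thesis
  proof (rule Lim_in_closed_set[OF D(1)])
    have "continuous_on {t..s} (pos k)"
      by (rule continuous_on_subset[OF pos_continuous]) (use t in auto)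
    then have "(pos k \<longlongrightarrow> pos k s) (at s within {t..s})" using ts by (auto simp: continuous_on_def)
    then show "(pos k \<longlongrightarrow> pos k s) (at s within {t<..<s})" by (rule tendsto_within_subset) auto
    show "\<forall>\<^sub>F u in at s within {t<..<s}. pos k u \<in> D"
      unfolding eventually_at_filter
    proof (intro always_eventually allI impI)
      fix u assume "u \<in> {t<..<s}"
      then have "tm k < ereal u" "ereal u < tm (Suc k)" using t s by (auto intro: less_le_trans[of _ "ereal s"])
      then show "pos k u \<in> D" using pos_between D(2) by blast
    qed
    show "at s within {t<..<s} \<noteq> bot" using ts by (simp add: at_within_eq_bot_iff)
  qed
qed (use t in simp)

lemma pos_later: "k \<le> j \<Longrightarrow> ereal s < tm (Suc k) \<Longrightarrow> pos j s = pos k s"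
proof (induction j rule: dec_induct)
  case (step j)
  then have "\<not> tm (Suc j) \<le> ereal s" using tm_mono[of "Suc k" "Suc j"] by (auto simp: not_le intro: less_le_trans)
  then show ?case using step by (simp add: pos_Suc)
qed simp

lemma state_eq_pos: "ereal s < tm (Suc k) \<Longrightarrow> state sig \<pi> x w s = pos k s"
  unfolding state_def using pos_later
  by (intro limI tendsto_eventually) (auto simp: eventually_sequentially)

lemma pos_shift: "k \<le> j \<Longrightarrow> pos j s = pos k s + (\<Sum>i\<in>{k<..j}. if tm i \<le> ereal s then jump i else 0)"
proof (induction j rule: dec_induct)
  case (step j)
  then show ?case by (simp add: pos_Suc atLeastSucAtMost_greaterThanAtMost[symmetric])
qed simp

end

section \<open>The verification inequality\<close>

locale controlled_brownian_motion = continuous_brownian_motion M F W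
  for M :: "'a measure" and F W +
  fixes sig x :: real and \<pi> :: "player \<Rightarrow> strategy"
  assumes strategies: "is_strategy i (\<pi> i)"
begin

abbreviation "stg k \<omega> \<equiv> stages sig \<pi> x (\<lambda>t. W t \<omega>) k"
abbreviation "tau k \<omega> \<equiv> time (stg k \<omega>)"
abbreviation "pos k s \<omega> \<equiv> traj (stg k \<omega>) s"
abbreviation "jump k \<omega> \<equiv> impulse (stg k \<omega>)"
abbreviation "actor k \<omega> \<equiv> who (stg k \<omega>)"
abbreviation "X s \<omega> \<equiv> state sig \<pi> x (\<lambda>t. W t \<omega>) s"
abbreviation "tauc k T \<omega> \<equiv> capped (tau k \<omega>) T"
abbreviation "flow r p q k a b \<omega> \<equiv> LINT s:{a..<b}|lborel. exp (- r * s) * (p + q * pos k s \<omega>)"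

lemma controlled_path: "\<omega> \<in> space M \<Longrightarrow> controlled_path \<pi> (\<lambda>t. W t \<omega>)"
  using strategies continuous_path by unfold_locales auto

lemma tau_nonneg [simp]: "0 \<le> tau k \<omega>"
proof (induction k)
  case (Suc k)
  then show ?case
    using exit_time_ge[of "tau k \<omega>"] by (auto simp: stages.simps(2) next_stage_def Let_def intro: order_trans)
qed simp

lemma tau_le_Suc: "\<omega> \<in> space M \<Longrightarrow> tau k \<omega> \<le> tau (Suc k) \<omega>"
  using controlled_path.tm_le_Suc[OF controlled_path] .

lemma tau_finite: "tau k \<omega> \<le> ereal T \<Longrightarrow> tau k \<omega> = ereal (tauc k T \<omega>)"
  by (simp add: capped_finite)

text \<open>Both claims have to be proved together: the next exit time is a stopping time because
  the current trajectory is adapted, and the next trajectory is adapted because its jump is known at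
  that time.\<close>

lemma stages_adapted: "stopping (tau k) \<and> (\<forall>s\<ge>0. pos k s \<in> borel_measurable (F s))"
proof (induction k)
  case 0
  have "stopping (tau 0)" using stopping_const[of 0] by (simp add: zero_ereal_def)
  moreover have "pos 0 s \<in> borel_measurable (F s)" if "0 \<le> s" for s
    using adapted[OF that] by simp measurable
  ultimately show ?case by blast
next
  case (Suc k)
  then have IH: "stopping (tau k)" "\<And>s. 0 \<le> s \<Longrightarrow> pos k s \<in> borel_measurable (F s)" by auto
  define ex where "ex i \<omega> = exit_time (fst (\<pi> i)) (traj (stg k \<omega>)) (tau k \<omega>)" for i \<omega>
  have ex: "stopping (ex i)" for i
    unfolding ex_def
    by (rule stopping_exit_time[OF IH(1), of "pos k"])
      (use IH(2) controlled_path.pos_continuous[OF controlled_path] strategies[of i] in \<open>auto simp: is_strategy_def\<close>)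
  have tau_eq: "tau (Suc k) \<omega> = min (ex Player1 \<omega>) (ex Player2 \<omega>)" for \<omega>
    by (simp add: stages.simps(2) next_stage_def Let_def ex_def)
  have st: "stopping (tau (Suc k))"
    unfolding tau_eq by (rule stopping_min[OF ex ex])
  have who_eq: "actor (Suc k) \<omega> = (if ex Player1 \<omega> \<le> ex Player2 \<omega> then Player1 else Player2)" for \<omega>
    by (simp add: stages.simps(2) next_stage_def Let_def ex_def)
  have P: "{\<omega> \<in> space M. ex Player1 \<omega> \<le> ex Player2 \<omega> \<and> tau (Suc k) \<omega> \<le> ereal t} \<in> sets (F t)" if "0 \<le> t" for t
    unfolding tau_eq by (rule stopping_le_event[OF ex ex that])
  have Y: "known_at (tau (Suc k)) (\<lambda>\<omega>. pos k (real_of_ereal (tau (Suc k) \<omega>)) \<omega>)"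
    by (rule known_at_process[OF st IH(2)])
      (use controlled_path.pos_right_continuous[OF controlled_path] in auto)
  \<comment> \<open>Where the intervention time is infinite this is a default value that never
    enters the trajectory.\<close>
  define J where "J \<omega> = (if ex Player1 \<omega> \<le> ex Player2 \<omega>
      then snd (\<pi> Player1) (pos k (real_of_ereal (tau (Suc k) \<omega>)) \<omega>)
      else snd (\<pi> Player2) (pos k (real_of_ereal (tau (Suc k) \<omega>)) \<omega>))" for \<omega>
  have "snd (\<pi> i) \<in> borel_measurable borel" for i
    using strategies[of i] by (auto simp: is_strategy_def intro: borel_measurable_continuous_onI)
  then have J: "known_at (tau (Suc k)) J"
    unfolding J_def by (intro known_at_if[OF st] known_at_compose[OF st Y] P) auto
  have pos_eq: "pos (Suc k) s \<omega> = pos k s \<omega> + (if tau (Suc k) \<omega> \<le> ereal s then J \<omega> else 0)"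
    if \<omega>: "\<omega> \<in> space M" for s \<omega>
  proof (cases "tau (Suc k) \<omega> \<le> ereal s")
    case True
    then have fin: "tau (Suc k) \<omega> = ereal (capped (tau (Suc k) \<omega>) s)" by (rule tau_finite)
    have rt: "real_of_ereal (tau (Suc k) \<omega>) = capped (tau (Suc k) \<omega>) s"
      using fin by (metis real_of_ereal.simps(1))
    have "jump (Suc k) \<omega> = J \<omega>"
      using controlled_path.jump_Suc[OF controlled_path[OF \<omega>] fin]
      unfolding J_def rt who_eq by (simp split: if_splits)
    then show ?thesis using True controlled_path.pos_Suc[OF controlled_path[OF \<omega>]] by simp
  qed (simp add: controlled_path.pos_Suc[OF controlled_path[OF \<omega>]])
  have "pos (Suc k) s \<in> borel_measurable (F s)" if s: "0 \<le> s" for s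
  proof -
    have "(\<lambda>\<omega>. pos k s \<omega> + (if tau (Suc k) \<omega> \<le> ereal s then J \<omega> else 0)) \<in> borel_measurable (F s)"
      using IH(2)[OF s] known_atD[OF J s] by (rule borel_measurable_add)
    then show ?thesis
      by (rule measurable_cong[THEN iffD1, rotated]) (use s pos_eq in auto)
  qed
  with st show ?case by blast
qed

lemma tau_stopping: "stopping (tau k)" and pos_adapted: "0 \<le> s \<Longrightarrow> pos k s \<in> borel_measurable (F s)"
  using stages_adapted[of k] by auto

lemma tau_measurable [measurable]: "tau k \<in> borel_measurable M"
  by (rule stopping_measurable_M[OF tau_stopping])

lemma pos_known_at: "stopping \<tau> \<Longrightarrow> known_at \<tau> (\<lambda>\<omega>. pos k (real_of_ereal (\<tau> \<omega>)) \<omega>)"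
  by (rule known_at_process[OF _ pos_adapted])
    (use controlled_path.pos_right_continuous[OF controlled_path] in auto)

lemma W_known_at: "stopping \<tau> \<Longrightarrow> known_at \<tau> (\<lambda>\<omega>. W (real_of_ereal (\<tau> \<omega>)) \<omega>)"
  by (rule known_at_process[OF _ adapted])
    (use controlled_path.path_right_continuous[OF controlled_path] in auto)

lemma pos_joint_measurable [measurable]: "(\<lambda>(\<omega>, s). pos k (max 0 s) \<omega>) \<in> borel_measurable (M \<Otimes>\<^sub>M borel)"
  by (rule measurable_right_continuous_process)
    (use controlled_path.pos_right_continuous[OF controlled_path] measurable_F_M[OF pos_adapted] in auto)

lemma capped_tau_measurable [measurable]: "0 \<le> T \<Longrightarrow> (\<lambda>\<omega>. tauc k T \<omega>) \<in> borel_measurable M"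
  using capped_measurable[OF tau_stopping] by (rule measurable_F_M)

lemma pos_measurable_at:
  assumes [measurable]: "u \<in> borel_measurable M" and u: "\<And>\<omega>. \<omega> \<in> space M \<Longrightarrow> 0 \<le> u \<omega>"
  shows "(\<lambda>\<omega>. pos k (u \<omega>) \<omega>) \<in> borel_measurable M"
proof -
  have "(\<lambda>\<omega>. (\<lambda>(\<omega>, s). pos k (max 0 s) \<omega>) (\<omega>, u \<omega>)) \<in> borel_measurable M" by measurable
  then show ?thesis by (rule measurable_cong[THEN iffD1, rotated]) (auto simp: u max_absorb2)
qed

lemma exp_mart_alt: "r = a\<^sup>2 / 2 \<Longrightarrow> exp_mart a t \<omega> = exp (- r * t) * exp (a * W t \<omega>)"
  by (simp add: exp_mart_def exp_add[symmetric] algebra_simps)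

lemma set_integrable_path:
  assumes \<omega>: "\<omega> \<in> space M" and ab: "0 \<le> a"
  shows "set_integrable lborel {a..<b} (\<lambda>s. exp (- r * s) * W s \<omega>)"
proof (rule set_integrable_subset)
  show "set_integrable lborel {a..b} (\<lambda>s. exp (- r * s) * W s \<omega>)"
    by (rule borel_integrable_atLeastAtMost')
      (use ab in \<open>auto intro!: continuous_intros continuous_on_subset[OF continuous_path[OF \<omega>]]\<close>)
qed auto

text \<open>On each stage \<open>V\<close> is dominated by the discounted harmonic function touching it at the starting
  point of the stage, and the latter is a martingale along the uncontrolled path.\<close>

lemma stage_pathwise:
  fixes V \<alpha> \<beta> :: "real \<Rightarrow> real" and r \<theta> p q T :: real and k :: nat and \<omega> :: 'a
  defines "t \<equiv> tauc k T \<omega>" and "t' \<equiv> tauc (Suc k) T \<omega>"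
  defines "a \<equiv> pos k t \<omega>"
  defines "\<Delta> \<equiv> exp (- r * t') * V (pos k t' \<omega>) - exp (- r * t) * V a
      + (flow r p q k t t' \<omega>)"
  assumes r: "0 < r" "r = (sig * \<theta>)\<^sup>2 / 2"
    and D: "closed D" "fst (\<pi> Player1) \<inter> fst (\<pi> Player2) \<subseteq> D"
    and touch: "V a = \<alpha> a + \<beta> a + (p + q * a) / r"
    and dom: "\<And>b. b \<in> D \<Longrightarrow> V b \<le> \<alpha> a * exp (\<theta> * (b - a)) + \<beta> a * exp (- \<theta> * (b - a)) + (p + q * b) / r"
    and \<omega>: "\<omega> \<in> space M" and T: "0 < T" and tau: "tau k \<omega> \<le> ereal T" and aD: "a \<in> D"
  shows "\<Delta> \<le> \<alpha> a * exp (- (sig * \<theta>) * W t \<omega>) * (exp_mart (sig * \<theta>) t' \<omega> - exp_mart (sig * \<theta>) t \<omega>)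
     + \<beta> a * exp (sig * \<theta> * W t \<omega>) * (exp_mart (- (sig * \<theta>)) t' \<omega> - exp_mart (- (sig * \<theta>)) t \<omega>)
     + q * sig / r * (exp (- r * t') * W t' \<omega> - exp (- r * t) * W t \<omega>
        + r * (LINT s:{t..<t'}|lborel. exp (- r * s) * W s \<omega>))"
proof -
  interpret P: controlled_path sig x \<pi> "\<lambda>t. W t \<omega>" by (rule controlled_path[OF \<omega>])
  have t: "tau k \<omega> = ereal t" "0 \<le> t" "t \<le> t'"
    using tau tau_le_Suc[OF \<omega>] T unfolding t_def t'_def by (auto simp: capped_finite capped_nonneg capped_mono)
  have t': "ereal t' \<le> tau (Suc k) \<omega>" unfolding t'_def by (simp add: ereal_capped)
  have pos: "pos k s \<omega> = a + sig * (W s \<omega> - W t \<omega>)" if "t \<le> s" for s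
    using P.pos_increment[of k t s] that t(1) unfolding a_def by simp
  have "pos k t' \<omega> \<in> D"
    by (rule P.stays_in_region[OF D t(1) _ t(3) t']) (use aD in \<open>simp add: a_def\<close>)
  then have "V (pos k t' \<omega>) \<le> \<alpha> a * exp (\<theta> * (pos k t' \<omega> - a)) + \<beta> a * exp (- \<theta> * (pos k t' \<omega> - a)) + (p + q * pos k t' \<omega>) / r"
    by (rule dom)
  also have "\<dots> = \<alpha> a * exp (- (sig * \<theta>) * W t \<omega>) * exp (sig * \<theta> * W t' \<omega>)
      + \<beta> a * exp (sig * \<theta> * W t \<omega>) * exp (- (sig * \<theta>) * W t' \<omega>) + (p + q * pos k t' \<omega>) / r"
    unfolding pos[OF t(3)] mult.assoc by (simp add: exp_add[symmetric] algebra_simps)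
  finally have V': "exp (- r * t') * V (pos k t' \<omega>) \<le> exp (- r * t') *
      (\<alpha> a * exp (- (sig * \<theta>) * W t \<omega>) * exp (sig * \<theta> * W t' \<omega>)
      + \<beta> a * exp (sig * \<theta> * W t \<omega>) * exp (- (sig * \<theta>) * W t' \<omega>) + (p + q * pos k t' \<omega>) / r)"
    by (rule mult_left_mono) simp
  let ?I = "LINT s:{t..<t'}|lborel. exp (- r * s) * W s \<omega>"
  \<comment> \<open>\<open>B\<close> collects what is known at the start of the stage; the integrand
    is \<open>B + q * sig * W s\<close>, up to the discount factor.\<close>
  define B where "B = p + q * a - q * sig * W t \<omega>"
  have "(flow r p q k t t' \<omega>)
    = (LINT s:{t..<t'}|lborel. B * exp (- r * s) + q * sig * (exp (- r * s) * W s \<omega>))"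
    by (rule set_lebesgue_integral_cong) (auto simp: pos B_def algebra_simps)
  also have "\<dots> = B * ((exp (- r * t) - exp (- r * t')) / r) + q * sig * ?I"
  proof -
    have "set_integrable lborel {t..<t'} (\<lambda>s. exp (- r * s))"
      by (rule set_integrable_subset[OF borel_integrable_atLeastAtMost'[of t t']]) (auto intro!: continuous_intros)
    then show ?thesis
      using set_integrable_path[OF \<omega> t(2), of t' r] integral_exp_interval[OF r(1) t(3)]
      by (subst set_integral_add(2)) auto
  qed
  finally have I: "(flow r p q k t t' \<omega>)
     = B * ((exp (- r * t) - exp (- r * t')) / r) + q * sig * ?I" .
  have e1: "exp (- (sig * \<theta>) * W t \<omega>) * exp (sig * \<theta> * W t \<omega>) = 1" by (simp add: exp_add[symmetric])
  have em: "exp_mart (sig * \<theta>) s \<omega> = exp (- r * s) * exp (sig * \<theta> * W s \<omega>)"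
    "exp_mart (- (sig * \<theta>)) s \<omega> = exp (- r * s) * exp (- (sig * \<theta>) * W s \<omega>)" for s
    by (rule exp_mart_alt, use r in simp)+
  \<comment> \<open>With these abbreviations the remaining identity is algebraic, and
    \<open>v * u = 1\<close> is the only relation between the exponentials that it uses.\<close>
  define u v u' v' E E' where d: "u = exp (sig * \<theta> * W t \<omega>)" "v = exp (- (sig * \<theta>) * W t \<omega>)"
    "u' = exp (sig * \<theta> * W t' \<omega>)" "v' = exp (- (sig * \<theta>) * W t' \<omega>)" "E = exp (- r * t)" "E' = exp (- r * t')"
  have vu: "v * u = 1" using e1 by (simp add: d)
  have V'': "E' * V (pos k t' \<omega>) \<le> E' * (\<alpha> a * v * u' + \<beta> a * u * v' + (p + q * (a + sig * (W t' \<omega> - W t \<omega>))) / r)"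
    using V' unfolding pos[OF t(3)] d by simp
  have "\<Delta> \<le> E' * (\<alpha> a * v * u' + \<beta> a * u * v' + (p + q * (a + sig * (W t' \<omega> - W t \<omega>))) / r)
     - E * (\<alpha> a + \<beta> a + (p + q * a) / r) + (B * ((E - E') / r) + q * sig * ?I)"
    using V'' unfolding \<Delta>_def I touch d by simp
  also have "\<dots> = \<alpha> a * v * (E' * u' - E * u) + \<beta> a * u * (E' * v' - E * v)
     + q * sig / r * (E' * W t' \<omega> - E * W t \<omega> + r * ?I)"
  proof -
    have "\<alpha> a * v * (E' * u' - E * u) = \<alpha> a * v * u' * E' - E * \<alpha> a"
      "\<beta> a * u * (E' * v' - E * v) = \<beta> a * u * v' * E' - E * \<beta> a"
      using vu by (simp_all add: right_diff_distrib mult_ac)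
    then show ?thesis using r(1) unfolding B_def by (simp only:) (simp add: field_simps)
  qed
  finally show ?thesis unfolding em d .
qed

text \<open>The pathwise bound has martingale increments on its right-hand side, but with unbounded
  coefficients. Zero-one cutoffs known at the start of the stage make them bounded, so the bound has
  mean zero. The cutoffs are then removed by dominated convergence, with the integrable stage
  increment as majorant.\<close>

lemma stage_step:
  fixes V \<alpha> \<beta> :: "real \<Rightarrow> real" and r \<theta> p q T :: real and k :: nat
  defines "\<Delta> \<equiv> \<lambda>\<omega>. exp (- r * tauc (Suc k) T \<omega>) * V (pos k (tauc (Suc k) T \<omega>) \<omega>)
      - exp (- r * tauc k T \<omega>) * V (pos k (tauc k T \<omega>) \<omega>)
      + (flow r p q k (tauc k T \<omega>) (tauc (Suc k) T \<omega>) \<omega>)"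
  assumes r: "0 < r" "r = (sig * \<theta>)\<^sup>2 / 2" and T: "0 < T"
    and D: "closed D" "fst (\<pi> Player1) \<inter> fst (\<pi> Player2) \<subseteq> D"
    and [measurable]: "\<alpha> \<in> borel_measurable borel" "\<beta> \<in> borel_measurable borel"
    and touch: "\<And>a. a \<in> D \<Longrightarrow> V a = \<alpha> a + \<beta> a + (p + q * a) / r"
    and dom: "\<And>a b. a \<in> D \<Longrightarrow> b \<in> D \<Longrightarrow>
      V b \<le> \<alpha> a * exp (\<theta> * (b - a)) + \<beta> a * exp (- \<theta> * (b - a)) + (p + q * b) / r"
    and int: "integrable M (\<lambda>\<omega>. if tau k \<omega> \<le> ereal T then \<Delta> \<omega> else 0)"
  shows "expectation (\<lambda>\<omega>. if tau k \<omega> \<le> ereal T then \<Delta> \<omega> else 0) \<le> 0"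
proof -
  let ?\<Delta> = "\<lambda>\<omega>. if tau k \<omega> \<le> ereal T then \<Delta> \<omega> else 0"
  define c where "c = sig * \<theta>"
  define a where "a \<omega> = pos k (real_of_ereal (tau k \<omega>)) \<omega>" for \<omega>
  define w where "w \<omega> = W (real_of_ereal (tau k \<omega>)) \<omega>" for \<omega>
  \<comment> \<open>Besides bounding the coefficients, this cutoff selects stages that start in
    \<open>D\<close>, where the touching function is available.\<close>
  define h1 where "h1 n y = (if y \<in> D \<and> \<bar>\<alpha> y\<bar> \<le> real n \<and> \<bar>\<beta> y\<bar> \<le> real n then 1 else (0::real))" for n y
  define h2 where "h2 n y = (if \<bar>y\<bar> \<le> real n then 1 else (0::real))" for n y
  define J where "J n \<omega> = h1 n (a \<omega>) * h2 n (w \<omega>)" for n \<omega>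
  have [measurable]: "D \<in> sets borel" using D(1) by simp
  have [measurable]: "h1 n \<in> borel_measurable borel" "h2 n \<in> borel_measurable borel" for n
    unfolding h1_def h2_def by measurable
  have a: "known_at (tau k) a" unfolding a_def by (rule pos_known_at[OF tau_stopping])
  have w: "known_at (tau k) w" unfolding w_def by (rule W_known_at[OF tau_stopping])
  have J01: "J n \<omega> = 0 \<or> J n \<omega> = 1" for n \<omega> by (simp add: J_def h1_def h2_def)
  define Z1 where "Z1 n \<omega> = (h1 n (a \<omega>) * \<alpha> (a \<omega>)) * (h2 n (w \<omega>) * exp (- c * w \<omega>))" for n \<omega>
  define Z2 where "Z2 n \<omega> = (h1 n (a \<omega>) * \<beta> (a \<omega>)) * (h2 n (w \<omega>) * exp (c * w \<omega>))" for n \<omega>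
  define Z3 where "Z3 n \<omega> = h1 n (a \<omega>) * (h2 n (w \<omega>) * (q * sig / r))" for n \<omega>
  have Z: "known_at (tau k) (Z1 n)" "known_at (tau k) (Z2 n)" "known_at (tau k) (Z3 n)" for n
    unfolding Z1_def Z2_def Z3_def
    by (intro known_at_mult known_at_compose[OF tau_stopping a, where h = "\<lambda>a. h1 n a * \<alpha> a"]
        known_at_compose[OF tau_stopping a, where h = "\<lambda>a. h1 n a * \<beta> a"]
        known_at_compose[OF tau_stopping a, where h = "h1 n"]
        known_at_compose[OF tau_stopping w, where h = "\<lambda>w. h2 n w * exp (- c * w)"]
        known_at_compose[OF tau_stopping w, where h = "\<lambda>w. h2 n w * exp (c * w)"]
        known_at_compose[OF tau_stopping w, where h = "\<lambda>w. h2 n w * (q * sig / r)"]; measurable)+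
  have hw: "\<bar>h2 n (w \<omega>) * exp (b * w \<omega>)\<bar> \<le> exp (\<bar>b\<bar> * real n)" for n b \<omega>
  proof (cases "\<bar>w \<omega>\<bar> \<le> real n")
    case True
    have "b * w \<omega> \<le> \<bar>b\<bar> * \<bar>w \<omega>\<bar>" by (metis abs_ge_self abs_mult)
    also have "\<dots> \<le> \<bar>b\<bar> * real n" using True by (intro mult_left_mono) auto
    finally show ?thesis using True by (simp add: h2_def)
  qed (simp add: h2_def)
  have ZK: "\<bar>Z1 n \<omega>\<bar> \<le> real n * exp (\<bar>c\<bar> * real n)" "\<bar>Z2 n \<omega>\<bar> \<le> real n * exp (\<bar>c\<bar> * real n)" "\<bar>Z3 n \<omega>\<bar> \<le> \<bar>q * sig / r\<bar>" for n \<omega>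
  proof -
    have 1: "\<bar>h1 n (a \<omega>) * \<alpha> (a \<omega>)\<bar> \<le> real n" "\<bar>h1 n (a \<omega>) * \<beta> (a \<omega>)\<bar> \<le> real n"
      by (auto simp: h1_def)
    show "\<bar>Z1 n \<omega>\<bar> \<le> real n * exp (\<bar>c\<bar> * real n)"
      unfolding Z1_def abs_mult[of "h1 n (a \<omega>) * \<alpha> (a \<omega>)"]
      using 1 hw[of n \<omega> "- c"] by (intro mult_mono) auto
    show "\<bar>Z2 n \<omega>\<bar> \<le> real n * exp (\<bar>c\<bar> * real n)"
      unfolding Z2_def abs_mult[of "h1 n (a \<omega>) * \<beta> (a \<omega>)"]
      using 1 hw[of n \<omega> c] by (intro mult_mono) auto
    show "\<bar>Z3 n \<omega>\<bar> \<le> \<bar>q * sig / r\<bar>" by (simp add: Z3_def h1_def h2_def)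
  qed
  obtain D1 where D1: "stop_mart T (exp_mart c) D1" using stop_mart_exp[OF T] .
  obtain D2 where D2: "stop_mart T (exp_mart (- c)) D2" using stop_mart_exp[OF T] .
  note s1 = optional_stopping_increment[OF T D1 tau_stopping[of k] tau_stopping[of "Suc k"] tau_le_Suc Z(1) ZK(1), simplified]
  note s2 = optional_stopping_increment[OF T D2 tau_stopping[of k] tau_stopping[of "Suc k"] tau_le_Suc Z(2) ZK(2), simplified]
  note s3 = linear_increment[OF T r(1) tau_stopping[of k] tau_stopping[of "Suc k"] tau_le_Suc Z(3) ZK(3), simplified]
  define R where "R n \<omega> =
      (if tau k \<omega> \<le> ereal T then Z1 n \<omega> * (exp_mart c (tauc (Suc k) T \<omega>) \<omega> - exp_mart c (tauc k T \<omega>) \<omega>) else 0)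
    + (if tau k \<omega> \<le> ereal T then Z2 n \<omega> * (exp_mart (- c) (tauc (Suc k) T \<omega>) \<omega> - exp_mart (- c) (tauc k T \<omega>) \<omega>) else 0)
    + (if tau k \<omega> \<le> ereal T then Z3 n \<omega> * (exp (- r * tauc (Suc k) T \<omega>) * W (tauc (Suc k) T \<omega>) \<omega>
       - exp (- r * tauc k T \<omega>) * W (tauc k T \<omega>) \<omega>
       + r * (LINT s:{tauc k T \<omega>..<tauc (Suc k) T \<omega>}|lborel. exp (- r * s) * W s \<omega>)) else 0)" for n \<omega>
  have R: "integrable M (R n)" "expectation (R n) = 0" for n
    unfolding R_def using s1[of n] s2[of n] s3[of n] by simp_all
  have le: "J n \<omega> * ?\<Delta> \<omega> \<le> R n \<omega>" if \<omega>: "\<omega> \<in> space M" for n \<omega>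
  proof (cases "tau k \<omega> \<le> ereal T \<and> J n \<omega> = 1")
    case True
    then have tk: "tau k \<omega> \<le> ereal T" and J1: "J n \<omega> = 1" by auto
    have hh: "h1 n (a \<omega>) = 1" "h2 n (w \<omega>) = 1" using J1 by (auto simp: J_def h1_def h2_def split: if_splits)
    have aD: "a \<omega> \<in> D" using hh(1) by (auto simp: h1_def split: if_splits)
    have rt: "real_of_ereal (tau k \<omega>) = tauc k T \<omega>" using tau_finite[OF tk] by (metis real_of_ereal.simps(1))
    have aw: "a \<omega> = pos k (tauc k T \<omega>) \<omega>" "w \<omega> = W (tauc k T \<omega>) \<omega>"
      by (simp_all add: a_def w_def rt)
    show ?thesis
      using stage_pathwise[where V = V and \<alpha> = \<alpha> and \<beta> = \<beta> and p = p and q = q and k = k and T = T and \<omega> = \<omega>,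
          OF r D touch[OF aD, unfolded aw] dom[OF aD, unfolded aw] \<omega> T tk aD[unfolded aw]]
      using tk J1 unfolding R_def Z1_def Z2_def Z3_def \<Delta>_def aw c_def by (simp add: hh[unfolded aw])
  next
    case False
    then show ?thesis using J01[of n \<omega>]
      by (auto simp: R_def Z1_def Z2_def Z3_def J_def)
  qed
  have h1_M: "(\<lambda>\<omega>. if tau k \<omega> \<le> ereal T then J n \<omega> else 0) \<in> borel_measurable M" for n
    using known_atD[OF known_at_mult[OF known_at_compose[OF tau_stopping a, of "h1 n"] known_at_compose[OF tau_stopping w, of "h2 n"]], of T] T
    unfolding J_def by (auto intro: measurable_F_M)
  have J\<Delta>: "integrable M (\<lambda>\<omega>. J n \<omega> * ?\<Delta> \<omega>)" for n
  proof -
    have "integrable M (\<lambda>\<omega>. (if tau k \<omega> \<le> ereal T then J n \<omega> else 0) * ?\<Delta> \<omega>)"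
    proof (rule integrable_bounded_mult[OF h1_M _ int, of _ 1])
      fix \<omega> show "\<bar>if tau k \<omega> \<le> ereal T then J n \<omega> else 0\<bar> \<le> 1" using J01[of n \<omega>] by auto
    qed
    moreover have "(if tau k \<omega> \<le> ereal T then J n \<omega> else 0) * ?\<Delta> \<omega> = J n \<omega> * ?\<Delta> \<omega>" for \<omega> by simp
    ultimately show ?thesis by simp
  qed
  have neg: "expectation (\<lambda>\<omega>. J n \<omega> * ?\<Delta> \<omega>) \<le> 0" for n
    using integral_mono[OF J\<Delta> R(1) le] R(2) by simp
  have lim: "(\<lambda>n. J n \<omega> * ?\<Delta> \<omega>) \<longlonglongrightarrow> ?\<Delta> \<omega>" if \<omega>: "\<omega> \<in> space M" for \<omega>
  proof (cases "tau k \<omega> \<le> ereal T")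
    case True
    interpret P: controlled_path sig x \<pi> "\<lambda>t. W t \<omega>" by (rule controlled_path[OF \<omega>])
    have rt: "real_of_ereal (tau k \<omega>) = tauc k T \<omega>" using tau_finite[OF True] by (metis real_of_ereal.simps(1))
    show ?thesis
    proof (cases "a \<omega> \<in> D")
      case False
      \<comment> \<open>The cutoffs never select a stage starting outside \<open>D\<close>, so its
        increment has to vanish by itself; it does, because the stage has length zero.\<close>
      have "tau (Suc k) \<omega> = tau k \<omega>"
        by (rule P.immediate_intervention[OF D tau_finite[OF True]]) (use False in \<open>simp add: a_def rt\<close>)
      then have "\<Delta> \<omega> = 0" by (simp add: \<Delta>_def set_lebesgue_integral_def)
      then show ?thesis by simp
    next
      case aD: True
      obtain N :: nat where N: "max (\<bar>\<alpha> (a \<omega>)\<bar>) (max \<bar>\<beta> (a \<omega>)\<bar> \<bar>w \<omega>\<bar>) \<le> real N" using real_arch_simple by blast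
      have J1: "J n \<omega> = 1" if "n \<ge> N" for n
        using N that aD unfolding J_def h1_def h2_def by auto
      have "\<forall>\<^sub>F n in sequentially. J n \<omega> * ?\<Delta> \<omega> = ?\<Delta> \<omega>"
        using eventually_ge_at_top[of N] by eventually_elim (simp add: J1)
      then show ?thesis by (rule tendsto_eventually)
    qed
  qed simp
  have "(\<lambda>n. expectation (\<lambda>\<omega>. J n \<omega> * ?\<Delta> \<omega>)) \<longlonglongrightarrow> expectation ?\<Delta>"
  proof (rule integral_dominated_convergence[where w = "\<lambda>\<omega>. \<bar>?\<Delta> \<omega>\<bar>"])
    show "AE \<omega> in M. (\<lambda>n. J n \<omega> * ?\<Delta> \<omega>) \<longlonglongrightarrow> ?\<Delta> \<omega>" using lim by (intro AE_I2)
    show "AE \<omega> in M. norm (J n \<omega> * ?\<Delta> \<omega>) \<le> \<bar>?\<Delta> \<omega>\<bar>" for n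
    proof (rule AE_I2)
      fix \<omega> show "norm (J n \<omega> * ?\<Delta> \<omega>) \<le> \<bar>?\<Delta> \<omega>\<bar>" using J01[of n \<omega>] by auto
    qed
    show "(\<lambda>\<omega>. J n \<omega> * ?\<Delta> \<omega>) \<in> borel_measurable M" for n using J\<Delta> by (rule borel_measurable_integrable)
  qed (use int in auto)
  then show ?thesis by (rule LIMSEQ_le_const2) (use neg in auto)
qed

end

section \<open>Accumulated payoff along the interventions\<close>

context controlled_brownian_motion begin

lemma actor_measurable [measurable]: "Measurable.pred M (\<lambda>\<omega>. actor k \<omega> = Player1)"
proof (cases k)
  case (Suc j)
  define ex where "ex i \<omega> = exit_time (fst (\<pi> i)) (traj (stg j \<omega>)) (tau j \<omega>)" for i \<omega>
  have "stopping (ex i)" for i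
    unfolding ex_def
    by (rule stopping_exit_time[OF tau_stopping, of "pos j"])
      (use pos_adapted controlled_path.pos_continuous[OF controlled_path] strategies[of i] in \<open>auto simp: is_strategy_def\<close>)
  then have [measurable]: "ex i \<in> borel_measurable M" for i by (rule stopping_measurable_M)
  have "(\<lambda>\<omega>. actor (Suc j) \<omega> = Player1) = (\<lambda>\<omega>. ex Player1 \<omega> \<le> ex Player2 \<omega>)"
    by (simp add: stages.simps(2) next_stage_def Let_def ex_def fun_eq_iff)
  then show ?thesis unfolding Suc by simp
qed simp

definition gain :: "real \<Rightarrow> (player \<Rightarrow> real \<Rightarrow> real) \<Rightarrow> nat \<Rightarrow> real \<Rightarrow> 'a \<Rightarrow> real" where
  "gain r g k T \<omega> = (if tau k \<omega> \<le> ereal T then exp (- r * tauc k T \<omega>) * g (actor k \<omega>) (jump k \<omega>) else 0)"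

text \<open>The impulse is recovered as the difference of two consecutive trajectories at the
  intervention time, so its measurability comes from that of the positions.\<close>

lemma gain_measurable:
  assumes [measurable]: "g Player1 \<in> borel_measurable borel" "g Player2 \<in> borel_measurable borel" and T: "0 \<le> T"
  shows "gain r g (Suc k) T \<in> borel_measurable M"
proof -
  note [measurable] = capped_tau_measurable[OF T]
  define d where "d \<omega> = pos (Suc k) (tauc (Suc k) T \<omega>) \<omega> - pos k (tauc (Suc k) T \<omega>) \<omega>" for \<omega>
  have [measurable]: "d \<in> borel_measurable M"
    unfolding d_def using T by (intro borel_measurable_diff pos_measurable_at capped_tau_measurable) (auto simp: capped_nonneg)
  have "(\<lambda>\<omega>. if tau (Suc k) \<omega> \<le> ereal T then exp (- r * tauc (Suc k) T \<omega>) *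
      (if actor (Suc k) \<omega> = Player1 then g Player1 (d \<omega>) else g Player2 (d \<omega>)) else 0) \<in> borel_measurable M"
    by measurable
  then show ?thesis
  proof (rule measurable_cong[THEN iffD1, rotated])
    fix \<omega> assume \<omega>: "\<omega> \<in> space M"
    have "g (actor (Suc k) \<omega>) (jump (Suc k) \<omega>) = (if actor (Suc k) \<omega> = Player1 then g Player1 (d \<omega>) else g Player2 (d \<omega>))"
      if "tau (Suc k) \<omega> \<le> ereal T"
    proof -
      have "d \<omega> = jump (Suc k) \<omega>"
        using controlled_path.pos_Suc[OF controlled_path[OF \<omega>], of sig x k "tauc (Suc k) T \<omega>"] tau_finite[OF that]
        by (simp add: d_def)
      then show ?thesis by (cases "actor (Suc k) \<omega>") auto
    qed
    then show "(if tau (Suc k) \<omega> \<le> ereal T then exp (- r * tauc (Suc k) T \<omega>) *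
      (if actor (Suc k) \<omega> = Player1 then g Player1 (d \<omega>) else g Player2 (d \<omega>)) else 0) = gain r g (Suc k) T \<omega>"
      by (simp add: gain_def)
  qed
qed

text \<open>The position is the free path plus finitely many step functions of time, and each of
  these is integrable on a bounded interval.\<close>

lemma set_integrable_pos:
  assumes \<omega>: "\<omega> \<in> space M" and a: "0 \<le> a"
  shows "set_integrable lborel {a..<b} (\<lambda>s. exp (- r * s) * (p + q * pos k s \<omega>))"
proof -
  interpret P: controlled_path sig x \<pi> "\<lambda>t. W t \<omega>" by (rule controlled_path[OF \<omega>])
  have ex: "set_integrable lborel {a..<b} (\<lambda>s. exp (- r * s))"
    by (rule set_integrable_subset[OF borel_integrable_atLeastAtMost'[of a b]]) (auto intro!: continuous_intros)
  have st: "set_integrable lborel {a..<b} (\<lambda>s. exp (- r * s) * (if u \<le> ereal s then d else 0))" for u d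
  proof (rule set_integrable_bound[OF set_integrable_mult_right[OF ex, of "\<bar>d\<bar>"]])
    show "set_borel_measurable lborel {a..<b} (\<lambda>s. exp (- r * s) * (if u \<le> ereal s then d else 0))"
      unfolding set_borel_measurable_def by measurable
    show "AE s in lborel. s \<in> {a..<b} \<longrightarrow> norm (exp (- r * s) * (if u \<le> ereal s then d else 0)) \<le> norm (\<bar>d\<bar> * exp (- r * s))"
      by (simp add: abs_mult)
  qed
  have eq: "exp (- r * s) * (p + q * pos k s \<omega>) = (p + q * x) * exp (- r * s) + q * sig * (exp (- r * s) * W s \<omega>)
     + q * (\<Sum>i\<in>{0<..k}. exp (- r * s) * (if tau i \<omega> \<le> ereal s then jump i \<omega> else 0))" for s
    using P.pos_shift[of 0 k s] by (simp add: algebra_simps sum_distrib_left)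
  show ?thesis unfolding eq
  proof (intro set_integral_add(1) set_integrable_mult_right ex set_integrable_path[OF \<omega> a])
    show "set_integrable lborel {a..<b} (\<lambda>s. \<Sum>i\<in>{0<..k}. exp (- r * s) * (if tau i \<omega> \<le> ereal s then jump i \<omega> else 0))"
      using st unfolding set_integrable_def
      by (simp only: scaleR_sum_right) (intro Bochner_Integration.integrable_sum)
  qed
qed

lemma integral_pos_measurable:
  assumes [measurable]: "u \<in> borel_measurable M" "v \<in> borel_measurable M" and u: "\<And>\<omega>. \<omega> \<in> space M \<Longrightarrow> 0 \<le> u \<omega>"
  shows "(\<lambda>\<omega>. flow r p q k (u \<omega>) (v \<omega>) \<omega>) \<in> borel_measurable M"
proof -
  have [measurable]: "(\<lambda>z. pos k (max 0 (snd z)) (fst z)) \<in> borel_measurable (M \<Otimes>\<^sub>M borel)"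
    using pos_joint_measurable[of k] by (simp add: split_beta')
  have "(\<lambda>(\<omega>, s). (if u \<omega> \<le> s \<and> s < v \<omega> then exp (- r * s) * (p + q * pos k (max 0 s) \<omega>) else 0)) \<in> borel_measurable (M \<Otimes>\<^sub>M lborel)"
    unfolding split_beta' by measurable
  then have "(\<lambda>\<omega>. \<integral>s. (if u \<omega> \<le> s \<and> s < v \<omega> then exp (- r * s) * (p + q * pos k (max 0 s) \<omega>) else 0) \<partial>lborel) \<in> borel_measurable M"
    by (rule lborel.borel_measurable_lebesgue_integral)
  then show ?thesis
  proof (rule measurable_cong[THEN iffD1, rotated])
    fix \<omega> assume "\<omega> \<in> space M"
    then have "0 \<le> u \<omega>" by (rule u)
    then show "(\<integral>s. (if u \<omega> \<le> s \<and> s < v \<omega> then exp (- r * s) * (p + q * pos k (max 0 s) \<omega>) else 0) \<partial>lborel)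
      = (flow r p q k (u \<omega>) (v \<omega>) \<omega>)"
      unfolding set_lebesgue_integral_def
      by (intro Bochner_Integration.integral_cong) (auto simp: indicator_def max_def)
  qed
qed

text \<open>At a fixed horizon the number \<open>k\<close> of interventions plays the role of time:
  this is what has been earned through the first \<open>k\<close> of them, plus the discounted value
  of the position reached. Its expectation will be bounded by \<open>V x\<close> for all
  \<open>k\<close>.\<close>

definition accrued :: "(real \<Rightarrow> real) \<Rightarrow> (player \<Rightarrow> real \<Rightarrow> real) \<Rightarrow> real \<Rightarrow> real \<Rightarrow> real \<Rightarrow> nat \<Rightarrow> real \<Rightarrow> 'a \<Rightarrow> real" where
  "accrued V g r p q k T \<omega> =
     exp (- r * tauc k T \<omega>) * V (pos k (tauc k T \<omega>) \<omega>)
     + (flow r p q k 0 (tauc k T \<omega>) \<omega>)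
     + (\<Sum>j\<in>{0<..k}. gain r g j T \<omega>)"

text \<open>One stage splits into an uncontrolled part, which is the increment
  \<open>\<Delta>\<close>, and an intervention, at which the obstacle inequality
  \<open>interv\<close> absorbs the gain. If the next intervention lies beyond the horizon, no jump
  takes place at \<open>T\<close>.\<close>

lemma accrued_Suc_le:
  fixes V g r p q T k \<omega>
  defines "\<Delta> \<equiv> exp (- r * tauc (Suc k) T \<omega>) * V (pos k (tauc (Suc k) T \<omega>) \<omega>)
      - exp (- r * tauc k T \<omega>) * V (pos k (tauc k T \<omega>) \<omega>)
      + (flow r p q k (tauc k T \<omega>) (tauc (Suc k) T \<omega>) \<omega>)"
  assumes \<omega>: "\<omega> \<in> space M" and T: "0 < T"
    and interv: "\<And>i y. y \<notin> fst (\<pi> i) \<Longrightarrow> V (y + snd (\<pi> i) y) + g i (snd (\<pi> i) y) \<le> V y"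
  shows "accrued V g r p q (Suc k) T \<omega> \<le> accrued V g r p q k T \<omega> + (if tau k \<omega> \<le> ereal T then \<Delta> else 0)"
proof -
  interpret P: controlled_path sig x \<pi> "\<lambda>t. W t \<omega>" by (rule controlled_path[OF \<omega>])
  define t where "t = tauc k T \<omega>"
  define t' where "t' = tauc (Suc k) T \<omega>"
  have t: "0 \<le> t" "t \<le> t'" "ereal t' \<le> tau (Suc k) \<omega>"
    using T P.tm_le_Suc unfolding t_def t'_def by (auto simp: capped_nonneg capped_mono ereal_capped)
  have int: "set_integrable lborel {a..<b} (\<lambda>s. exp (- r * s) * (p + q * pos k s \<omega>))" if "0 \<le> a" for a b
    using set_integrable_pos[OF \<omega> that] .
  have I: "(flow r p q (Suc k) 0 t' \<omega>)
     = (flow r p q k 0 t' \<omega>)"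
  proof (rule set_lebesgue_integral_cong)
    have "\<not> tau (Suc k) \<omega> \<le> ereal s" if "s < t'" for s
      using that t(3) by (auto simp: not_le intro: less_le_trans[of _ "ereal t'"])
    then show "\<forall>s. s \<in> {0..<t'} \<longrightarrow> exp (- r * s) * (p + q * pos (Suc k) s \<omega>) = exp (- r * s) * (p + q * pos k s \<omega>)"
      by (auto simp: P.pos_Suc)
  qed simp
  have I2: "(flow r p q k 0 t' \<omega>) =
    (flow r p q k 0 t \<omega>) + (flow r p q k t t' \<omega>)"
  proof -
    have "{0..<t'} = {0..<t} \<union> {t..<t'}" using t by auto
    then show ?thesis using int[of 0 t] int[of t t'] t by (simp add: set_integral_Un)
  qed
  have jump: "exp (- r * t') * V (pos (Suc k) t' \<omega>) + gain r g (Suc k) T \<omega> \<le> exp (- r * t') * V (pos k t' \<omega>)"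
  proof (cases "tau (Suc k) \<omega> \<le> ereal T")
    case True
    then have fin: "tau (Suc k) \<omega> = ereal t'" unfolding t'_def by (rule tau_finite)
    have "pos (Suc k) t' \<omega> = pos k t' \<omega> + jump (Suc k) \<omega>" using fin by (simp add: P.pos_Suc)
    moreover have "V (pos k t' \<omega> + jump (Suc k) \<omega>) + g (actor (Suc k) \<omega>) (jump (Suc k) \<omega>) \<le> V (pos k t' \<omega>)"
      using interv[OF P.pos_at_intervention[OF fin]] P.jump_Suc[OF fin] by simp
    ultimately have "exp (- r * t') * (V (pos (Suc k) t' \<omega>) + g (actor (Suc k) \<omega>) (jump (Suc k) \<omega>)) \<le> exp (- r * t') * V (pos k t' \<omega>)"
      by (intro mult_left_mono) auto
    then show ?thesis using True by (simp add: gain_def t'_def distrib_left)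
  next
    case False
    then have "t' = T" unfolding t'_def by (intro capped_ge) auto
    then show ?thesis using False by (simp add: gain_def P.pos_Suc)
  qed
  have sum: "(\<Sum>j\<in>{0<..Suc k}. gain r g j T \<omega>) = (\<Sum>j\<in>{0<..k}. gain r g j T \<omega>) + gain r g (Suc k) T \<omega>"
    by (simp add: atLeastSucAtMost_greaterThanAtMost[symmetric])
  show ?thesis
  proof (cases "tau k \<omega> \<le> ereal T")
    case True
    then show ?thesis
      using jump unfolding accrued_def \<Delta>_def t_def[symmetric] t'_def[symmetric] I I2 sum by simp
  next
    case False
    then have "t = T" "ereal T \<le> tau (Suc k) \<omega>"
      using P.tm_le_Suc[of k] unfolding t_def by (auto intro!: capped_ge intro: order_trans)
    then have "t = t'" unfolding t'_def by (simp add: capped_ge)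
    then show ?thesis
      using False jump unfolding accrued_def t_def[symmetric] t'_def[symmetric] I sum by simp
  qed
qed

text \<open>Induction over the interventions, with all integrability drawn from one majorant. It
  bounds the value after an intervention (\<open>Dom1\<close>) and just before it
  (\<open>Dom2\<close>), the running payoff from an arbitrary earlier time, and each gain. The free
  time \<open>a\<close> serves both the current stage and time 0.\<close>

lemma accrued_le:
  fixes V \<alpha> \<beta> Dom :: "_ \<Rightarrow> real" and r \<theta> p q T :: real
  assumes r: "0 < r" "r = (sig * \<theta>)\<^sup>2 / 2" and T: "0 < T"
    and D: "closed D" "fst (\<pi> Player1) \<inter> fst (\<pi> Player2) \<subseteq> D"
    and \<alpha>\<beta>: "\<alpha> \<in> borel_measurable borel" "\<beta> \<in> borel_measurable borel"
    and V [measurable]: "V \<in> borel_measurable borel"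
    and g: "g Player1 \<in> borel_measurable borel" "g Player2 \<in> borel_measurable borel"
    and touch: "\<And>a. a \<in> D \<Longrightarrow> V a = \<alpha> a + \<beta> a + (p + q * a) / r"
    and dom: "\<And>a b. a \<in> D \<Longrightarrow> b \<in> D \<Longrightarrow>
      V b \<le> \<alpha> a * exp (\<theta> * (b - a)) + \<beta> a * exp (- \<theta> * (b - a)) + (p + q * b) / r"
    and interv: "\<And>i y. y \<notin> fst (\<pi> i) \<Longrightarrow> V (y + snd (\<pi> i) y) + g i (snd (\<pi> i) y) \<le> V y"
    and Dom: "integrable M Dom"
    and Dom1: "\<And>k. AE \<omega> in M. \<bar>exp (- r * tauc k T \<omega>) * V (pos k (tauc k T \<omega>) \<omega>)\<bar> \<le> Dom \<omega>"
    and Dom2: "\<And>k. AE \<omega> in M. \<bar>exp (- r * tauc (Suc k) T \<omega>) * V (pos k (tauc (Suc k) T \<omega>) \<omega>)\<bar> \<le> Dom \<omega>"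
    and Dom3: "\<And>k a. AE \<omega> in M. (0 \<le> a \<omega> \<and> a \<omega> \<le> tauc (Suc k) T \<omega> \<longrightarrow>
        \<bar>flow r p q k (a \<omega>) (tauc (Suc k) T \<omega>) \<omega>\<bar> \<le> Dom \<omega>)"
    and Dom4: "\<And>k. AE \<omega> in M. \<bar>gain r g (Suc k) T \<omega>\<bar> \<le> Dom \<omega>"
  shows "integrable M (accrued V g r p q k T) \<and> expectation (accrued V g r p q k T) \<le> V x"
proof (induction k)
  case 0
  have eq: "accrued V g r p q 0 T \<omega> = V x" if "\<omega> \<in> space M" for \<omega>
    using T by (simp add: accrued_def capped_def min_def path_zero[OF that] set_lebesgue_integral_def)
  have "integrable M (accrued V g r p q 0 T) \<longleftrightarrow> integrable M (\<lambda>_. V x)"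
    "expectation (accrued V g r p q 0 T) = expectation (\<lambda>_. V x)"
    by (rule Bochner_Integration.integrable_cong Bochner_Integration.integral_cong; simp add: eq)+
  then show ?case by (simp add: prob_space)
next
  case (Suc k)
  note T0 = less_imp_le[OF T]
  define \<Delta> where "\<Delta> \<omega> = exp (- r * tauc (Suc k) T \<omega>) * V (pos k (tauc (Suc k) T \<omega>) \<omega>)
      - exp (- r * tauc k T \<omega>) * V (pos k (tauc k T \<omega>) \<omega>)
      + (flow r p q k (tauc k T \<omega>) (tauc (Suc k) T \<omega>) \<omega>)" for \<omega>
  note [measurable] = capped_tau_measurable[OF T0]
  have c0: "0 \<le> tauc j T \<omega>" for j \<omega> using T0 by (simp add: capped_nonneg)
  have m [measurable]: "(\<lambda>\<omega>. pos j (tauc l T \<omega>) \<omega>) \<in> borel_measurable M" for j l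
    by (rule pos_measurable_at) (simp_all add: capped_tau_measurable[OF T0] c0)
  have mI [measurable]: "(\<lambda>\<omega>. flow r p q j (tauc i T \<omega>) (tauc l T \<omega>) \<omega>) \<in> borel_measurable M" for i j l
    by (rule integral_pos_measurable) (simp_all add: capped_tau_measurable[OF T0] c0)
  have i1: "integrable M (\<lambda>\<omega>. exp (- r * tauc j T \<omega>) * V (pos j (tauc j T \<omega>) \<omega>))" for j
    by (rule Bochner_Integration.integrable_bound[OF Dom]) (use Dom1[of j] in \<open>measurable, auto\<close>)
  have i2: "integrable M (\<lambda>\<omega>. exp (- r * tauc (Suc k) T \<omega>) * V (pos k (tauc (Suc k) T \<omega>) \<omega>))"
    by (rule Bochner_Integration.integrable_bound[OF Dom]) (use Dom2[of k] in \<open>measurable, auto\<close>)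
  have mono: "tauc k T \<omega> \<le> tauc (Suc k) T \<omega>" if "\<omega> \<in> space M" for \<omega>
    using tau_le_Suc[OF that] by (simp add: capped_mono)
  have i3: "integrable M (\<lambda>\<omega>. flow r p q k (tauc k T \<omega>) (tauc (Suc k) T \<omega>) \<omega>)"
  proof (rule Bochner_Integration.integrable_bound[OF Dom])
    show "AE \<omega> in M. norm (flow r p q k (tauc k T \<omega>) (tauc (Suc k) T \<omega>) \<omega>) \<le> norm (Dom \<omega>)"
      using Dom3[of "\<lambda>\<omega>. tauc k T \<omega>" k] AE_space by eventually_elim (use mono c0 in auto)
  qed measurable
  have \<Delta>_int: "integrable M \<Delta>" unfolding \<Delta>_def using i1[of k] i2 i3 by auto
  have [measurable]: "Measurable.pred M (\<lambda>\<omega>. tau k \<omega> \<le> ereal T)"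
    using stopping_pred[OF tau_stopping T0] T0 by (rule measurable_F_M)
  have \<Delta>'_int: "integrable M (\<lambda>\<omega>. if tau k \<omega> \<le> ereal T then \<Delta> \<omega> else 0)"
  proof (rule Bochner_Integration.integrable_bound[OF \<Delta>_int])
    have [measurable]: "\<Delta> \<in> borel_measurable M" by (rule borel_measurable_integrable[OF \<Delta>_int])
    show "(\<lambda>\<omega>. if tau k \<omega> \<le> ereal T then \<Delta> \<omega> else 0) \<in> borel_measurable M" by measurable
  qed auto
  have step: "expectation (\<lambda>\<omega>. if tau k \<omega> \<le> ereal T then \<Delta> \<omega> else 0) \<le> 0"
    using stage_step[OF r T D \<alpha>\<beta> touch dom, where k = k] \<Delta>'_int unfolding \<Delta>_def by blast
  have ig: "integrable M (gain r g (Suc j) T)" for j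
    by (rule Bochner_Integration.integrable_bound[OF Dom gain_measurable[OF g T0]]) (use Dom4[of j] in auto)
  have int: "integrable M (accrued V g r p q (Suc k) T)"
    unfolding accrued_def
  proof (intro Bochner_Integration.integrable_add i1 Bochner_Integration.integrable_sum)
    have eq: "(flow r p q (Suc k) 0 (tauc (Suc k) T \<omega>) \<omega>)
     = (flow r p q k 0 (tauc (Suc k) T \<omega>) \<omega>)"
      if \<omega>: "\<omega> \<in> space M" for \<omega>
    proof (rule set_lebesgue_integral_cong)
      have "\<not> tau (Suc k) \<omega> \<le> ereal s" if "s < tauc (Suc k) T \<omega>" for s
      proof -
        have "ereal s < ereal (tauc (Suc k) T \<omega>)" using that by simp
        also have "\<dots> \<le> tau (Suc k) \<omega>" by (simp add: ereal_capped)
        finally show ?thesis by simp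
      qed
      then show "\<forall>s. s \<in> {0..<tauc (Suc k) T \<omega>} \<longrightarrow>
          exp (- r * s) * (p + q * pos (Suc k) s \<omega>) = exp (- r * s) * (p + q * pos k s \<omega>)"
        by (auto simp: controlled_path.pos_Suc[OF controlled_path[OF \<omega>]])
    qed simp
    have "integrable M (\<lambda>\<omega>. flow r p q k 0 (tauc (Suc k) T \<omega>) \<omega>)"
    proof (rule Bochner_Integration.integrable_bound[OF Dom])
      show "AE \<omega> in M. norm (flow r p q k 0 (tauc (Suc k) T \<omega>) \<omega>) \<le> norm (Dom \<omega>)"
        using Dom3[of "\<lambda>_. 0" k] by eventually_elim (use c0 in auto)
      show "(\<lambda>\<omega>. flow r p q k 0 (tauc (Suc k) T \<omega>) \<omega>) \<in> borel_measurable M"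
        by (rule integral_pos_measurable) (simp_all add: capped_tau_measurable[OF T0])
    qed
    then show "integrable M (\<lambda>\<omega>. flow r p q (Suc k) 0 (tauc (Suc k) T \<omega>) \<omega>)"
      by (rule Bochner_Integration.integrable_cong[OF refl, THEN iffD1, rotated]) (rule eq[symmetric])
    fix j assume "j \<in> {0<..Suc k}"
    then show "integrable M (\<lambda>\<omega>. gain r g j T \<omega>)" using ig[of "j - 1"] by simp
  qed
  have "expectation (accrued V g r p q (Suc k) T) \<le>
      expectation (\<lambda>\<omega>. accrued V g r p q k T \<omega> + (if tau k \<omega> \<le> ereal T then \<Delta> \<omega> else 0))"
  proof (rule integral_mono[OF int])
    show "integrable M (\<lambda>\<omega>. accrued V g r p q k T \<omega> + (if tau k \<omega> \<le> ereal T then \<Delta> \<omega> else 0))"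
      using Suc.IH \<Delta>'_int by (intro Bochner_Integration.integrable_add) auto
    fix \<omega> assume "\<omega> \<in> space M"
    from accrued_Suc_le[OF this T interv, of r p q k]
    show "accrued V g r p q (Suc k) T \<omega> \<le> accrued V g r p q k T \<omega> + (if tau k \<omega> \<le> ereal T then \<Delta> \<omega> else 0)"
      unfolding \<Delta>_def .
  qed
  also have "\<dots> \<le> V x" using Suc.IH \<Delta>'_int step by (simp add: Bochner_Integration.integral_add)
  finally show ?case using int by blast
qed

end

section \<open>Intervention costs along one path\<close>

context controlled_path begin

text \<open>Costs are indexed by the common numbering of stages, not by each player's own. Stage 0
  has time 0 but is no intervention, hence the condition \<open>1 \<le> k\<close>.\<close>

definition cost :: "real \<Rightarrow> real \<Rightarrow> real \<Rightarrow> nat \<Rightarrow> real" where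
  "cost r a b k = (if 1 \<le> k \<and> tm k < \<infinity> then exp (- r * real_of_ereal (tm k)) * (a + b * \<bar>jump k\<bar>) else 0)"

definition player_cost :: "real \<Rightarrow> real \<Rightarrow> real \<Rightarrow> player \<Rightarrow> nat \<Rightarrow> real" where
  "player_cost r a b j k = (if actor k = j then cost r a b k else 0)"

lemma cost_nonneg: "0 \<le> a \<Longrightarrow> 0 \<le> b \<Longrightarrow> 0 \<le> cost r a b k"
  by (simp add: cost_def)

lemma player_cost_nonneg: "0 \<le> a \<Longrightarrow> 0 \<le> b \<Longrightarrow> 0 \<le> player_cost r a b j k"
  by (simp add: player_cost_def cost_nonneg)

lemma cost_split: "cost r a b k = player_cost r a b Player1 k + player_cost r a b Player2 k"
  by (cases "actor k") (auto simp: player_cost_def)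

text \<open>Passing from a player's own numbering to that of the stages is a reindexing along
  \<open>enumerate\<close>. Counting-measure integrals treat finitely and infinitely many
  interventions alike, and nonnegativity removes any question of convergence.\<close>

lemma control_sum:
  assumes ab: "0 \<le> a" "0 \<le> b"
  shows "(\<Sum>k. ennreal (discounted r a b (control sig \<pi> x w j k))) = (\<Sum>k. ennreal (player_cost r a b j k))"
proof -
  define H where "H = interventions sig \<pi> x w j"
  define A where "A = {k. infinite H \<or> k < card H}"
  have bij: "bij_betw (enumerate H) A H"
    using bij_enumerate[of H] finite_bij_enumerate[of H] unfolding A_def by (cases "finite H") (auto simp: lessThan_def)
  have H: "h \<in> H \<longleftrightarrow> 1 \<le> h \<and> tm h < \<infinity> \<and> actor h = j" for h by (auto simp: H_def interventions_def)
  have ctl: "ennreal (discounted r a b (control sig \<pi> x w j k)) = ennreal (player_cost r a b j (enumerate H k)) * indicator A k" for k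
  proof (cases "k \<in> A")
    case True
    then have "enumerate H k \<in> H" using bij by (auto simp: bij_betw_def)
    then show ?thesis using True H[of "enumerate H k"]
      by (auto simp: control_def H_def[symmetric] A_def discounted_def player_cost_def cost_def Let_def)
  next
    case False
    then show ?thesis by (auto simp: control_def H_def[symmetric] A_def discounted_def Let_def)
  qed
  have out: "ennreal (player_cost r a b j h) * indicator H h = ennreal (player_cost r a b j h)" for h
    using H[of h] by (cases "h \<in> H") (auto simp: player_cost_def cost_def)
  have "(\<Sum>k. ennreal (discounted r a b (control sig \<pi> x w j k))) =
     (\<integral>\<^sup>+k. ennreal (player_cost r a b j (enumerate H k)) * indicator A k \<partial>count_space UNIV)"
    unfolding ctl by (simp add: nn_integral_count_space_nat)
  also have "\<dots> = (\<integral>\<^sup>+k. ennreal (player_cost r a b j (enumerate H k)) \<partial>count_space A)"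
    by (cases "A = UNIV") (auto simp: nn_integral_count_space_indicator)
  also have "\<dots> = (\<integral>\<^sup>+h. ennreal (player_cost r a b j h) \<partial>count_space H)"
    by (rule nn_integral_bij_count_space[OF bij])
  also have "\<dots> = (\<integral>\<^sup>+h. ennreal (player_cost r a b j h) * indicator H h \<partial>count_space UNIV)"
    by (cases "H = UNIV") (auto simp: nn_integral_count_space_indicator)
  also have "\<dots> = (\<Sum>k. ennreal (player_cost r a b j k))"
    unfolding out by (rule nn_integral_count_space_nat)
  finally show ?thesis .
qed

text \<open>Finiteness is required of the \<open>ennreal\<close> series, where reindexing is
  unconditional; the real series then converge and the equality transfers to them.\<close>

lemma control_suminf:
  assumes ab: "0 \<le> a" "0 \<le> b" and fin: "(\<Sum>k. ennreal (discounted r a b (control sig \<pi> x w j k))) < \<infinity>"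
  shows "summable (player_cost r a b j)"
    and "(\<Sum>k. discounted r a b (control sig \<pi> x w j k)) = (\<Sum>k. player_cost r a b j k)"
    and "(\<Sum>k. player_cost r a b j k) = enn2real (\<Sum>k. ennreal (discounted r a b (control sig \<pi> x w j k)))"
proof -
  have d0: "0 \<le> discounted r a b (control sig \<pi> x w j k)" for k using ab by (simp add: discounted_def)
  have p0: "0 \<le> player_cost r a b j k" for k by (rule player_cost_nonneg[OF ab])
  have sd: "summable (\<lambda>k. discounted r a b (control sig \<pi> x w j k))"
    using fin by (intro summable_suminf_not_top d0) auto
  show sp: "summable (player_cost r a b j)"
    using fin unfolding control_sum[OF ab] by (intro summable_suminf_not_top p0) auto
  have "ennreal (\<Sum>k. discounted r a b (control sig \<pi> x w j k)) = ennreal (\<Sum>k. player_cost r a b j k)"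
    using control_sum[OF ab, of r j] unfolding suminf_ennreal2[OF d0 sd] suminf_ennreal2[OF p0 sp] .
  then show eq: "(\<Sum>k. discounted r a b (control sig \<pi> x w j k)) = (\<Sum>k. player_cost r a b j k)"
    using suminf_nonneg[OF sd d0] suminf_nonneg[OF sp p0] by (simp add: ennreal_inj)
  show "(\<Sum>k. player_cost r a b j k) = enn2real (\<Sum>k. ennreal (discounted r a b (control sig \<pi> x w j k)))"
    unfolding suminf_ennreal2[OF d0 sd] eq using suminf_nonneg[OF sp p0] by simp
qed

text \<open>If all times stayed below \<open>T\<close>, every stage other than 0 would be an
  intervention. One of the two players would act infinitely often before \<open>T\<close>, against
  the divergence of that player's times.\<close>

lemma tm_unbounded:
  assumes lim: "\<And>j. (\<lambda>k. fst (control sig \<pi> x w j k)) \<longlonglongrightarrow> \<infinity>"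
  shows "\<exists>k. ereal T < tm k"
proof (rule ccontr)
  assume "\<not> (\<exists>k. ereal T < tm k)"
  then have bd: "tm k \<le> ereal T" for k by (auto simp: not_less)
  then have fin: "tm k < \<infinity>" for k
    using le_less_trans[OF bd[of k], of \<infinity>] by simp
  have un: "insert 0 (interventions sig \<pi> x w Player1 \<union> interventions sig \<pi> x w Player2) = UNIV"
  proof (intro set_eqI iffI UNIV_I)
    fix h :: nat
    show "h \<in> insert 0 (interventions sig \<pi> x w Player1 \<union> interventions sig \<pi> x w Player2)"
      using fin[of h] by (cases "actor h"; cases h) (auto simp: interventions_def)
  qed
  have "infinite (insert 0 (interventions sig \<pi> x w Player1 \<union> interventions sig \<pi> x w Player2))"
    unfolding un by (rule infinite_UNIV_nat)
  then have "infinite (interventions sig \<pi> x w Player1) \<or> infinite (interventions sig \<pi> x w Player2)" by simp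
  then obtain j where inf: "infinite (interventions sig \<pi> x w j)" by blast
  have "fst (control sig \<pi> x w j k) \<le> ereal T" for k
    using inf bd by (simp add: control_def Let_def)
  moreover have "\<forall>\<^sub>F k in sequentially. ereal T < fst (control sig \<pi> x w j k)"
    using lim[of j] by (rule order_tendstoD) simp
  ultimately show False by (auto simp: eventually_sequentially not_le[symmetric])
qed

text \<open>The \<open>k\<close>-th intervention of a player is at least the \<open>k\<close>-th in
  the common numbering, so its time is at least \<open>tm k\<close>.\<close>

lemma control_times_tendsto:
  assumes unb: "\<And>T. \<exists>k. ereal T < tm k"
  shows "(\<lambda>k. fst (control sig \<pi> x w j k)) \<longlonglongrightarrow> \<infinity>"
  unfolding tendsto_PInfty
proof
  fix T
  obtain n where n: "ereal T < tm n" using unb by blast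
  define H where "H = interventions sig \<pi> x w j"
  have "ereal T < fst (control sig \<pi> x w j k)" if k: "n \<le> k" for k
  proof (cases "infinite H \<or> k < card H")
    case True
    then have "k \<le> enumerate H k"
      using le_enumerate[of H k] finite_le_enumerate[of H k] by auto
    then have "tm n \<le> tm (enumerate H k)" using k by (intro tm_mono) simp
    then show ?thesis using n True by (simp add: control_def H_def[symmetric] Let_def)
  qed (simp add: control_def H_def[symmetric] Let_def)
  then show "\<forall>\<^sub>F k in sequentially. ereal T < fst (control sig \<pi> x w j k)"
    by (auto simp: eventually_sequentially)
qed

text \<open>A position reached in the middle of several simultaneous interventions is not a value of the
  state process; it is controlled by the size of the remaining interventions at that time.\<close>

lemma pos_bound:
  assumes r: "0 < r" and ab: "0 \<le> a" "0 \<le> b" and unb: "\<And>T. \<exists>k. ereal T < tm k"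
    and S: "\<And>s. 0 \<le> s \<Longrightarrow> \<bar>state sig \<pi> x w s\<bar> \<le> U"
    and Q: "\<And>n. (\<Sum>h\<in>{0<..n}. cost r a b h) \<le> Q"
    and t: "0 \<le> t" "ereal t \<le> tm (Suc k)"
  shows "exp (- r * t) * (b * \<bar>pos k t\<bar>) \<le> b * U + Q"
proof -
  obtain n where n: "ereal t < tm n" using unb by blast
  \<comment> \<open>By stage \<open>j\<close> the trajectory at time \<open>t\<close> is final, so
    the state there differs from the position only by the jumps after stage
    \<open>k\<close>.\<close>
  define j where "j = max n k"
  have j: "k \<le> j" "ereal t < tm (Suc j)"
    using n tm_mono[of n "Suc j"] by (auto simp: j_def intro: less_le_trans)
  have X: "state sig \<pi> x w t = pos k t + (\<Sum>i\<in>{k<..j}. if tm i \<le> ereal t then jump i else 0)"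
    using state_eq_pos[OF j(2)] pos_shift[OF j(1)] by simp
  have "\<bar>pos k t\<bar> \<le> \<bar>state sig \<pi> x w t\<bar> + \<bar>\<Sum>i\<in>{k<..j}. if tm i \<le> ereal t then jump i else 0\<bar>"
    unfolding X by simp
  also have "\<dots> \<le> U + (\<Sum>i\<in>{k<..j}. \<bar>if tm i \<le> ereal t then jump i else 0\<bar>)"
    using S[OF t(1)] by (intro add_mono sum_abs)
  finally have "b * \<bar>pos k t\<bar> \<le> b * (U + (\<Sum>i\<in>{k<..j}. \<bar>if tm i \<le> ereal t then jump i else 0\<bar>))"
    using ab by (intro mult_left_mono)
  then have "exp (- r * t) * (b * \<bar>pos k t\<bar>) \<le>
      exp (- r * t) * (b * (U + (\<Sum>i\<in>{k<..j}. \<bar>if tm i \<le> ereal t then jump i else 0\<bar>)))"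
    by (rule mult_left_mono) simp
  also have "\<dots> = exp (- r * t) * (b * U) + (\<Sum>i\<in>{k<..j}. exp (- r * t) * (b * \<bar>if tm i \<le> ereal t then jump i else 0\<bar>))"
    by (simp add: distrib_left sum_distrib_left)
  also have "\<dots> \<le> b * U + (\<Sum>i\<in>{k<..j}. cost r a b i)"
  proof (intro add_mono sum_mono)
    have "0 \<le> U" using S[of 0] by (auto intro: order_trans)
    then show "exp (- r * t) * (b * U) \<le> b * U"
      using r t ab by (intro mult_left_le_one_le) auto
    fix i assume i: "i \<in> {k<..j}"
    show "exp (- r * t) * (b * \<bar>if tm i \<le> ereal t then jump i else 0\<bar>) \<le> cost r a b i"
    proof (cases "tm i \<le> ereal t")
      case True
      have "tm (Suc k) \<le> tm i" using i by (intro tm_mono) auto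
      \<comment> \<open>All jumps still missing at time \<open>t\<close> happen exactly at
        \<open>t\<close>, so the discount factor in front agrees with the one in
        \<open>cost\<close>.\<close>
      then have "tm i = ereal t" using True t(2) by simp
      then show ?thesis using i ab by (auto simp: cost_def distrib_left)
    qed (simp add: cost_nonneg ab)
  qed
  also have "(\<Sum>i\<in>{k<..j}. cost r a b i) \<le> (\<Sum>i\<in>{0<..j}. cost r a b i)"
    by (rule sum_mono2) (auto simp: cost_nonneg ab)
  finally show ?thesis using Q[of j] by simp
qed

end

lemma set_integral_at_top:
  fixes f :: "real \<Rightarrow> real"
  assumes f: "set_integrable lborel {0..} f"
  shows "(\<lambda>n. LINT s:{0..<real n}|lborel. f s) \<longlonglongrightarrow> (LINT s:{0..}|lborel. f s)"
  unfolding set_lebesgue_integral_def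
proof (rule integral_dominated_convergence)
  let ?F = "\<lambda>s. indicator {0..} s *\<^sub>R f s"
  show F: "?F \<in> borel_measurable lborel" using f unfolding set_integrable_def by (rule borel_measurable_integrable)
  show "integrable lborel (\<lambda>s. norm (?F s))" using f unfolding set_integrable_def by (rule integrable_norm)
  have eq: "(\<lambda>s. indicator {0..<real n} s *\<^sub>R f s) = (\<lambda>s. indicator {..<real n} s * ?F s)" for n
    by (auto simp: indicator_def fun_eq_iff)
  show "(\<lambda>s. indicator {0..<real n} s *\<^sub>R f s) \<in> borel_measurable lborel" for n
    unfolding eq using F by measurable
  show "AE s in lborel. (\<lambda>n. indicator {0..<real n} s *\<^sub>R f s) \<longlonglongrightarrow> ?F s"
  proof (rule AE_I2, rule tendsto_eventually)
    fix s :: real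
    obtain N :: nat where N: "s < real N" using reals_Archimedean2 by blast
    show "\<forall>\<^sub>F n in sequentially. indicator {0..<real n} s *\<^sub>R f s = ?F s"
      using eventually_ge_at_top[of N] by eventually_elim (use N in \<open>auto simp: indicator_def\<close>)
  qed
  show "AE s in lborel. norm (indicator {0..<real n} s *\<^sub>R f s) \<le> norm (?F s)" for n
    by (rule AE_I2) (auto simp: indicator_def)
qed

lemma integrable_enn2real:
  assumes "integrable_nonneg M f"
  shows "integrable M (\<lambda>\<omega>. enn2real (f \<omega>))" "AE \<omega> in M. f \<omega> < \<infinity>"
proof -
  have f: "f \<in> borel_measurable M" "(\<integral>\<^sup>+ \<omega>. f \<omega> \<partial>M) < \<infinity>" using assms by (auto simp: integrable_nonneg_def)
  show fin: "AE \<omega> in M. f \<omega> < \<infinity>"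
    using nn_integral_noteq_infinite[OF f(1)] f(2) by (auto simp: less_top)
  show "integrable M (\<lambda>\<omega>. enn2real (f \<omega>))"
  proof (rule integrableI_bounded)
    have "(\<integral>\<^sup>+ \<omega>. ennreal (norm (enn2real (f \<omega>))) \<partial>M) \<le> (\<integral>\<^sup>+ \<omega>. f \<omega> \<partial>M)"
      by (rule nn_integral_mono) (simp add: ennreal_enn2real_if)
    then show "(\<integral>\<^sup>+ \<omega>. ennreal (norm (enn2real (f \<omega>))) \<partial>M) < \<infinity>" using f(2) by simp
  qed (use f(1) in measurable)
qed

lemma (in complete_measure) borel_measurable_AE_LIMSEQ:
  fixes f :: "nat \<Rightarrow> 'a \<Rightarrow> real"
  assumes f: "\<And>n. f n \<in> borel_measurable M" and lim: "AE \<omega> in M. (\<lambda>n. f n \<omega>) \<longlonglongrightarrow> g \<omega>"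
  shows "g \<in> borel_measurable M"
proof (rule borel_measurable_AE_cong)
  show "(\<lambda>\<omega>. lim (\<lambda>n. f n \<omega>)) \<in> borel_measurable M"
    using f by (rule borel_measurable_lim_metric)
  show "AE \<omega> in M. lim (\<lambda>n. f n \<omega>) = g \<omega>" using lim by eventually_elim (rule limI)
qed

section \<open>Bounds and limits on almost every path\<close>

context controlled_brownian_motion begin

abbreviation "total_cost \<omega> \<equiv> controlled_path.cost sig x \<pi> (\<lambda>t. W t \<omega>)"
abbreviation "pcost \<omega> \<equiv> controlled_path.player_cost sig x \<pi> (\<lambda>t. W t \<omega>)"
abbreviation "ctl j k \<omega> \<equiv> control sig \<pi> x (\<lambda>t. W t \<omega>) j k"

lemma state_joint_measurable: "(\<lambda>z. X (max 0 (snd z)) (fst z)) \<in> borel_measurable (M \<Otimes>\<^sub>M borel)"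
proof -
  have "(\<lambda>z. pos k (max 0 (snd z)) (fst z)) \<in> borel_measurable (M \<Otimes>\<^sub>M borel)" for k
    using pos_joint_measurable[of k] by (simp add: split_beta')
  then show ?thesis unfolding state_def by (rule borel_measurable_lim_metric)
qed

lemma state_measurable_time:
  assumes "\<omega> \<in> space M" shows "(\<lambda>s. X (max 0 s) \<omega>) \<in> borel_measurable borel"
  using measurable_compose[OF measurable_Pair1'[OF assms] state_joint_measurable] by simp

text \<open>What the passage to the limit uses of a single path. The numbers \<open>S\<close>,
  \<open>Q\<close>, \<open>I\<close> will be values of integrable random variables, bounding the
  state, the total cost and the running payoff.\<close>

definition regular_path :: "real \<Rightarrow> real \<Rightarrow> real \<Rightarrow> real \<Rightarrow> real \<Rightarrow> real \<Rightarrow> real \<Rightarrow> real \<Rightarrow> 'a \<Rightarrow> bool" where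
  "regular_path r a b p q S Q I \<omega> \<longleftrightarrow>
    \<omega> \<in> space M \<and> (\<forall>T. \<exists>k. ereal T < tau k \<omega>) \<and> (\<forall>s\<ge>0. \<bar>X s \<omega>\<bar> \<le> S) \<and>
    summable (total_cost \<omega> r a b) \<and>
    suminf (total_cost \<omega> r a b) = Q \<and>
    set_integrable lborel {0..} (\<lambda>s. exp (- r * s) * (p + q * X s \<omega>)) \<and>
    (LINT s:{0..}|lborel. \<bar>exp (- r * s) * (p + q * X s \<omega>)\<bar>) \<le> I"

definition total_gain :: "real \<Rightarrow> (player \<Rightarrow> real \<Rightarrow> real) \<Rightarrow> nat \<Rightarrow> 'a \<Rightarrow> real" where
  "total_gain r g k \<omega> = (if tau k \<omega> < \<infinity> then exp (- r * real_of_ereal (tau k \<omega>)) * g (actor k \<omega>) (jump k \<omega>) else 0)"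

lemma gain_eq: "gain r g k T \<omega> = (if tau k \<omega> \<le> ereal T then total_gain r g k \<omega> else 0)"
proof (cases "tau k \<omega> \<le> ereal T")
  case True
  then have "real_of_ereal (tau k \<omega>) = tauc k T \<omega>"
    using tau_finite[OF True] by (metis real_of_ereal.simps(1))
  moreover have "tau k \<omega> < \<infinity>" using le_less_trans[OF True, of \<infinity>] by simp
  ultimately show ?thesis using True by (simp add: gain_def total_gain_def)
qed (simp add: gain_def)

text \<open>The growth of \<open>V\<close> is linear with the proportional cost \<open>b\<close> as
  slope, because \<open>b\<close> times a position is bounded even in the middle of simultaneous
  interventions. The limits are taken in two steps: \<open>L T\<close> exhausts the interventions at
  a fixed horizon, then the horizon tends to infinity.\<close>

lemma regular_path_limits:
  fixes V :: "real \<Rightarrow> real" and g and r a b p q S Q I C :: real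
  assumes reg: "regular_path r a b p q S Q I \<omega>" and r: "0 < r" and ab: "0 \<le> a" "0 \<le> b"
    and growth: "\<And>y. \<bar>V y\<bar> \<le> C * (1 + b * \<bar>y\<bar>)" and C: "0 \<le> C"
    and g: "\<And>j d. \<bar>g j d\<bar> \<le> a + b * \<bar>d\<bar>"
  defines "B \<equiv> C * (1 + b * S + Q)"
  defines "L \<equiv> \<lambda>T. exp (- r * T) * V (X T \<omega>) + (LINT s:{0..<T}|lborel. exp (- r * s) * (p + q * X s \<omega>))
      + (\<Sum>k. gain r g (Suc k) T \<omega>)"
  shows "\<And>t k. 0 \<le> t \<Longrightarrow> ereal t \<le> tau (Suc k) \<omega> \<Longrightarrow> \<bar>exp (- r * t) * V (pos k t \<omega>)\<bar> \<le> B"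
    and "\<And>t u k. 0 \<le> u \<Longrightarrow> ereal t \<le> tau (Suc k) \<omega> \<Longrightarrow>
      \<bar>flow r p q k u t \<omega>\<bar> \<le> I"
    and "\<And>k T. \<bar>gain r g (Suc k) T \<omega>\<bar> \<le> Q"
    and "\<And>k T. 0 < T \<Longrightarrow> \<bar>accrued V g r p q k T \<omega>\<bar> \<le> B + I + Q"
    and "\<And>T. 0 < T \<Longrightarrow> (\<lambda>k. accrued V g r p q k T \<omega>) \<longlonglongrightarrow> L T"
    and "(\<lambda>n. L (real n)) \<longlonglongrightarrow> (LINT s:{0..}|lborel. exp (- r * s) * (p + q * X s \<omega>)) + (\<Sum>k. total_gain r g (Suc k) \<omega>)"
proof -
  have \<omega>: "\<omega> \<in> space M" and unb: "\<And>T. \<exists>k. ereal T < tau k \<omega>" and S: "\<And>s. 0 \<le> s \<Longrightarrow> \<bar>X s \<omega>\<bar> \<le> S"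
    and sint: "set_integrable lborel {0..} (\<lambda>s. exp (- r * s) * (p + q * X s \<omega>))"
    and I: "(LINT s:{0..}|lborel. \<bar>exp (- r * s) * (p + q * X s \<omega>)\<bar>) \<le> I"
    using reg by (auto simp: regular_path_def)
  interpret P: controlled_path sig x \<pi> "\<lambda>t. W t \<omega>" by (rule controlled_path[OF \<omega>])
  have cs: "summable (P.cost r a b)" "suminf (P.cost r a b) = Q" using reg by (auto simp: regular_path_def)
  have c0: "0 \<le> P.cost r a b k" for k by (rule P.cost_nonneg[OF ab])
  have Qsum: "(\<Sum>h\<in>{0<..n}. P.cost r a b h) \<le> Q" for n
    unfolding cs(2)[symmetric] by (rule sum_le_suminf[OF cs(1)]) (auto simp: c0)
  have tg: "\<bar>total_gain r g (Suc k) \<omega>\<bar> \<le> P.cost r a b (Suc k)" for k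
    using g by (auto simp: total_gain_def P.cost_def abs_mult intro!: mult_left_mono)
  have gn: "\<bar>gain r g (Suc k) T \<omega>\<bar> \<le> P.cost r a b (Suc k)" for k T
    using tg[of k] c0[of "Suc k"] by (simp add: gain_eq)
  have csuc: "P.cost r a b (Suc k) \<le> Q" for k
    using Qsum[of "Suc k"] member_le_sum[of "Suc k" "{0<..Suc k}" "P.cost r a b"] c0 by auto
  show g3: "\<bar>gain r g (Suc k) T \<omega>\<bar> \<le> Q" for k T using gn[of k T] csuc[of k] by simp
  show V1: "\<bar>exp (- r * t) * V (pos k t \<omega>)\<bar> \<le> B" if t: "0 \<le> t" "ereal t \<le> tau (Suc k) \<omega>" for t k
  proof -
    have "\<bar>exp (- r * t) * V (pos k t \<omega>)\<bar> \<le> exp (- r * t) * (C * (1 + b * \<bar>pos k t \<omega>\<bar>))"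
      using growth[of "pos k t \<omega>"] by (simp add: abs_mult)
    also have "\<dots> = C * (exp (- r * t) + exp (- r * t) * (b * \<bar>pos k t \<omega>\<bar>))" by (simp add: algebra_simps)
    also have "\<dots> \<le> C * (1 + (b * S + Q))"
      using P.pos_bound[OF r ab unb S Qsum t] r t C by (intro mult_left_mono add_mono) auto
    finally show ?thesis by (simp add: B_def add.assoc)
  qed
  have Xpos: "X s \<omega> = pos k s \<omega>" if "ereal s < tau (Suc k) \<omega>" for s k using P.state_eq_pos[OF that] .
  have set_int: "set_integrable lborel {u..<t} (\<lambda>s. exp (- r * s) * (p + q * X s \<omega>))" if "0 \<le> u" for u t
    by (rule set_integrable_subset[OF sint]) (use that in auto)
  have IX: "\<bar>LINT s:{u..<t}|lborel. exp (- r * s) * (p + q * X s \<omega>)\<bar> \<le> I" if u: "0 \<le> u" for u t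
  proof -
    have "\<bar>LINT s:{u..<t}|lborel. exp (- r * s) * (p + q * X s \<omega>)\<bar> \<le> (LINT s:{u..<t}|lborel. \<bar>exp (- r * s) * (p + q * X s \<omega>)\<bar>)"
      using set_integral_norm_bound[OF set_int[OF u]] by simp
    also have "\<dots> \<le> (LINT s:{0..}|lborel. \<bar>exp (- r * s) * (p + q * X s \<omega>)\<bar>)"
      unfolding set_lebesgue_integral_def
      by (rule integral_mono)
        (use set_integrable_abs[OF set_int[OF u, of t]] set_integrable_abs[OF sint] u in \<open>auto simp: set_integrable_def indicator_def\<close>)
    finally show ?thesis using I by simp
  qed
  have Ieq: "(flow r p q k u t \<omega>) = (LINT s:{u..<t}|lborel. exp (- r * s) * (p + q * X s \<omega>))"
    if t: "ereal t \<le> tau (Suc k) \<omega>" for u t k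
  proof (rule set_lebesgue_integral_cong)
    have "X s \<omega> = pos k s \<omega>" if "s < t" for s
      using that t less_le_trans[of "ereal s" "ereal t"] by (intro Xpos) simp
    then show "\<forall>s. s \<in> {u..<t} \<longrightarrow> exp (- r * s) * (p + q * pos k s \<omega>) = exp (- r * s) * (p + q * X s \<omega>)"
      by simp
  qed simp
  show I2: "\<bar>flow r p q k u t \<omega>\<bar> \<le> I" if "0 \<le> u" "ereal t \<le> tau (Suc k) \<omega>" for t u k
    using IX[OF that(1)] Ieq[OF that(2)] by simp
  have gsum: "\<bar>\<Sum>j\<in>{0<..k}. gain r g j T \<omega>\<bar> \<le> Q" for k T
  proof -
    have "\<bar>\<Sum>j\<in>{0<..k}. gain r g j T \<omega>\<bar> \<le> (\<Sum>j\<in>{0<..k}. P.cost r a b j)"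
    proof (rule order_trans[OF sum_abs sum_mono])
      fix j assume "j \<in> {0<..k}"
      then show "\<bar>gain r g j T \<omega>\<bar> \<le> P.cost r a b j" using gn[of "j - 1" T] by simp
    qed
    then show ?thesis using Qsum[of k] by simp
  qed
  show acc: "\<bar>accrued V g r p q k T \<omega>\<bar> \<le> B + I + Q" if T: "0 < T" for k T
  proof -
    have t: "0 \<le> tauc k T \<omega>" "ereal (tauc k T \<omega>) \<le> tau (Suc k) \<omega>"
      using T P.tm_le_Suc[of k] by (auto simp: capped_nonneg ereal_capped intro: order_trans min.coboundedI1)
    show ?thesis
      using V1[OF t] I2[OF order_refl t(2)] gsum[of T k] unfolding accrued_def by linarith
  qed
  have sumgain: "(\<lambda>k. \<Sum>j\<in>{0<..k}. gain r g j T \<omega>) \<longlonglongrightarrow> (\<Sum>k. gain r g (Suc k) T \<omega>)" for T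
  proof -
    have "summable (\<lambda>k. gain r g (Suc k) T \<omega>)"
      by (rule summable_comparison_test'[OF summable_Suc_iff[THEN iffD2, OF cs(1)]]) (use gn in auto)
    then have "(\<lambda>k. \<Sum>j<k. gain r g (Suc j) T \<omega>) \<longlonglongrightarrow> (\<Sum>k. gain r g (Suc k) T \<omega>)"
      by (rule summable_LIMSEQ)
    moreover have "(\<Sum>j<k. gain r g (Suc j) T \<omega>) = (\<Sum>j\<in>{0<..k}. gain r g j T \<omega>)" for k
      by (rule sum.reindex_bij_witness[of _ "\<lambda>j. j - 1" Suc]) auto
    ultimately show ?thesis by simp
  qed
  show "(\<lambda>k. accrued V g r p q k T \<omega>) \<longlonglongrightarrow> L T" if T: "0 < T" for T
    unfolding accrued_def L_def
  proof (intro tendsto_add sumgain)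
    obtain N where N: "ereal T < tau N \<omega>" using unb by blast
    have ev: "tauc k T \<omega> = T \<and> ereal T < tau (Suc k) \<omega>" if "N \<le> k" for k
      using N P.tm_mono[OF that] P.tm_le_Suc[of k] by (auto intro!: capped_ge)
    show "(\<lambda>k. exp (- r * tauc k T \<omega>) * V (pos k (tauc k T \<omega>) \<omega>)) \<longlonglongrightarrow> exp (- r * T) * V (X T \<omega>)"
      by (rule tendsto_eventually, unfold eventually_sequentially, rule exI[of _ N]) (use ev in \<open>auto simp: Xpos[symmetric]\<close>)
    show "(\<lambda>k. flow r p q k 0 (tauc k T \<omega>) \<omega>) \<longlonglongrightarrow>
      (LINT s:{0..<T}|lborel. exp (- r * s) * (p + q * X s \<omega>))"
      by (rule tendsto_eventually, unfold eventually_sequentially, rule exI[of _ N]) (use ev Ieq[OF less_imp_le[OF ev[THEN conjunct2]]] in auto)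
  qed
  show "(\<lambda>n. L (real n)) \<longlonglongrightarrow> (LINT s:{0..}|lborel. exp (- r * s) * (p + q * X s \<omega>)) + (\<Sum>k. total_gain r g (Suc k) \<omega>)"
  proof -
    have "(\<lambda>n. exp (- r) ^ n) \<longlonglongrightarrow> 0" using r by (intro LIMSEQ_power_zero) simp
    then have e0: "(\<lambda>n. exp (- r * real n)) \<longlonglongrightarrow> 0"
      by (simp add: exp_of_nat_mult[symmetric] mult.commute)
    \<comment> \<open>The transversality condition: the state is bounded along the path, so the
      discount factor wins.\<close>
    have "(\<lambda>n. exp (- r * real n) * V (X (real n) \<omega>)) \<longlonglongrightarrow> 0"
    proof (rule Lim_null_comparison)
      show "\<forall>\<^sub>F n in sequentially. norm (exp (- r * real n) * V (X (real n) \<omega>)) \<le> exp (- r * real n) * (C * (1 + b * S))"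
      proof (intro always_eventually allI)
        fix n
        have "\<bar>V (X (real n) \<omega>)\<bar> \<le> C * (1 + b * \<bar>X (real n) \<omega>\<bar>)" by (rule growth)
        also have "\<dots> \<le> C * (1 + b * S)" using S[of "real n"] C ab by (intro mult_left_mono add_mono) auto
        finally show "norm (exp (- r * real n) * V (X (real n) \<omega>)) \<le> exp (- r * real n) * (C * (1 + b * S))"
          by (simp add: abs_mult)
      qed
      show "(\<lambda>n. exp (- r * real n) * (C * (1 + b * S))) \<longlonglongrightarrow> 0"
        using tendsto_mult_left_zero[OF e0] .
    qed
    \<comment> \<open>Dominated convergence for series, with the summable total cost as
      majorant.\<close>
    moreover have "(\<lambda>n. \<Sum>k. gain r g (Suc k) (real n) \<omega>) \<longlonglongrightarrow> (\<Sum>k. total_gain r g (Suc k) \<omega>)"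
    proof (rule tannerys_theorem[THEN conjunct2, THEN conjunct2])
      show "(\<lambda>n. gain r g (Suc k) (real n) \<omega>) \<longlonglongrightarrow> total_gain r g (Suc k) \<omega>" for k
      proof (cases "tau (Suc k) \<omega>")
        case (real t)
        obtain N :: nat where N: "t \<le> real N" using real_arch_simple by blast
        show ?thesis
          by (rule tendsto_eventually, unfold eventually_sequentially, rule exI[of _ N]) (use N real in \<open>auto simp: gain_eq\<close>)
      qed (use tau_nonneg[of \<omega> "Suc k"] in \<open>auto simp: gain_eq total_gain_def\<close>)
      show "\<forall>\<^sub>F (k, n) in at_top \<times>\<^sub>F sequentially. norm (gain r g (Suc k) (real n) \<omega>) \<le> P.cost r a b (Suc k)"
        using gn by (intro always_eventually) auto
      show "summable (\<lambda>k. P.cost r a b (Suc k))" using cs(1) by (simp add: summable_Suc_iff)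
    qed simp
    ultimately have "(\<lambda>n. L (real n)) \<longlonglongrightarrow> 0 + (LINT s:{0..}|lborel. exp (- r * s) * (p + q * X s \<omega>)) + (\<Sum>k. total_gain r g (Suc k) \<omega>)"
      unfolding L_def by (intro tendsto_add set_integral_at_top[OF sint])
    then show ?thesis by simp
  qed
qed

end

lemma sigma_theta:
  assumes "admissible_parameters G"
  shows "rho G = (sigma G * theta G)\<^sup>2 / 2"
  using assms by (auto simp: admissible_parameters_def theta_def power_mult_distrib)

lemma running_payoff_affine:
  "running_payoff G i y = running_payoff G i 0 + (running_payoff G i 1 - running_payoff G i 0) * y"
  "\<bar>running_payoff G i y\<bar> = \<bar>y - target G i\<bar>"
  by (cases i; simp)+

section \<open>From admissibility to a bound on the payoff\<close>

context controlled_brownian_motion begin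

definition regular_costs :: "game \<Rightarrow> 'a \<Rightarrow> bool" where
  "regular_costs G \<omega> \<longleftrightarrow> (\<forall>j. (\<Sum>k. discounted (rho G) (c G) (lambda G) (ctl j k \<omega>))
            = (\<Sum>k. pcost \<omega> (rho G) (c G) (lambda G) j k)
          \<and> (\<Sum>k. discounted (rho G) (c_tilde G) (lambda_tilde G) (ctl j k \<omega>))
            = (\<Sum>k. pcost \<omega> (rho G) (c_tilde G) (lambda_tilde G) j k)
          \<and> summable (pcost \<omega> (rho G) (c G) (lambda G) j)
          \<and> summable (pcost \<omega> (rho G) (c_tilde G) (lambda_tilde G) j))"

text \<open>The integrability conditions of admissibility provide the random bounds. The sign
  \<open>e\<close> reverses the running payoff but leaves its absolute value unchanged, so both
  signs share the same bounds.\<close>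

lemma admissible_regular_path:
  fixes G i e
  defines "p \<equiv> e * running_payoff G i 0" and "q \<equiv> e * (running_payoff G i 1 - running_payoff G i 0)"
  assumes G: "admissible_parameters G" and sig: "sig = sigma G" and adm: "admissible G M W x \<pi>"
    and e: "e = 1 \<or> e = - 1"
  obtains S Q I where "integrable M S" "integrable M Q" "integrable M I"
    "AE \<omega> in M. regular_path (rho G) (c G) (lambda G) p q (S \<omega>) (Q \<omega>) (I \<omega>) \<omega>
      \<and> regular_costs G \<omega>"
proof -
  have nn: "0 \<le> c G" "0 \<le> lambda G" "0 \<le> c_tilde G" "0 \<le> lambda_tilde G" "0 < rho G"
    using G by (auto simp: admissible_parameters_def)
  define S where "S \<omega> = (\<Squnion>t\<in>{0..}. ennreal (\<bar>X t \<omega>\<bar> ^ 1))" for \<omega>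
  define Q where "Q j \<omega> = (\<Sum>k. ennreal (discounted (rho G) (c G) (lambda G) (ctl j k \<omega>)))" for j \<omega>
  define Q' where "Q' j \<omega> = (\<Sum>k. ennreal (discounted (rho G) (c_tilde G) (lambda_tilde G) (ctl j k \<omega>)))" for j \<omega>
  define I where "I \<omega> = (\<integral>\<^sup>+ s\<in>{0..}. ennreal (exp (- rho G * s) * \<bar>X s \<omega> - target G i\<bar>) \<partial>lborel)" for \<omega>
  have S: "integrable_nonneg M S" and Q: "integrable_nonneg M (Q j)" and Q': "integrable_nonneg M (Q' j)"
    and I: "integrable_nonneg M I" and lim: "AE \<omega> in M. (\<lambda>k. fst (ctl j k \<omega>)) \<longlonglongrightarrow> \<infinity>" for j
    using adm unfolding admissible_def S_def Q_def Q'_def I_def sig by blast+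
  show ?thesis
  proof (rule that)
    show "integrable M (\<lambda>\<omega>. enn2real (S \<omega>))"
      "integrable M (\<lambda>\<omega>. enn2real (Q Player1 \<omega>) + enn2real (Q Player2 \<omega>))"
      "integrable M (\<lambda>\<omega>. enn2real (I \<omega>))"
      using integrable_enn2real(1)[OF S] integrable_enn2real(1)[OF I] integrable_enn2real(1)[OF Q] by auto
    show "AE \<omega> in M. regular_path (rho G) (c G) (lambda G) p q (enn2real (S \<omega>)) (enn2real (Q Player1 \<omega>) + enn2real (Q Player2 \<omega>)) (enn2real (I \<omega>)) \<omega>
      \<and> regular_costs G \<omega>"
      using AE_space integrable_enn2real(2)[OF S] integrable_enn2real(2)[OF I]
        integrable_enn2real(2)[OF Q[of Player1]] integrable_enn2real(2)[OF Q[of Player2]]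
        integrable_enn2real(2)[OF Q'[of Player1]] integrable_enn2real(2)[OF Q'[of Player2]]
        lim[of Player1] lim[of Player2]
    proof eventually_elim
      case (elim \<omega>)
      interpret P: controlled_path sig x \<pi> "\<lambda>t. W t \<omega>" by (rule controlled_path[OF elim(1)])
      have Qf: "Q j \<omega> < \<infinity>" "Q' j \<omega> < \<infinity>" for j using elim by (cases j; simp)+
      note cs = P.control_suminf[OF nn(1,2) Qf(1)[unfolded Q_def]]
      note cs' = P.control_suminf[OF nn(3,4) Qf(2)[unfolded Q'_def]]
      have tm: "\<exists>k. ereal T < tau k \<omega>" for T
      proof (rule P.tm_unbounded)
        show "(\<lambda>k. fst (ctl j k \<omega>)) \<longlonglongrightarrow> \<infinity>" for j
          using elim by (cases j) auto
      qed
      have Sb: "\<bar>X s \<omega>\<bar> \<le> enn2real (S \<omega>)" if "0 \<le> s" for s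
      proof -
        have "ennreal (\<bar>X s \<omega>\<bar> ^ 1) \<le> S \<omega>" unfolding S_def using that by (intro SUP_upper) auto
        then have "enn2real (ennreal (\<bar>X s \<omega>\<bar> ^ 1)) \<le> enn2real (S \<omega>)"
          using elim(2) by (intro enn2real_mono) (auto simp: less_top)
        then show ?thesis by simp
      qed
      have split: "P.cost r a b = (\<lambda>k. P.player_cost r a b Player1 k + P.player_cost r a b Player2 k)" for r a b
        by (simp add: fun_eq_iff P.cost_split)
      have sc: "summable (P.cost (rho G) (c G) (lambda G))"
        unfolding split by (intro summable_add cs(1))
      have qc: "suminf (P.cost (rho G) (c G) (lambda G)) = enn2real (Q Player1 \<omega>) + enn2real (Q Player2 \<omega>)"
        unfolding split Q_def cs(3)[symmetric] by (intro suminf_add[symmetric] cs(1))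
      have pq: "\<bar>p + q * y\<bar> = \<bar>y - target G i\<bar>" for y
        using e running_payoff_affine[of G i y]
        unfolding p_def q_def by (auto simp: algebra_simps abs_minus_commute)
      let ?h = "\<lambda>s. indicator {0..} s *\<^sub>R (exp (- rho G * s) * (p + q * X s \<omega>))"
      have h_eq: "?h = (\<lambda>s. indicator {0..} s *\<^sub>R (exp (- rho G * s) * (p + q * X (max 0 s) \<omega>)))"
        by (auto simp: indicator_def fun_eq_iff)
      have h_M: "?h \<in> borel_measurable lborel"
        unfolding h_eq using state_measurable_time[OF elim(1)] by measurable
      have h_nn: "(\<integral>\<^sup>+s. ennreal (norm (?h s)) \<partial>lborel) = I \<omega>"
        unfolding I_def by (rule nn_integral_cong) (auto simp: indicator_def abs_mult pq)
      have h_int: "integrable lborel ?h"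
        using elim(3) by (intro integrableI_bounded h_M) (simp only: h_nn)
      have "(LINT s:{0..}|lborel. \<bar>exp (- rho G * s) * (p + q * X s \<omega>)\<bar>) = (\<integral>s. norm (?h s) \<partial>lborel)"
        unfolding set_lebesgue_integral_def by (rule Bochner_Integration.integral_cong) (auto simp: indicator_def)
      also have "\<dots> = enn2real (I \<omega>)"
        unfolding h_nn[symmetric] using h_M by (intro integral_eq_nn_integral) auto
      finally have "regular_path (rho G) (c G) (lambda G) p q (enn2real (S \<omega>)) (enn2real (Q Player1 \<omega>) + enn2real (Q Player2 \<omega>)) (enn2real (I \<omega>)) \<omega>"
        unfolding regular_path_def set_integrable_def using elim(1) tm Sb sc qc h_int by auto
      then show ?case unfolding regular_costs_def using cs cs' by blast
    qed
  qed
qed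

text \<open>For \<open>e = 1\<close> this bounds the payoff from above by \<open>V\<close>; for
  \<open>e = - 1\<close>, with a negated value function, it bounds the payoff from below. Only an
  inequality is asked at interventions and on \<open>D\<close>; exact equalities permit the use of
  both signs.\<close>

lemma verification:
  fixes G i e V \<alpha> \<beta> C D
  defines "g \<equiv> \<lambda>j d. e * (if j = i then - (c G + lambda G * \<bar>d\<bar>) else c_tilde G + lambda_tilde G * \<bar>d\<bar>)"
  assumes G: "admissible_parameters G" and sig: "sig = sigma G" and adm: "admissible G M W x \<pi>"
    and e: "e = 1 \<or> e = - 1"
    and D: "closed D" "fst (\<pi> Player1) \<inter> fst (\<pi> Player2) \<subseteq> D"
    and \<alpha>\<beta>: "\<alpha> \<in> borel_measurable borel" "\<beta> \<in> borel_measurable borel"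
    and V: "V \<in> borel_measurable borel"
    and growth: "\<And>y. \<bar>V y\<bar> \<le> C * (1 + lambda G * \<bar>y\<bar>)" and C: "0 \<le> C"
    and touch: "\<And>a. a \<in> D \<Longrightarrow> V a = \<alpha> a + \<beta> a + e * running_payoff G i a / rho G"
    and dom: "\<And>a b. a \<in> D \<Longrightarrow> b \<in> D \<Longrightarrow>
      V b \<le> \<alpha> a * exp (theta G * (b - a)) + \<beta> a * exp (- theta G * (b - a)) + e * running_payoff G i b / rho G"
    and interv: "\<And>j y. y \<notin> fst (\<pi> j) \<Longrightarrow> V (y + snd (\<pi> j) y) + g j (snd (\<pi> j) y) \<le> V y"
  shows "e * payoff G M W i x \<pi> \<le> V x"
proof -
  define r where "r = rho G"
  define p where "p = e * running_payoff G i 0"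
  define q where "q = e * (running_payoff G i 1 - running_payoff G i 0)"
  have nn: "0 \<le> c G" "0 \<le> lambda G" "0 \<le> c_tilde G" "0 \<le> lambda_tilde G" "0 < r"
    "c_tilde G \<le> c G" "lambda_tilde G \<le> lambda G"
    using G by (auto simp: admissible_parameters_def r_def)
  have r2: "r = (sig * theta G)\<^sup>2 / 2" using sigma_theta[OF G] by (simp add: r_def sig)
  have pq: "e * running_payoff G i y = p + q * y" for y
    unfolding p_def q_def by (subst running_payoff_affine(1)) (simp add: algebra_simps)
  have g_bound: "\<bar>g j d\<bar> \<le> c G + lambda G * \<bar>d\<bar>" for j d
  proof -
    have 1: "lambda_tilde G * \<bar>d\<bar> \<le> lambda G * \<bar>d\<bar>" "0 \<le> c_tilde G + lambda_tilde G * \<bar>d\<bar>" "0 \<le> c G + lambda G * \<bar>d\<bar>"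
      using nn by (auto intro: mult_right_mono)
    have "\<bar>e\<bar> = 1" using e by auto
    then have "\<bar>g j d\<bar> = (if j = i then c G + lambda G * \<bar>d\<bar> else c_tilde G + lambda_tilde G * \<bar>d\<bar>)"
      using abs_of_nonneg[OF 1(2)] abs_of_nonneg[OF 1(3)] unfolding g_def by (simp add: abs_mult del: minus_add_distrib)
    then show ?thesis using 1(1) nn(6) by auto
  qed
  have g_M: "g j \<in> borel_measurable borel" for j unfolding g_def by (cases "j = i") auto
  obtain S Q I where int: "integrable M S" "integrable M Q" "integrable M I" and ae:
    "AE \<omega> in M. regular_path (rho G) (c G) (lambda G) p q (S \<omega>) (Q \<omega>) (I \<omega>) \<omega>
      \<and> regular_costs G \<omega>"
    using admissible_regular_path[OF G sig adm e, of i] unfolding p_def q_def by blast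
  have reg: "AE \<omega> in M. regular_path r (c G) (lambda G) p q (S \<omega>) (Q \<omega>) (I \<omega>) \<omega>"
    using ae unfolding r_def by eventually_elim blast
  define B where "B \<omega> = C * (1 + lambda G * S \<omega> + Q \<omega>)" for \<omega>
  \<comment> \<open>One integrable majorant for all the bounds at once; the absolute values dispense
    with separate arguments about signs.\<close>
  define Dom where "Dom \<omega> = \<bar>B \<omega> + I \<omega> + Q \<omega>\<bar> + \<bar>B \<omega>\<bar> + \<bar>I \<omega>\<bar> + \<bar>Q \<omega>\<bar>" for \<omega>
  have Dom: "integrable M Dom" unfolding Dom_def B_def using int by auto
  note lims = regular_path_limits[where g = g and V = V, OF _ nn(5) nn(1,2) growth C g_bound]
  have fin: "0 \<le> tauc (Suc k) T \<omega>" "ereal (tauc (Suc k) T \<omega>) \<le> tau (Suc k) \<omega>" if "0 < T" for k \<omega> T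
    using that by (auto simp: capped_nonneg ereal_capped)
  have acc: "integrable M (accrued V g r p q k T) \<and> expectation (accrued V g r p q k T) \<le> V x" if T: "0 < T" for k T
  proof (rule accrued_le[OF nn(5) r2 T D \<alpha>\<beta> V g_M g_M _ _ interv Dom])
    show "V a = \<alpha> a + \<beta> a + (p + q * a) / r" if "a \<in> D" for a
      using touch[OF that] by (simp add: pq r_def)
    show "V b \<le> \<alpha> a * exp (theta G * (b - a)) + \<beta> a * exp (- theta G * (b - a)) + (p + q * b) / r"
      if "a \<in> D" "b \<in> D" for a b
      using dom[OF that] by (simp add: pq r_def)
    show "AE \<omega> in M. \<bar>exp (- r * tauc k T \<omega>) * V (pos k (tauc k T \<omega>) \<omega>)\<bar> \<le> Dom \<omega>" for k
      using reg
    proof eventually_elim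
      case (elim \<omega>)
      then have \<omega>: "\<omega> \<in> space M" by (simp add: regular_path_def)
      have "ereal (tauc k T \<omega>) \<le> tau (Suc k) \<omega>"
        using T tau_le_Suc[OF \<omega>, of k] by (auto simp: ereal_capped intro: order_trans min.coboundedI1)
      then have "\<bar>exp (- r * tauc k T \<omega>) * V (pos k (tauc k T \<omega>) \<omega>)\<bar> \<le> B \<omega>"
        unfolding B_def using T by (intro lims(1)[OF elim]) (simp_all add: capped_nonneg)
      then show ?case by (simp add: Dom_def)
    qed
    show "AE \<omega> in M. \<bar>exp (- r * tauc (Suc k) T \<omega>) * V (pos k (tauc (Suc k) T \<omega>) \<omega>)\<bar> \<le> Dom \<omega>" for k
      using reg
    proof eventually_elim
      case (elim \<omega>)
      have "\<bar>exp (- r * tauc (Suc k) T \<omega>) * V (pos k (tauc (Suc k) T \<omega>) \<omega>)\<bar> \<le> B \<omega>"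
        unfolding B_def by (rule lims(1)[OF elim fin[OF T]])
      then show ?case by (simp add: Dom_def)
    qed
    show "AE \<omega> in M. (0 \<le> a \<omega> \<and> a \<omega> \<le> tauc (Suc k) T \<omega> \<longrightarrow>
        \<bar>flow r p q k (a \<omega>) (tauc (Suc k) T \<omega>) \<omega>\<bar> \<le> Dom \<omega>)" for k a
      using reg
    proof eventually_elim
      case (elim \<omega>)
      have "\<bar>flow r p q k (a \<omega>) (tauc (Suc k) T \<omega>) \<omega>\<bar> \<le> I \<omega>" if "0 \<le> a \<omega>"
        by (rule lims(2)[OF elim that fin(2)[OF T]])
      moreover have "I \<omega> \<le> Dom \<omega>" by (simp add: Dom_def)
      ultimately show ?case by linarith
    qed
    show "AE \<omega> in M. \<bar>gain r g (Suc k) T \<omega>\<bar> \<le> Dom \<omega>" for k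
      using reg
    proof eventually_elim
      case (elim \<omega>)
      have "\<bar>gain r g (Suc k) T \<omega>\<bar> \<le> Q \<omega>" by (rule lims(3)[OF elim])
      then show ?case by (simp add: Dom_def)
    qed
  qed
  define L where "L T \<omega> = exp (- r * T) * V (X T \<omega>) + (LINT s:{0..<T}|lborel. exp (- r * s) * (p + q * X s \<omega>))
      + (\<Sum>k. gain r g (Suc k) T \<omega>)" for T \<omega>
  have accL: "AE \<omega> in M. (\<lambda>k. accrued V g r p q k T \<omega>) \<longlonglongrightarrow> L T \<omega>" if "0 < T" for T
    using reg unfolding L_def by eventually_elim (rule lims(5)[OF _ that])
  have accD: "AE \<omega> in M. norm (accrued V g r p q k T \<omega>) \<le> Dom \<omega>" if "0 < T" for k T
    using reg
  proof eventually_elim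
    case (elim \<omega>)
    have "\<bar>accrued V g r p q k T \<omega>\<bar> \<le> B \<omega> + I \<omega> + Q \<omega>"
      unfolding B_def by (rule lims(4)[OF elim that])
    then show ?case by (simp add: Dom_def)
  qed
  have L_M: "L T \<in> borel_measurable M" if "0 < T" for T
    by (rule borel_measurable_AE_LIMSEQ[OF _ accL[OF that]]) (use acc[OF that] in auto)
  have L_int: "integrable M (L T)" and L_le: "expectation (L T) \<le> V x" if T: "0 < T" for T
  proof -
    have am: "accrued V g r p q k T \<in> borel_measurable M" for k using acc[OF T] by auto
    show "integrable M (L T)"
      by (rule integrable_dominated_convergence[OF L_M[OF T] am Dom accL[OF T] accD[OF T]])
    have "(\<lambda>k. expectation (accrued V g r p q k T)) \<longlonglongrightarrow> expectation (L T)"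
      by (rule integral_dominated_convergence[OF L_M[OF T] am Dom accL[OF T] accD[OF T]])
    then show "expectation (L T) \<le> V x"
      by (rule LIMSEQ_le_const2) (use acc[OF T] in auto)
  qed
  have LD: "AE \<omega> in M. norm (L T \<omega>) \<le> Dom \<omega>" if T: "0 < T" for T
  proof -
    have "AE \<omega> in M. \<forall>k. norm (accrued V g r p q k T \<omega>) \<le> Dom \<omega>"
      using accD[OF T] by (simp add: AE_all_countable)
    then show ?thesis using accL[OF T]
    proof eventually_elim
      case (elim \<omega>)
      show ?case using tendsto_norm[OF elim(2)] by (rule LIMSEQ_le_const2) (use elim(1) in auto)
    qed
  qed
  define \<Psi> where "\<Psi> \<omega> = (LINT s:{0..}|lborel. exp (- rho G * s) * running_payoff G i (X s \<omega>))
       - (\<Sum>k. discounted (rho G) (c G) (lambda G) (ctl i k \<omega>))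
       + (\<Sum>k. discounted (rho G) (c_tilde G) (lambda_tilde G) (ctl (opponent i) k \<omega>))" for \<omega>
  \<comment> \<open>The index is \<open>Suc n\<close> because integrability and the bound of
    \<open>L T\<close> were established for positive horizons.\<close>
  have L\<Psi>: "AE \<omega> in M. (\<lambda>n. L (real (Suc n)) \<omega>) \<longlonglongrightarrow> e * \<Psi> \<omega>"
    using ae
  proof eventually_elim
    case (elim \<omega>)
    then have rg: "regular_path r (c G) (lambda G) p q (S \<omega>) (Q \<omega>) (I \<omega>) \<omega>" by (simp add: r_def)
    then have \<omega>: "\<omega> \<in> space M" by (simp add: regular_path_def)
    interpret P: controlled_path sig x \<pi> "\<lambda>t. W t \<omega>" by (rule controlled_path[OF \<omega>])
    have sm: "summable (P.player_cost r (c G) (lambda G) i)"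
      "summable (P.player_cost r (c_tilde G) (lambda_tilde G) (opponent i))"
      using elim by (auto simp: r_def regular_costs_def)
    have tg: "total_gain r g (Suc k) \<omega> = e * (P.player_cost r (c_tilde G) (lambda_tilde G) (opponent i) (Suc k)
       - P.player_cost r (c G) (lambda G) i (Suc k))" for k
      by (cases i; cases "actor (Suc k) \<omega>") (simp_all add: total_gain_def g_def P.player_cost_def P.cost_def algebra_simps)
    have "(\<Sum>k. total_gain r g (Suc k) \<omega>) = e * (\<Sum>k. P.player_cost r (c_tilde G) (lambda_tilde G) (opponent i) (Suc k)
       - P.player_cost r (c G) (lambda G) i (Suc k))"
      unfolding tg using sm by (intro suminf_mult) (auto simp: summable_Suc_iff intro!: summable_diff)
    also have "(\<Sum>k. P.player_cost r (c_tilde G) (lambda_tilde G) (opponent i) (Suc k) - P.player_cost r (c G) (lambda G) i (Suc k))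
       = (\<Sum>k. P.player_cost r (c_tilde G) (lambda_tilde G) (opponent i) (Suc k)) - (\<Sum>k. P.player_cost r (c G) (lambda G) i (Suc k))"
      using sm by (intro suminf_diff[symmetric]) (auto simp: summable_Suc_iff)
    also have "\<dots> = (\<Sum>k. P.player_cost r (c_tilde G) (lambda_tilde G) (opponent i) k) - (\<Sum>k. P.player_cost r (c G) (lambda G) i k)"
    proof -
      \<comment> \<open>No intervention belongs to stage 0, so the shift of the index loses
        nothing.\<close>
      have "P.player_cost r a b j 0 = 0" for a b j by (simp add: P.player_cost_def P.cost_def)
      then show ?thesis using suminf_split_head[OF sm(1)] suminf_split_head[OF sm(2)] by simp
    qed
    finally have sums: "(\<Sum>k. total_gain r g (Suc k) \<omega>) = e * ((\<Sum>k. P.player_cost r (c_tilde G) (lambda_tilde G) (opponent i) k)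
       - (\<Sum>k. P.player_cost r (c G) (lambda G) i k))" .
    have "(LINT s:{0..}|lborel. exp (- r * s) * (p + q * X s \<omega>)) = (LINT s:{0..}|lborel. e * (exp (- rho G * s) * running_payoff G i (X s \<omega>)))"
      unfolding pq[symmetric] r_def by (simp add: mult_ac)
    also have "\<dots> = e * (LINT s:{0..}|lborel. exp (- rho G * s) * running_payoff G i (X s \<omega>))"
      by (rule set_integral_mult_right)
    finally have "(LINT s:{0..}|lborel. exp (- r * s) * (p + q * X s \<omega>)) + (\<Sum>k. total_gain r g (Suc k) \<omega>) = e * \<Psi> \<omega>"
      unfolding sums \<Psi>_def using elim by (simp add: r_def regular_costs_def algebra_simps)
    then have "(\<lambda>n. L (real n) \<omega>) \<longlonglongrightarrow> e * \<Psi> \<omega>"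
      using lims(6)[OF rg] unfolding L_def by simp
    then show ?case by (rule LIMSEQ_Suc)
  qed
  have \<Psi>_M: "(\<lambda>\<omega>. e * \<Psi> \<omega>) \<in> borel_measurable M"
    by (rule borel_measurable_AE_LIMSEQ[OF _ L\<Psi>]) (rule L_M, simp)
  have "(\<lambda>n. expectation (L (real (Suc n)))) \<longlonglongrightarrow> expectation (\<lambda>\<omega>. e * \<Psi> \<omega>)"
    by (rule integral_dominated_convergence[OF \<Psi>_M _ Dom L\<Psi> LD]) (auto intro: L_M)
  then have "expectation (\<lambda>\<omega>. e * \<Psi> \<omega>) \<le> V x"
    by (rule LIMSEQ_le_const2) (intro exI allI impI L_le, simp)
  moreover have "payoff G M W i x \<pi> = expectation \<Psi>"
    unfolding payoff_def \<Psi>_def sig by simp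
  ultimately show ?thesis by simp
qed

end

section \<open>The value functions\<close>

text \<open>The differences of the two sides vanish at 0, and their derivatives
  \<open>cosh u - 1\<close>, \<open>u * sinh u\<close> and \<open>u * cosh u\<close> are
  nonnegative.\<close>

lemma sinh_cosh_bounds:
  fixes s :: real
  assumes "0 \<le> s"
  shows "s \<le> sinh s" "sinh s \<le> s * cosh s" "cosh s \<le> 1 + s * sinh s"
proof -
  have 1: "0 \<le> cosh u - 1" for u :: real using cosh_real_ge_1[of u] by simp
  show "s \<le> sinh s"
  proof -
    have "(\<lambda>u. sinh u - u) 0 \<le> (\<lambda>u. sinh u - u) s"
      by (rule DERIV_nonneg_imp_nondecreasing[OF assms]) (use 1 in \<open>auto intro!: derivative_eq_intros exI\<close>)
    then show ?thesis by simp
  qed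
  show "sinh s \<le> s * cosh s"
  proof -
    have "(\<lambda>u. u * cosh u - sinh u) 0 \<le> (\<lambda>u. u * cosh u - sinh u) s"
    proof (rule DERIV_nonneg_imp_nondecreasing[OF assms])
      fix u :: real assume "0 \<le> u"
      then show "\<exists>y. ((\<lambda>u. u * cosh u - sinh u) has_real_derivative y) (at u) \<and> 0 \<le> y"
        by (intro exI[of _ "u * sinh u"]) (auto intro!: derivative_eq_intros mult_nonneg_nonneg)
    qed
    then show ?thesis by simp
  qed
  show "cosh s \<le> 1 + s * sinh s"
  proof -
    have "(\<lambda>u. 1 + u * sinh u - cosh u) 0 \<le> (\<lambda>u. 1 + u * sinh u - cosh u) s"
    proof (rule DERIV_nonneg_imp_nondecreasing[OF assms])
      fix u :: real assume "0 \<le> u"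
      then show "\<exists>y. ((\<lambda>u. 1 + u * sinh u - cosh u) has_real_derivative y) (at u) \<and> 0 \<le> y"
        by (intro exI[of _ "u * cosh u"]) (auto intro!: derivative_eq_intros mult_nonneg_nonneg less_imp_le[OF cosh_real_pos])
    qed
    then show ?thesis by simp
  qed
qed

text \<open>In the coordinate \<open>z = x - x_bar 1\<close> the function \<open>kinked\<close> is \<open>V1_tilde\<close> minus the affine part
  \<open>(x - s1) / rho\<close>; \<open>up\<close> and \<open>down\<close> are the coefficients of the solution of
  \<open>u'' = theta^2 u\<close> that touches it at \<open>z\<close>.\<close>

definition kinked :: "real \<Rightarrow> real \<Rightarrow> real \<Rightarrow> real \<Rightarrow> real" where
  "kinked v \<eta> \<theta> z = (if z \<le> 0 then v - \<eta> * z else v * cosh (\<theta> * z) - \<eta> / \<theta> * sinh (\<theta> * z))"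

definition up :: "real \<Rightarrow> real \<Rightarrow> real \<Rightarrow> real \<Rightarrow> real" where
  "up v \<eta> \<theta> z = (if z \<le> 0 then (v - \<eta> * z - \<eta> / \<theta>) / 2 else (v - \<eta> / \<theta>) / 2 * exp (\<theta> * z))"

definition down :: "real \<Rightarrow> real \<Rightarrow> real \<Rightarrow> real \<Rightarrow> real" where
  "down v \<eta> \<theta> z = (if z \<le> 0 then (v - \<eta> * z + \<eta> / \<theta>) / 2 else (v + \<eta> / \<theta>) / 2 * exp (- \<theta> * z))"

lemma up_down_measurable [measurable]:
  "up v \<eta> \<theta> \<in> borel_measurable borel" "down v \<eta> \<theta> \<in> borel_measurable borel"
  unfolding up_def down_def by measurable

lemma cosh_sinh_exp:
  fixes u :: real
  shows "(m - n) / 2 * exp u + (m + n) / 2 * exp (- u) = m * cosh u - n * sinh u"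
  by (simp add: cosh_field_def sinh_field_def field_simps)

lemma kinked_touch: "0 < \<theta> \<Longrightarrow> kinked v \<eta> \<theta> z = up v \<eta> \<theta> z + down v \<eta> \<theta> z"
  using cosh_sinh_exp[of v "\<eta> / \<theta>" "\<theta> * z"] by (simp add: kinked_def up_def down_def field_simps)

text \<open>On the right half-line \<open>kinked\<close> itself solves the differential equation.
  All functions touching it there coincide, which is the source of the equalities between the
  thresholds; at \<open>z = 0\<close> the two formulas for the coefficients agree.\<close>

lemma kinked_harmonic:
  assumes \<theta>: "0 < \<theta>" and z: "0 \<le> z"
  shows "up v \<eta> \<theta> z * exp (\<theta> * (y - z)) + down v \<eta> \<theta> z * exp (- \<theta> * (y - z))
    = v * cosh (\<theta> * y) - \<eta> / \<theta> * sinh (\<theta> * y)"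
proof -
  have e: "exp (\<theta> * z) * exp (\<theta> * (y - z)) = exp (\<theta> * y)" "exp (- \<theta> * z) * exp (- \<theta> * (y - z)) = exp (- (\<theta> * y))"
    by (simp_all add: exp_add[symmetric] algebra_simps)
  have u: "up v \<eta> \<theta> z = (v - \<eta> / \<theta>) / 2 * exp (\<theta> * z)" "down v \<eta> \<theta> z = (v + \<eta> / \<theta>) / 2 * exp (- \<theta> * z)"
    using z by (auto simp: up_def down_def)
  show ?thesis unfolding cosh_sinh_exp[symmetric] u mult.assoc e ..
qed

text \<open>The reason is that \<open>kinked\<close> is continuously differentiable and satisfies
  \<open>u'' \<le> \<theta>\<^sup>2 * u\<close>: with equality on the right, and on the left because
  the affine branch is nonnegative. A solution of the equation with the same value and slope at
  \<open>z\<close> therefore stays above it. The proof makes this explicit according to the signs of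
  \<open>z\<close> and \<open>y\<close>.\<close>

lemma kinked_le_tangent:
  assumes \<theta>: "0 < \<theta>" and v: "0 \<le> v" and \<eta>: "0 \<le> \<eta>"
  shows "kinked v \<eta> \<theta> y \<le> up v \<eta> \<theta> z * exp (\<theta> * (y - z)) + down v \<eta> \<theta> z * exp (- \<theta> * (y - z))"
proof -
  define n where "n = \<eta> / \<theta>"
  have n: "0 \<le> n" "\<eta> * x = n * (\<theta> * x)" for x using \<theta> \<eta> by (auto simp: n_def)
  have sinh_neg: "sinh s \<le> s" if "s \<le> 0" for s :: real
    using sinh_cosh_bounds(1)[of "- s"] that by simp
  show ?thesis
  proof (cases "0 < z")
    case True
    have R: "up v \<eta> \<theta> z * exp (\<theta> * (y - z)) + down v \<eta> \<theta> z * exp (- \<theta> * (y - z)) = v * cosh (\<theta> * y) - n * sinh (\<theta> * y)"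
      using kinked_harmonic[OF \<theta>, of z] True by (simp add: n_def)
    show ?thesis
    proof (cases "y \<le> 0")
      case y: True
      have "n * sinh (\<theta> * y) \<le> n * (\<theta> * y)"
        using n(1) \<theta> y by (intro mult_left_mono sinh_neg) (auto simp: mult_le_0_iff)
      moreover have "v * 1 \<le> v * cosh (\<theta> * y)" using v by (intro mult_left_mono cosh_real_ge_1)
      moreover have "kinked v \<eta> \<theta> y = v - n * (\<theta> * y)" unfolding n(2)[symmetric] using y by (simp add: kinked_def)
      ultimately show ?thesis unfolding R by linarith
    qed (simp only: R, simp add: kinked_def n_def)
  next
    case False
    define w where "w = v - \<eta> * z"
    have R: "up v \<eta> \<theta> z * exp (\<theta> * (y - z)) + down v \<eta> \<theta> z * exp (- \<theta> * (y - z)) = w * cosh (\<theta> * (y - z)) - n * sinh (\<theta> * (y - z))"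
      using False cosh_sinh_exp[of w n "\<theta> * (y - z)"] by (simp add: up_def down_def w_def n_def)
    have w0: "0 \<le> w" using mult_nonneg_nonpos[OF \<eta>, of z] False v by (simp add: w_def)
    show ?thesis
    proof (cases "y \<le> 0")
      case y: True
      define s where "s = \<theta> * (y - z)"
      have L: "kinked v \<eta> \<theta> y = w - n * s" using y n(2)[of "y - z"] by (simp add: kinked_def w_def s_def algebra_simps)
      show ?thesis unfolding R L unfolding s_def[symmetric]
      proof (cases "0 \<le> s")
        case True
        have "0 \<le> v - \<eta> * y" using mult_nonneg_nonpos[OF \<eta>, of y] y v by simp
        \<comment> \<open>Nonnegativity of the affine branch at \<open>y\<close>, expressed by its
          value \<open>w\<close> at \<open>z\<close>.\<close>
        then have "n * s \<le> w" using n(2)[of "y - z"] by (simp add: w_def s_def algebra_simps)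
        then have "n * s * (cosh s - 1) \<le> w * (cosh s - 1)"
          using cosh_real_ge_1[of s] by (intro mult_right_mono) auto
        moreover have "n * sinh s \<le> n * (s * cosh s)"
          using n(1) sinh_cosh_bounds(2)[OF True] by (intro mult_left_mono)
        ultimately show "w - n * s \<le> w * cosh s - n * sinh s" by (simp add: algebra_simps)
      next
        case False
        have "n * sinh s \<le> n * s" using n(1) False by (intro mult_left_mono sinh_neg) auto
        moreover have "w * 1 \<le> w * cosh s" using w0 by (intro mult_left_mono cosh_real_ge_1)
        ultimately show "w - n * s \<le> w * cosh s - n * sinh s" by simp
      qed
    next
      case y: False
      define s where "s = - \<theta> * z"
      define u where "u = \<theta> * y"
      have su: "0 \<le> s" "0 \<le> u" using mult_nonneg_nonpos[of \<theta> z] False y \<theta> by (auto simp: s_def u_def)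
      have w: "w = v + n * s" using n(2)[of z] by (simp add: w_def s_def)
      have L: "kinked v \<eta> \<theta> y = v * cosh u - n * sinh u" using y by (simp add: kinked_def n_def u_def)
      have "\<theta> * (y - z) = u + s" by (simp add: u_def s_def algebra_simps)
      then have R': "w * cosh (\<theta> * (y - z)) - n * sinh (\<theta> * (y - z))
        = cosh u * (w * cosh s - n * sinh s) + sinh u * (w * sinh s - n * cosh s)"
        by (simp add: cosh_add sinh_add algebra_simps)
      have "n * sinh s \<le> n * (s * cosh s)" "n * cosh s \<le> n * (1 + s * sinh s)"
        using n(1) sinh_cosh_bounds(2,3)[OF su(1)] by (auto intro: mult_left_mono)
      moreover have "v * 1 \<le> v * cosh s" using v by (intro mult_left_mono cosh_real_ge_1)
      moreover have "0 \<le> v * sinh s" using v su by simp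
      \<comment> \<open>The touching function has at 0 at least the value and the slope, divided by
        \<open>\<theta>\<close>, of \<open>kinked\<close>. To the right of 0 both solve the same
        equation, with nonnegative kernels \<open>cosh u\<close> and \<open>sinh u\<close>.\<close>
      ultimately have "v \<le> w * cosh s - n * sinh s" "- n \<le> w * sinh s - n * cosh s"
        by (auto simp: w algebra_simps)
      then have "cosh u * v + sinh u * (- n) \<le> cosh u * (w * cosh s - n * sinh s) + sinh u * (w * sinh s - n * cosh s)"
        using su by (intro add_mono mult_left_mono) (auto simp: less_imp_le[OF cosh_real_pos])
      then show ?thesis unfolding R R' L by (simp add: mult.commute)
    qed
  qed
qed

section \<open>The explicit value function of player 1\<close>

locale candidate_solution =
  fixes G :: game and \<xi> st :: real
  assumes params: "admissible_parameters G" and xi: "is_xi G \<xi>"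
begin

abbreviation "\<theta> \<equiv> theta G"
abbreviation "\<eta> \<equiv> eta G"
abbreviation "xb \<equiv> x_bar G \<xi> st"
abbreviation "xs \<equiv> x_star G \<xi> st"
abbreviation "V \<equiv> V1_tilde G \<xi> st"

lemma param_facts: "0 < rho G" "0 < sigma G" "0 \<le> c_tilde G" "c_tilde G \<le> c G" "0 \<le> lambda_tilde G"
  "lambda_tilde G \<le> lambda G" "0 < \<theta>" "0 < \<eta>" "0 < \<xi>" "\<xi> < \<eta>" "1 / rho G = \<eta> + lambda G"
  using params xi by (auto simp: admissible_parameters_def is_xi_def theta_def eta_def diff_divide_distrib)

text \<open>Each player's own impulse, made at the player's own threshold, has length
  \<open>2 * ln ratio / \<theta>\<close>.\<close>

definition ratio :: real where "ratio = sqrt ((\<eta> + \<xi>) / (\<eta> - \<xi>))"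
text \<open>The distance from either threshold to the other player's target is
  \<open>2 * ln gap / \<theta>\<close>.\<close>

definition gap :: real where "gap = sqrt (Gam G \<xi> + 1) + sqrt (Gam G \<xi>)"

lemma ratio: "1 < ratio" "ratio\<^sup>2 = (\<eta> + \<xi>) / (\<eta> - \<xi>)" "sqrt ((\<eta> - \<xi>) / (\<eta> + \<xi>)) = 1 / ratio"
proof -
  have 1: "1 < (\<eta> + \<xi>) / (\<eta> - \<xi>)" using param_facts by (simp add: field_simps)
  then show "1 < ratio" unfolding ratio_def by simp
  show "ratio\<^sup>2 = (\<eta> + \<xi>) / (\<eta> - \<xi>)" unfolding ratio_def using 1 by simp
  show "sqrt ((\<eta> - \<xi>) / (\<eta> + \<xi>)) = 1 / ratio" unfolding ratio_def by (simp add: real_sqrt_divide)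
qed

lemma ln_ratio: "2 * ln ratio * \<eta> = 2 * \<xi> + \<theta> * c G"
proof -
  have "2 * ln ratio = ln (ratio\<^sup>2)" using ratio(1) by (simp add: ln_realpow)
  then show ?thesis using xi ratio(2) by (simp add: is_xi_def xi_fun_def mult.commute)
qed

text \<open>The existence of \<open>\<xi>\<close> forces a positive fixed cost: the function
  \<open>h\<close> below vanishes at 0, has derivative
  \<open>2 * u\<^sup>2 / (\<eta>\<^sup>2 - u\<^sup>2)\<close>, and takes the value
  \<open>\<theta> * c G\<close> at \<open>\<xi>\<close>.\<close>

lemma c_pos: "0 < c G"
proof -
  have "0 < \<theta> * c G"
  proof -
    define h where "h u = \<eta> * (ln (\<eta> + u) - ln (\<eta> - u)) - 2 * u" for u
    have "h 0 < h \<xi>"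
    proof (rule DERIV_pos_imp_increasing_open[OF param_facts(9)])
      fix u assume u: "0 < u" "u < \<xi>"
      have "(h has_real_derivative \<eta> * (1 / (\<eta> + u) + 1 / (\<eta> - u)) - 2) (at u)"
        unfolding h_def using u param_facts by (auto intro!: derivative_eq_intros)
      moreover have "0 < \<eta> * (1 / (\<eta> + u) + 1 / (\<eta> - u)) - 2"
      proof -
        have p: "0 < (\<eta> + u) * (\<eta> - u)" using u param_facts by (intro mult_pos_pos) auto
        define P where "P = (\<eta> + u) * (\<eta> - u)"
        have "1 / (\<eta> + u) + 1 / (\<eta> - u) = 2 * \<eta> / P"
          using u param_facts unfolding P_def by (simp add: add_frac_eq)
        moreover have "\<eta> * (2 * \<eta> / P) - 2 = (2 * \<eta>\<^sup>2 - 2 * P) / P"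
          using p unfolding P_def[symmetric] by (simp add: diff_divide_distrib power2_eq_square)
        moreover have "2 * \<eta>\<^sup>2 - 2 * P = 2 * u\<^sup>2" by (simp add: P_def power2_eq_square algebra_simps)
        ultimately show ?thesis using p u unfolding P_def[symmetric] by simp
      qed
      ultimately show "\<exists>y. (h has_real_derivative y) (at u) \<and> 0 < y" by blast
    next
      show "continuous_on {0..\<xi>} h" unfolding h_def
        using param_facts by (auto intro!: continuous_intros)
    qed
    moreover have "h \<xi> = \<theta> * c G"
      using xi param_facts by (simp add: h_def is_xi_def xi_fun_def ln_div)
    ultimately show ?thesis by (simp add: h_def)
  qed
  then show ?thesis using param_facts(7) by (simp add: zero_less_mult_iff)
qed

text \<open>Strictness comes from the two pairs of cost parameters being distinct. It makes
  \<open>gap\<close> larger than 1, which separates each threshold from the opponent's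
  target.\<close>

lemma Gam_pos: "0 < Gam G \<xi>"
proof -
  have "c_tilde G < c G \<or> lambda_tilde G < lambda G"
    using params by (auto simp: admissible_parameters_def)
  moreover have "0 \<le> \<theta> * (c G - c_tilde G) / (4 * \<xi>)" "0 \<le> \<theta> * c G * (lambda G - lambda_tilde G) / (4 * \<eta> * \<xi>)"
    "0 \<le> (lambda G - lambda_tilde G) / (2 * \<eta>)"
    using param_facts by simp_all
  moreover have "0 < \<theta> * (c G - c_tilde G) / (4 * \<xi>)" if "c_tilde G < c G" using that param_facts by simp
  moreover have "0 < (lambda G - lambda_tilde G) / (2 * \<eta>)" if "lambda_tilde G < lambda G" using that param_facts by simp
  ultimately show ?thesis unfolding Gam_def by linarith
qed

lemma gap: "1 < gap" "1 / gap = sqrt (Gam G \<xi> + 1) - sqrt (Gam G \<xi>)" "gap\<^sup>2 + (1 / gap)\<^sup>2 = 4 * Gam G \<xi> + 2"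
proof -
  have s: "sqrt (Gam G \<xi> + 1) * sqrt (Gam G \<xi> + 1) = Gam G \<xi> + 1" "sqrt (Gam G \<xi>) * sqrt (Gam G \<xi>) = Gam G \<xi>"
    using Gam_pos by auto
  have "1 < sqrt (Gam G \<xi> + 1)" "0 < sqrt (Gam G \<xi>)" using Gam_pos by auto
  then show g1: "1 < gap" unfolding gap_def by linarith
  have "gap * (sqrt (Gam G \<xi> + 1) - sqrt (Gam G \<xi>)) = 1" unfolding gap_def using s by (simp add: algebra_simps)
  then show inv: "1 / gap = sqrt (Gam G \<xi> + 1) - sqrt (Gam G \<xi>)" using g1 by (simp add: field_simps)
  show "gap\<^sup>2 + (1 / gap)\<^sup>2 = 4 * Gam G \<xi> + 2"
    unfolding inv unfolding gap_def power2_eq_square using s by (simp add: algebra_simps)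
qed

lemma points:
  "xb 1 = st - (ln ratio + ln gap) / \<theta>" "xb 2 = st + (ln ratio + ln gap) / \<theta>"
  "xs 1 = st - (ln gap - ln ratio) / \<theta>" "xs 2 = st + (ln gap - ln ratio) / \<theta>"
proof -
  have l: "ln (ratio * gap) = ln ratio + ln gap" "ln (1 / ratio * gap) = ln gap - ln ratio"
    using ratio(1) gap(1) by (simp_all add: ln_mult ln_div)
  show "xb 1 = st - (ln ratio + ln gap) / \<theta>" "xb 2 = st + (ln ratio + ln gap) / \<theta>"
    unfolding x_bar_def ratio_def[symmetric] gap_def[symmetric] l by (simp_all add: field_simps)
  show "xs 1 = st - (ln gap - ln ratio) / \<theta>" "xs 2 = st + (ln gap - ln ratio) / \<theta>"
    unfolding x_star_def ratio(3) gap_def[symmetric] l by (simp_all add: field_simps)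
qed

lemma order: "xb 1 < xs 1" "xs 1 < xb 2" "xb 1 < xs 2" "xs 2 < xb 2"
proof -
  have "0 < ln ratio" "0 < ln gap" using ratio(1) gap(1) by simp_all
  then show "xb 1 < xs 1" "xs 1 < xb 2" "xb 1 < xs 2" "xs 2 < xb 2"
    using param_facts(7) unfolding points by (simp_all add: field_simps)
qed

lemma sqrt_prod: "sqrt (\<eta>\<^sup>2 - \<xi>\<^sup>2) * ratio = \<eta> + \<xi>" "sqrt (\<eta>\<^sup>2 - \<xi>\<^sup>2) / ratio = \<eta> - \<xi>"
proof -
  have p: "0 < \<eta> + \<xi>" "0 < \<eta> - \<xi>" using param_facts by auto
  have e: "sqrt (\<eta>\<^sup>2 - \<xi>\<^sup>2) = sqrt (\<eta> + \<xi>) * sqrt (\<eta> - \<xi>)"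
    by (simp add: real_sqrt_mult[symmetric] power2_eq_square algebra_simps)
  show "sqrt (\<eta>\<^sup>2 - \<xi>\<^sup>2) * ratio = \<eta> + \<xi>" "sqrt (\<eta>\<^sup>2 - \<xi>\<^sup>2) / ratio = \<eta> - \<xi>"
    unfolding e ratio_def real_sqrt_divide using p by (simp_all add: field_simps)
qed

text \<open>Centred at \<open>xb 1\<close>, the non-affine part has value
  \<open>\<xi> / \<theta>\<close> and slope \<open>- \<eta>\<close>. Since
  \<open>1 / rho G = \<eta> + lambda G\<close>, the slope of \<open>phi1\<close> there is
  \<open>lambda G\<close>: smooth fit with the affine branch.\<close>

lemma phi1_eq: "phi1 G \<xi> st x = \<xi> / \<theta> * cosh (\<theta> * (x - xb 1)) - \<eta> / \<theta> * sinh (\<theta> * (x - xb 1)) + (x - s1 G) / rho G"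
proof -
  define P where "P = sqrt (\<eta>\<^sup>2 - \<xi>\<^sup>2)"
  have P: "P * ratio = \<eta> + \<xi>" "P / ratio = \<eta> - \<xi>" using sqrt_prod by (simp_all add: P_def)
  have A1: "A_coeff G \<xi> st 1 1 = - (exp (- \<theta> * st) * (P / (2 * \<theta>)) * gap)"
  proof -
    have "(- 1) ^ (1 + 1 + 1) * sqrt (Gam G \<xi> + 1) - sqrt (Gam G \<xi>) = - gap" by (simp add: gap_def)
    then show ?thesis unfolding A_coeff_def P_def by simp
  qed
  have A2: "A_coeff G \<xi> st 1 2 = exp (\<theta> * st) * (P / (2 * \<theta>)) * (1 / gap)"
    unfolding A_coeff_def gap(2) P_def by simp
  have r: "0 < ratio" "0 < gap" using ratio(1) gap(1) by auto
  have e: "\<theta> * xb 1 = \<theta> * st - (ln ratio + ln gap)"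
    using param_facts(7) unfolding points by (simp add: field_simps)
  have e1: "exp (\<theta> * xb 1) = exp (\<theta> * st) / (ratio * gap)" "exp (- \<theta> * xb 1) = exp (- \<theta> * st) * (ratio * gap)"
  proof -
    show "exp (\<theta> * xb 1) = exp (\<theta> * st) / (ratio * gap)" unfolding e using r by (simp add: exp_diff exp_add)
    have "- \<theta> * xb 1 = - \<theta> * st + (ln ratio + ln gap)" using e by simp
    then show "exp (- \<theta> * xb 1) = exp (- \<theta> * st) * (ratio * gap)" using r by (simp only: exp_add exp_ln)
  qed
  have x1: "exp (\<theta> * x) = exp (\<theta> * (x - xb 1)) * exp (\<theta> * xb 1)"
    "exp (- \<theta> * x) = exp (- (\<theta> * (x - xb 1))) * exp (- \<theta> * xb 1)"
    by (simp_all add: exp_add[symmetric] algebra_simps)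
  have st: "exp (- \<theta> * st) * exp (\<theta> * st) = 1" by (simp add: exp_add[symmetric])
  have 1: "A_coeff G \<xi> st 1 1 * exp (\<theta> * x) = (\<xi> / \<theta> - \<eta> / \<theta>) / 2 * exp (\<theta> * (x - xb 1))"
  proof -
    have "A_coeff G \<xi> st 1 1 * exp (\<theta> * x) = - ((exp (- \<theta> * st) * exp (\<theta> * st)) * (P / ratio) / (2 * \<theta>)) * exp (\<theta> * (x - xb 1))"
      unfolding A1 x1 e1 using r by (simp add: field_simps)
    then show ?thesis unfolding st P(2) by (simp add: diff_divide_distrib)
  qed
  have 2: "A_coeff G \<xi> st 1 2 * exp (- \<theta> * x) = (\<xi> / \<theta> + \<eta> / \<theta>) / 2 * exp (- (\<theta> * (x - xb 1)))"
  proof -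
    have "A_coeff G \<xi> st 1 2 * exp (- \<theta> * x) = (exp (- \<theta> * st) * exp (\<theta> * st)) * (P * ratio) / (2 * \<theta>) * exp (- (\<theta> * (x - xb 1)))"
      unfolding A2 x1 e1 using r by (simp add: field_simps)
    then show ?thesis unfolding st P(1) by (simp add: add_divide_distrib)
  qed
  show ?thesis unfolding phi1_def 1 2 cosh_sinh_exp ..
qed

lemma exp_gaps:
  "exp (\<theta> * (xs 1 - xb 1)) = ratio\<^sup>2" "exp (\<theta> * (xb 2 - xb 1)) = ratio\<^sup>2 * gap\<^sup>2" "exp (\<theta> * (xs 2 - xb 1)) = gap\<^sup>2"
proof -
  have "\<theta> * (xs 1 - xb 1) = 2 * ln ratio" "\<theta> * (xb 2 - xb 1) = 2 * ln ratio + 2 * ln gap" "\<theta> * (xs 2 - xb 1) = 2 * ln gap"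
    using param_facts(7) unfolding points by (simp_all add: field_simps)
  then show "exp (\<theta> * (xs 1 - xb 1)) = ratio\<^sup>2" "exp (\<theta> * (xb 2 - xb 1)) = ratio\<^sup>2 * gap\<^sup>2" "exp (\<theta> * (xs 2 - xb 1)) = gap\<^sup>2"
    using ratio(1) gap(1) by (simp_all add: exp_add exp_double)
qed

lemma ratio_sq: "(\<eta> + \<xi>) / ratio\<^sup>2 = \<eta> - \<xi>" "(\<eta> - \<xi>) * ratio\<^sup>2 = \<eta> + \<xi>"
  using param_facts unfolding ratio(2) by auto

lemma hyperbolic: "\<xi> / \<theta> * cosh u - \<eta> / \<theta> * sinh u = ((\<eta> + \<xi>) / exp u - (\<eta> - \<xi>) * exp u) / (2 * \<theta>)"
  unfolding cosh_field_def sinh_field_def exp_minus using param_facts(7) by (simp add: field_simps)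

text \<open>These are the two value-matching conditions satisfied by the 8-uple.\<close>

lemma phi1_impulse: "phi1 G \<xi> st (xb 1) = phi1 G \<xi> st (xs 1) - c G - lambda G * (xs 1 - xb 1)"
proof -
  define d where "d = xs 1 - xb 1"
  have d: "\<theta> * d = 2 * ln ratio" using param_facts(7) unfolding d_def points by (simp add: field_simps)
  \<comment> \<open>The hyperbolic part takes opposite values at the two ends of the impulse,
    \<open>\<xi> / \<theta>\<close> at the threshold and \<open>- \<xi> / \<theta>\<close> at the
    target.\<close>
  have A: "\<xi> / \<theta> * cosh (\<theta> * d) - \<eta> / \<theta> * sinh (\<theta> * d) = - \<xi> / \<theta>"
    unfolding hyperbolic exp_gaps(1)[folded d_def] ratio_sq by simp
  have "phi1 G \<xi> st (xs 1) - phi1 G \<xi> st (xb 1) - lambda G * d = - 2 * \<xi> / \<theta> + d * (1 / rho G - lambda G)"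
  proof -
    have "(xs 1 - s1 G) / rho G = (xb 1 - s1 G) / rho G + d * (1 / rho G)"
      by (simp add: d_def diff_divide_distrib)
    then show ?thesis unfolding phi1_eq d_def[symmetric] A by (simp add: right_diff_distrib)
  qed
  also have "\<dots> = - 2 * \<xi> / \<theta> + (2 * ln ratio * \<eta>) / \<theta>"
    unfolding param_facts(11) d[symmetric] using param_facts(7) by simp
  also have "\<dots> = c G" unfolding ln_ratio using param_facts(7) by (simp add: field_simps)
  finally show ?thesis unfolding d_def by simp
qed

lemma phi1_opponent_impulse: "phi1 G \<xi> st (xb 2) = phi1 G \<xi> st (xs 2) + c_tilde G + lambda_tilde G * (xb 2 - xs 2)"
proof -
  define d where "d = xb 2 - xs 2"
  have d: "\<theta> * d = 2 * ln ratio" using param_facts(7) unfolding d_def points by (simp add: field_simps)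
  have e: "(\<eta> + \<xi>) / (ratio\<^sup>2 * gap\<^sup>2) = (\<eta> - \<xi>) / gap\<^sup>2" "(\<eta> - \<xi>) * (ratio\<^sup>2 * gap\<^sup>2) = (\<eta> + \<xi>) * gap\<^sup>2"
    using ratio_sq by (simp_all add: divide_divide_eq_left[symmetric] mult.assoc[symmetric])
  have "\<xi> / \<theta> * cosh (\<theta> * (xb 2 - xb 1)) - \<eta> / \<theta> * sinh (\<theta> * (xb 2 - xb 1))
     - (\<xi> / \<theta> * cosh (\<theta> * (xs 2 - xb 1)) - \<eta> / \<theta> * sinh (\<theta> * (xs 2 - xb 1))) = - \<xi> * (gap\<^sup>2 + (1 / gap)\<^sup>2) / \<theta>"
  proof -
    have aux: "(a / h - b * h) / (2 * \<theta>) - (b / h - a * h) / (2 * \<theta>) = (a - b) * (h + 1 / h) / (2 * \<theta>)"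
      if "h \<noteq> 0" for a b h using that param_facts(7) by (simp add: field_simps)
    show ?thesis unfolding hyperbolic exp_gaps e
      using aux[of "gap\<^sup>2" "\<eta> - \<xi>" "\<eta> + \<xi>"] gap(1) by (simp add: power_divide)
  qed
  then have A: "\<xi> / \<theta> * cosh (\<theta> * (xb 2 - xb 1)) - \<eta> / \<theta> * sinh (\<theta> * (xb 2 - xb 1))
     = (\<xi> / \<theta> * cosh (\<theta> * (xs 2 - xb 1)) - \<eta> / \<theta> * sinh (\<theta> * (xs 2 - xb 1))) - \<xi> * (4 * Gam G \<xi> + 2) / \<theta>"
    unfolding gap(3) by simp
  have "phi1 G \<xi> st (xb 2) - phi1 G \<xi> st (xs 2) = - \<xi> * (4 * Gam G \<xi> + 2) / \<theta> + d * (1 / rho G)"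
    unfolding phi1_eq A d_def by (simp add: diff_divide_distrib)
  also have "\<dots> = c_tilde G + lambda_tilde G * d"
  proof -
    have dv: "d = (2 * \<xi> + \<theta> * c G) / (\<eta> * \<theta>)"
    proof -
      have "(\<theta> * d) * \<eta> = 2 * \<xi> + \<theta> * c G" unfolding d by (rule ln_ratio)
      then show ?thesis using param_facts(7,8) by (simp add: eq_divide_eq mult_ac)
    qed
    have N: "(2 * \<xi> + \<theta> * c G) / \<eta> = d * \<theta>" "d * \<eta> = 2 * \<xi> / \<theta> + c G"
    proof -
      show "(2 * \<xi> + \<theta> * c G) / \<eta> = d * \<theta>" unfolding dv using param_facts(7,8) by simp
      have "d * \<eta> = (2 * \<xi> + \<theta> * c G) / \<theta>" unfolding dv using param_facts(7,8) by simp
      then show "d * \<eta> = 2 * \<xi> / \<theta> + c G" using param_facts(7) by (simp add: add_divide_distrib)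
    qed
    \<comment> \<open>Here the formula for \<open>Gam\<close> shows its origin: it solves value
      matching at \<open>xb 2\<close>, where the unknown \<open>gap\<close> enters only through
      \<open>gap\<^sup>2 + (1 / gap)\<^sup>2\<close>.\<close>
    have "\<xi> * (4 * Gam G \<xi>) = \<theta> * (c G - c_tilde G) + (lambda G - lambda_tilde G) * ((2 * \<xi> + \<theta> * c G) / \<eta>)"
      unfolding Gam_def using param_facts(8,9) by (simp add: field_simps)
    also have "\<dots> = \<theta> * (c G - c_tilde G + (lambda G - lambda_tilde G) * d)"
      unfolding N by (simp add: algebra_simps)
    finally have "- \<xi> * (4 * Gam G \<xi> + 2) / \<theta> = - (c G - c_tilde G + (lambda G - lambda_tilde G) * d) - 2 * \<xi> / \<theta>"
      using param_facts(7) by (simp add: distrib_left diff_divide_distrib mult.assoc)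
    then show ?thesis unfolding param_facts(11) distrib_left N(2) by (simp add: algebra_simps)
  qed
  finally show ?thesis unfolding d_def by simp
qed

text \<open>Value matching for the own impulse identifies the affine branch, and value matching for
  the opponent's impulse extends the formula to the endpoint \<open>xb 2\<close>. The closed
  half-line can then serve as the set \<open>D\<close> of the verification.\<close>

lemma V_eq_kinked: "x \<le> xb 2 \<Longrightarrow> V x = kinked (\<xi> / \<theta>) \<eta> \<theta> (x - xb 1) + (x - s1 G) / rho G"
proof (cases "x \<le> xb 1")
  case True
  have "phi1 G \<xi> st (xs 1) - c G - lambda G * (xs 1 - x) = phi1 G \<xi> st (xb 1) + lambda G * (x - xb 1)"
    unfolding phi1_impulse by (simp add: algebra_simps)
  also have "\<dots> = \<xi> / \<theta> - \<eta> * (x - xb 1) + (x - s1 G) / rho G"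
  proof -
    have "lambda G = 1 / rho G - \<eta>" using param_facts(11) by simp
    then have "lambda G * (x - xb 1) = (x - xb 1) / rho G - \<eta> * (x - xb 1)" by (simp add: left_diff_distrib)
    then show ?thesis unfolding phi1_eq by (simp add: diff_divide_distrib)
  qed
  finally show ?thesis using True by (simp add: V1_tilde_def kinked_def)
next
  case False
  assume "x \<le> xb 2"
  then consider "x < xb 2" | "x = xb 2" by linarith
  then have "V x = phi1 G \<xi> st x"
    by cases (use False order phi1_opponent_impulse in \<open>auto simp: V1_tilde_def\<close>)
  then show ?thesis using False by (simp add: phi1_eq kinked_def)
qed

lemma V_measurable [measurable]: "V \<in> borel_measurable borel"
  unfolding V1_tilde_def phi1_def by measurable

lemma V_phi1: "xb 1 \<le> x \<Longrightarrow> x \<le> xb 2 \<Longrightarrow> V x = phi1 G \<xi> st x"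
  by (simp add: V_eq_kinked phi1_eq kinked_def)

lemma V_left: "x \<le> xb 1 \<Longrightarrow> V x = V (xs 1) - c G - lambda G * (xs 1 - x)"
  using V_phi1[of "xs 1"] order by (simp add: V1_tilde_def)

lemma V_right: "xb 2 \<le> x \<Longrightarrow> V x = V (xs 2) + c_tilde G + lambda_tilde G * (x - xs 2)"
  using V_phi1[of "xs 2"] order by (simp add: V1_tilde_def)

text \<open>In factored form the derivative displays its sign: it vanishes at \<open>xb 1\<close>
  and at \<open>xs 1\<close>, is positive between them, and negative beyond
  \<open>xs 1\<close>.\<close>

lemma V_deriv:
  assumes "xb 1 \<le> x"
  shows "((\<lambda>x. phi1 G \<xi> st x - lambda G * x) has_real_derivative
     (exp (\<theta> * (x - xb 1)) - 1) / (2 * exp (\<theta> * (x - xb 1))) * ((\<eta> - \<xi>) * (exp (\<theta> * (xs 1 - xb 1)) - exp (\<theta> * (x - xb 1))))) (at x)"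
proof -
  define E where "E = exp (\<theta> * (x - xb 1))"
  have E: "0 < E" by (simp add: E_def)
  have p: "0 < \<eta> - \<xi>" using param_facts by simp
  have "((\<lambda>x. phi1 G \<xi> st x - lambda G * x) has_real_derivative
     \<xi> * sinh (\<theta> * (x - xb 1)) - \<eta> * cosh (\<theta> * (x - xb 1)) + 1 / rho G - lambda G) (at x)"
    unfolding phi1_eq using param_facts(1,7) by (auto intro!: derivative_eq_intros simp: field_simps)
  moreover have "\<xi> * sinh (\<theta> * (x - xb 1)) - \<eta> * cosh (\<theta> * (x - xb 1)) + 1 / rho G - lambda G
    = (E - 1) / (2 * E) * ((\<eta> - \<xi>) * ((\<eta> + \<xi>) / (\<eta> - \<xi>) - E))"
    unfolding param_facts(11) sinh_field_def cosh_field_def exp_minus E_def[symmetric] using E p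
    by (simp add: field_simps)
  ultimately show ?thesis unfolding exp_gaps(1) ratio(2) E_def by simp
qed

lemma V_minus_linear_mono:
  assumes "xb 1 \<le> x" "x \<le> y" "y \<le> xs 1"
  shows "V x - lambda G * x \<le> V y - lambda G * y"
proof -
  have "phi1 G \<xi> st x - lambda G * x \<le> phi1 G \<xi> st y - lambda G * y"
  proof (rule DERIV_nonneg_imp_nondecreasing[OF assms(2)])
    fix u assume u: "x \<le> u" "u \<le> y"
    have f: "exp (\<theta> * (u - xb 1)) \<le> exp (\<theta> * (xs 1 - xb 1))" "1 \<le> exp (\<theta> * (u - xb 1))"
      using u assms param_facts(7) by auto
    show "\<exists>d. ((\<lambda>x. phi1 G \<xi> st x - lambda G * x) has_real_derivative d) (at u) \<and> 0 \<le> d"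
      by (intro exI conjI, rule V_deriv) (use f u assms param_facts in auto)
  qed
  then show ?thesis using assms order by (simp add: V_phi1)
qed

lemma V_minus_linear_antimono:
  assumes "xs 1 \<le> x" "x \<le> y"
  shows "V y - lambda G * y \<le> V x - lambda G * x"
proof -
  have 1: "V y - lambda G * y \<le> V x - lambda G * x" if xy: "xs 1 \<le> x" "x \<le> y" "y \<le> xb 2" for x y
  proof -
    have "phi1 G \<xi> st y - lambda G * y \<le> phi1 G \<xi> st x - lambda G * x"
    proof (rule DERIV_nonpos_imp_nonincreasing[OF xy(2)])
      fix u assume u: "x \<le> u" "u \<le> y"
      have f: "exp (\<theta> * (xs 1 - xb 1)) \<le> exp (\<theta> * (u - xb 1))" "1 \<le> exp (\<theta> * (u - xb 1))"
        using u xy param_facts(7) order by auto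
      show "\<exists>d. ((\<lambda>x. phi1 G \<xi> st x - lambda G * x) has_real_derivative d) (at u) \<and> d \<le> 0"
        by (intro exI conjI, rule V_deriv) (use f u xy order param_facts in \<open>auto intro!: mult_nonneg_nonpos divide_nonpos_pos\<close>)
    qed
    then show ?thesis using xy order by (simp add: V_phi1)
  qed
  have 2: "V y - lambda G * y \<le> V x - lambda G * x" if "xb 2 \<le> x" "x \<le> y" for x y
  proof -
    have "lambda_tilde G * (y - x) \<le> lambda G * (y - x)" using that param_facts by (intro mult_right_mono) auto
    then show ?thesis using V_right[of x] V_right[of y] that by (simp add: algebra_simps)
  qed
  show ?thesis
  proof (cases "y \<le> xb 2")
    case False
    then show ?thesis
      using 1[of x "xb 2"] 2[of "xb 2" y] 2[of x y] assms by (cases "x \<le> xb 2") auto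
  qed (use 1 assms in auto)
qed

text \<open>After subtracting \<open>lambda G * x\<close> from \<open>V\<close>, only the fixed cost
  matters. The resulting function is constant up to \<open>xb 1\<close>, increases by exactly
  \<open>c G\<close> to its maximum at \<open>xs 1\<close>, and decreases afterwards. An upward move
  can thus gain at most the fixed cost, and gains nothing from beyond \<open>xs 1\<close>.\<close>

lemma V_obstacle:
  assumes "0 \<le> d"
  shows "V (y + d) - (c G + lambda G * d) \<le> V y"
proof -
  have left: "V x - lambda G * x = V (xs 1) - lambda G * xs 1 - c G" if "x \<le> xb 1" for x
    using V_left[OF that] by (simp add: algebra_simps)
  have top: "V x - lambda G * x \<le> V (xs 1) - lambda G * xs 1" for x
  proof -
    consider "x \<le> xb 1" | "xb 1 \<le> x" "x \<le> xs 1" | "xs 1 \<le> x" by linarith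
    then show ?thesis
    proof cases
      case 1
      show ?thesis unfolding left[OF 1] using c_pos by linarith
    qed (rule V_minus_linear_mono V_minus_linear_antimono; simp)+
  qed
  have low: "V (xs 1) - lambda G * xs 1 - c G \<le> V x - lambda G * x" if "x \<le> xs 1" for x
  proof (cases "x \<le> xb 1")
    case True
    show ?thesis unfolding left[OF True] by simp
  next
    case False
    then show ?thesis unfolding left[OF order_refl, symmetric] using that by (intro V_minus_linear_mono) auto
  qed
  have "V (y + d) - lambda G * (y + d) - c G \<le> V y - lambda G * y"
  proof (cases "y \<le> xs 1")
    case True
    then show ?thesis using top[of "y + d"] low[OF True] by linarith
  next
    case False
    then have "V (y + d) - lambda G * (y + d) \<le> V y - lambda G * y"
      using assms by (intro V_minus_linear_antimono) auto
    then show ?thesis using c_pos by linarith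
  qed
  then show ?thesis by (simp add: algebra_simps)
qed

text \<open>The outer slopes are \<open>lambda G\<close> on the left and
  \<open>lambda_tilde G\<close>, which is not larger, on the right. Keeping the factor
  \<open>lambda G\<close> in the bound is essential: that multiple of a position is what the
  intervention costs control.\<close>

lemma V_growth: obtains C where "0 \<le> C" "\<And>y. \<bar>V y\<bar> \<le> C * (1 + lambda G * \<bar>y\<bar>)"
proof -
  have "continuous_on {xb 1..xb 2} (phi1 G \<xi> st)" unfolding phi1_def using param_facts(1) by (intro continuous_intros) auto
  then have "bounded (phi1 G \<xi> st ` {xb 1..xb 2})" by (intro compact_imp_bounded compact_continuous_image) auto
  then obtain B where B: "\<forall>x\<in>{xb 1..xb 2}. \<bar>phi1 G \<xi> st x\<bar> \<le> B" by (auto simp: bounded_iff)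
  define K where "K = \<bar>B\<bar> + \<bar>V (xs 1)\<bar> + c G + lambda G * \<bar>xs 1\<bar> + \<bar>V (xs 2)\<bar> + c_tilde G + lambda_tilde G * \<bar>xs 2\<bar> + 1"
  have nn: "0 \<le> lambda G * \<bar>y\<bar>" "0 \<le> lambda_tilde G * \<bar>y\<bar>" for y using param_facts by auto
  have c0: "0 \<le> c G" "0 \<le> c_tilde G" using param_facts c_pos by auto
  have K1: "1 \<le> K" unfolding K_def using nn[of "xs 1"] nn[of "xs 2"] c0 by linarith
  have *: "\<bar>V y\<bar> \<le> K + lambda G * \<bar>y\<bar>" for y
  proof -
    consider "y \<le> xb 1" | "xb 1 \<le> y" "y \<le> xb 2" | "xb 2 \<le> y" by linarith
    then show ?thesis
    proof cases
      case 1
      have "\<bar>lambda G * (xs 1 - y)\<bar> \<le> lambda G * \<bar>xs 1\<bar> + lambda G * \<bar>y\<bar>"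
        using param_facts by (simp add: abs_mult distrib_left[symmetric] mult_left_mono abs_triangle_ineq4)
      then show ?thesis unfolding V_left[OF 1] K_def using nn[of "xs 1"] nn[of "xs 2"] c0 by linarith
    next
      case 2
      then have "\<bar>V y\<bar> \<le> B" using B by (simp add: V_phi1)
      then show ?thesis unfolding K_def using nn[of y] nn[of "xs 1"] nn[of "xs 2"] c0 by linarith
    next
      case 3
      have "\<bar>lambda_tilde G * (y - xs 2)\<bar> \<le> lambda_tilde G * \<bar>y\<bar> + lambda_tilde G * \<bar>xs 2\<bar>"
        using param_facts by (simp add: abs_mult distrib_left[symmetric] mult_left_mono abs_triangle_ineq4)
      moreover have "lambda_tilde G * \<bar>y\<bar> \<le> lambda G * \<bar>y\<bar>" using param_facts by (intro mult_right_mono) auto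
      ultimately show ?thesis unfolding V_right[OF 3] K_def using nn[of "xs 1"] nn[of "xs 2"] c0 by linarith
    qed
  qed
  have "\<bar>V y\<bar> \<le> K * (1 + lambda G * \<bar>y\<bar>)" for y
  proof -
    have "1 * (lambda G * \<bar>y\<bar>) \<le> K * (lambda G * \<bar>y\<bar>)" using K1 nn(1)[of y] by (intro mult_right_mono) auto
    then show ?thesis using *[of y] by (simp add: distrib_left)
  qed
  then show ?thesis using that[of K] K1 by auto
qed

lemma V_touch: "a \<le> xb 2 \<Longrightarrow> V a = up (\<xi> / \<theta>) \<eta> \<theta> (a - xb 1) + down (\<xi> / \<theta>) \<eta> \<theta> (a - xb 1) + (a - s1 G) / rho G"
  using kinked_touch[OF param_facts(7)] by (simp add: V_eq_kinked)

lemma V_le_tangent: "b \<le> xb 2 \<Longrightarrow> V b \<le> up (\<xi> / \<theta>) \<eta> \<theta> (a - xb 1) * exp (\<theta> * (b - a))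
     + down (\<xi> / \<theta>) \<eta> \<theta> (a - xb 1) * exp (- \<theta> * (b - a)) + (b - s1 G) / rho G"
  using kinked_le_tangent[OF param_facts(7), of "\<xi> / \<theta>" \<eta> "b - xb 1" "a - xb 1"] param_facts by (simp add: V_eq_kinked)

lemma V_eq_tangent: "xb 1 \<le> a \<Longrightarrow> xb 1 \<le> b \<Longrightarrow> b \<le> xb 2 \<Longrightarrow> V b = up (\<xi> / \<theta>) \<eta> \<theta> (a - xb 1) * exp (\<theta> * (b - a))
     + down (\<xi> / \<theta>) \<eta> \<theta> (a - xb 1) * exp (- \<theta> * (b - a)) + (b - s1 G) / rho G"
  using kinked_harmonic[OF param_facts(7), of "a - xb 1" "\<xi> / \<theta>" \<eta> "b - xb 1"] by (simp add: V_phi1 phi1_eq)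

end

section \<open>The equilibrium\<close>

lemma player_cases_opponent: "j = i \<or> j = opponent i" for i j :: player
  by (cases i; cases j) auto

section \<open>Both players by reflection\<close>

context candidate_solution begin

text \<open>Reflecting the state space exchanges the two players.\<close>

definition mirror :: game where "mirror = G\<lparr>s1 := - s2 G, s2 := - s1 G\<rparr>"

lemma mirror_simps [simp]:
  "rho mirror = rho G" "game.sigma mirror = game.sigma G" "c mirror = c G" "c_tilde mirror = c_tilde G"
  "lambda mirror = lambda G" "lambda_tilde mirror = lambda_tilde G" "s1 mirror = - s2 G" "s2 mirror = - s1 G"
  "theta mirror = theta G" "eta mirror = eta G" "Gam mirror \<xi> = Gam G \<xi>"
  by (simp_all add: mirror_def theta_def eta_def Gam_def)

lemma candidate_solution_mirror: "candidate_solution mirror \<xi>"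
proof
  show "admissible_parameters mirror" using params by (simp add: admissible_parameters_def)
  show "is_xi mirror \<xi>" using xi by (simp add: is_xi_def xi_fun_def)
qed

lemma mirror_points:
  "x_bar mirror \<xi> (- st) 1 = - xb 2" "x_bar mirror \<xi> (- st) 2 = - xb 1"
  "x_star mirror \<xi> (- st) 1 = - xs 2" "x_star mirror \<xi> (- st) 2 = - xs 1"
  by (simp_all add: x_bar_def x_star_def)

lemma phi2_mirror: "phi2 G \<xi> st y = phi1 mirror \<xi> (- st) (- y)"
proof -
  have "A_coeff G \<xi> st 2 1 = A_coeff mirror \<xi> (- st) 1 2" "A_coeff G \<xi> st 2 2 = A_coeff mirror \<xi> (- st) 1 1"
    by (simp_all add: A_coeff_def)
  then show ?thesis by (simp add: phi1_def phi2_def)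
qed

lemma V2_mirror: "V2_tilde G \<xi> st y = V1_tilde mirror \<xi> (- st) (- y)"
  unfolding V1_tilde_def V2_tilde_def mirror_points phi2_mirror using order by auto

definition val :: "player \<Rightarrow> real \<Rightarrow> real" where
  "val i = (if i = Player1 then V1_tilde G \<xi> st else V2_tilde G \<xi> st)"

text \<open>The closure of the opponent's continuation region. Player \<open>i\<close> may deviate
  arbitrarily, but the path between interventions cannot leave it.\<close>

definition region :: "player \<Rightarrow> real set" where
  "region i = (if i = Player1 then {..xb 2} else {xb 1..})"

abbreviation "cand \<equiv> candidate G \<xi> st"

lemma val_measurable: "val i \<in> borel_measurable borel"
  unfolding val_def V2_tilde_def phi2_def by (cases i) auto

lemma val_obstacle:
  assumes "d \<in> impulses i" shows "val i (y + d) - (c G + lambda G * \<bar>d\<bar>) \<le> val i y"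
proof (cases i)
  case Player1
  then show ?thesis using V_obstacle[of d y] assms by (simp add: val_def)
next
  case Player2
  then show ?thesis
    using candidate_solution.V_obstacle[OF candidate_solution_mirror, of "- d" "- st" "- y"] assms
    by (simp add: val_def V2_mirror)
qed

lemma val_own_impulse:
  assumes "y \<notin> fst (cand i)"
  shows "snd (cand i) y \<in> impulses i"
    and "val i (y + snd (cand i) y) - (c G + lambda G * \<bar>snd (cand i) y\<bar>) = val i y"
proof -
  have "snd (cand i) y \<in> impulses i \<and> val i (y + snd (cand i) y) - (c G + lambda G * \<bar>snd (cand i) y\<bar>) = val i y"
  proof (cases i)
    case Player1
    then have "y \<le> xb 1" using assms by auto
    then show ?thesis using Player1 order V_left[of y] by (simp add: val_def)
  next
    case Player2
    then have "xb 2 \<le> y" using assms by auto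
    then show ?thesis using Player2 order
        candidate_solution.V_left[OF candidate_solution_mirror, of "- y" "- st"]
      by (simp add: val_def V2_mirror mirror_points[unfolded One_nat_def])
  qed
  then show "snd (cand i) y \<in> impulses i"
    "val i (y + snd (cand i) y) - (c G + lambda G * \<bar>snd (cand i) y\<bar>) = val i y" by auto
qed

lemma val_opponent_impulse:
  assumes "y \<notin> fst (cand (opponent i))"
  shows "val i (y + snd (cand (opponent i)) y) + (c_tilde G + lambda_tilde G * \<bar>snd (cand (opponent i)) y\<bar>) = val i y"
proof (cases i)
  case Player1
  then have "xb 2 \<le> y" using assms by auto
  then show ?thesis using Player1 order V_right[of y] by (simp add: val_def)
next
  case Player2
  then have "y \<le> xb 1" using assms by auto
  then show ?thesis using Player2 order
      candidate_solution.V_right[OF candidate_solution_mirror, of "- st" "- y"]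
    by (simp add: val_def V2_mirror mirror_points[unfolded One_nat_def])
qed

lemma val_growth: obtains C where "0 \<le> C" "\<And>y. \<bar>val i y\<bar> \<le> C * (1 + lambda G * \<bar>y\<bar>)"
proof (cases i)
  case Player1
  then show ?thesis using V_growth that by (auto simp: val_def)
next
  case Player2
  obtain C where C: "0 \<le> C" "\<And>y. \<bar>V1_tilde mirror \<xi> (- st) y\<bar> \<le> C * (1 + lambda mirror * \<bar>y\<bar>)"
    using candidate_solution.V_growth[OF candidate_solution_mirror, of "- st"] by blast
  show ?thesis
    by (rule that[OF C(1)]) (use C(2)[of "- y" for y] Player2 in \<open>simp add: val_def V2_mirror\<close>)
qed

lemma val_tangents:
  obtains \<alpha> \<beta> where "\<alpha> \<in> borel_measurable borel" "\<beta> \<in> borel_measurable borel"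
    "\<And>a. a \<in> region i \<Longrightarrow> val i a = \<alpha> a + \<beta> a + running_payoff G i a / rho G"
    "\<And>a b. a \<in> region i \<Longrightarrow> b \<in> region i \<Longrightarrow>
      val i b \<le> \<alpha> a * exp (\<theta> * (b - a)) + \<beta> a * exp (- \<theta> * (b - a)) + running_payoff G i b / rho G"
    "\<And>a b. a \<in> {xb 1..xb 2} \<Longrightarrow> b \<in> {xb 1..xb 2} \<Longrightarrow>
      val i b = \<alpha> a * exp (\<theta> * (b - a)) + \<beta> a * exp (- \<theta> * (b - a)) + running_payoff G i b / rho G"
proof (cases i)
  case Player1
  show ?thesis
  proof (rule that[of "\<lambda>a. up (\<xi> / \<theta>) \<eta> \<theta> (a - xb 1)" "\<lambda>a. down (\<xi> / \<theta>) \<eta> \<theta> (a - xb 1)"])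
    fix a b
    show "a \<in> region i \<Longrightarrow> val i a = up (\<xi> / \<theta>) \<eta> \<theta> (a - xb 1) + down (\<xi> / \<theta>) \<eta> \<theta> (a - xb 1) + running_payoff G i a / rho G"
      using V_touch[of a] Player1 by (simp add: val_def region_def)
    show "a \<in> region i \<Longrightarrow> b \<in> region i \<Longrightarrow> val i b \<le> up (\<xi> / \<theta>) \<eta> \<theta> (a - xb 1) * exp (\<theta> * (b - a))
        + down (\<xi> / \<theta>) \<eta> \<theta> (a - xb 1) * exp (- \<theta> * (b - a)) + running_payoff G i b / rho G"
      using V_le_tangent[of b a] Player1 by (simp add: val_def region_def)
    show "a \<in> {xb 1..xb 2} \<Longrightarrow> b \<in> {xb 1..xb 2} \<Longrightarrow> val i b = up (\<xi> / \<theta>) \<eta> \<theta> (a - xb 1) * exp (\<theta> * (b - a))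
        + down (\<xi> / \<theta>) \<eta> \<theta> (a - xb 1) * exp (- \<theta> * (b - a)) + running_payoff G i b / rho G"
      using V_eq_tangent[of a b] Player1 by (simp add: val_def)
  qed measurable
next
  case Player2
  interpret R: candidate_solution mirror \<xi> "- st" by (rule candidate_solution_mirror)
  note T = R.V_touch R.V_le_tangent R.V_eq_tangent
  show ?thesis
  \<comment> \<open>Reflection exchanges increasing and decreasing exponentials, so
    \<open>up\<close> and \<open>down\<close> trade places. The argument is the distance of
    \<open>- a\<close> from the mirrored threshold \<open>- xb 2\<close>.\<close>
  proof (rule that[of "\<lambda>a. down (\<xi> / \<theta>) \<eta> \<theta> (- a + xb 2)" "\<lambda>a. up (\<xi> / \<theta>) \<eta> \<theta> (- a + xb 2)"])
    fix a b
    show "a \<in> region i \<Longrightarrow> val i a = down (\<xi> / \<theta>) \<eta> \<theta> (- a + xb 2) + up (\<xi> / \<theta>) \<eta> \<theta> (- a + xb 2) + running_payoff G i a / rho G"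
      using R.V_touch[of "- a"] Player2 unfolding mirror_points by (simp add: val_def region_def V2_mirror)
    show "a \<in> region i \<Longrightarrow> b \<in> region i \<Longrightarrow> val i b \<le> down (\<xi> / \<theta>) \<eta> \<theta> (- a + xb 2) * exp (\<theta> * (b - a))
        + up (\<xi> / \<theta>) \<eta> \<theta> (- a + xb 2) * exp (- \<theta> * (b - a)) + running_payoff G i b / rho G"
      using R.V_le_tangent[of "- b" "- a"] Player2 unfolding mirror_points
      by (simp add: val_def region_def V2_mirror algebra_simps)
    show "a \<in> {xb 1..xb 2} \<Longrightarrow> b \<in> {xb 1..xb 2} \<Longrightarrow> val i b = down (\<xi> / \<theta>) \<eta> \<theta> (- a + xb 2) * exp (\<theta> * (b - a))
        + up (\<xi> / \<theta>) \<eta> \<theta> (- a + xb 2) * exp (- \<theta> * (b - a)) + running_payoff G i b / rho G"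
      using R.V_eq_tangent[of "- a" "- b"] Player2 unfolding mirror_points
      by (simp add: val_def V2_mirror algebra_simps)
  qed measurable
qed

lemma cand_strategy: "is_strategy i (cand i)"
  using val_own_impulse(1)[of _ i] unfolding is_strategy_def
  by (cases i) (auto intro!: continuous_intros)

lemma cand_opponent_region: "fst (cand (opponent i)) \<subseteq> region i" "closed (region i)" "{xb 1..xb 2} \<subseteq> region i"
  by (cases i; auto simp: region_def)+

end

section \<open>Optimality of the candidate strategies\<close>

locale equilibrium_game = candidate_solution G \<xi> st + continuous_brownian_motion M F W
  for G \<xi> st and M :: "'a measure" and F W
begin

text \<open>Verification with sign 1 on \<open>region i\<close>. The deviator's own impulses are
  covered by the obstacle inequality, those of the opponent by value matching.\<close>

lemma deviation_le:
  assumes adm: "admissible G M W x (cand(i := s))"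
  shows "payoff G M W i x (cand(i := s)) \<le> val i x"
proof -
  have strat: "is_strategy j ((cand(i := s)) j)" for j using adm unfolding admissible_def by blast
  interpret controlled_brownian_motion M F W "game.sigma G" x "cand(i := s)"
    by unfold_locales (rule strat)
  obtain C where C: "0 \<le> C" "\<And>y. \<bar>val i y\<bar> \<le> C * (1 + lambda G * \<bar>y\<bar>)" using val_growth[where i = i] by blast
  obtain \<alpha> \<beta> where ab: "\<alpha> \<in> borel_measurable borel" "\<beta> \<in> borel_measurable borel"
    "\<And>a. a \<in> region i \<Longrightarrow> val i a = \<alpha> a + \<beta> a + running_payoff G i a / rho G"
    "\<And>a b. a \<in> region i \<Longrightarrow> b \<in> region i \<Longrightarrow>
      val i b \<le> \<alpha> a * exp (\<theta> * (b - a)) + \<beta> a * exp (- \<theta> * (b - a)) + running_payoff G i b / rho G"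
    using val_tangents by metis
  have "1 * payoff G M W i x (cand(i := s)) \<le> val i x"
  proof (rule verification[OF params refl adm _ cand_opponent_region(2) _ ab(1,2) val_measurable C(2,1)])
    show "fst ((cand(i := s)) Player1) \<inter> fst ((cand(i := s)) Player2) \<subseteq> region i"
      using cand_opponent_region(1)[of i] by (cases i) auto
    fix j y assume y: "y \<notin> fst ((cand(i := s)) j)"
    consider "j = i" | "j = opponent i" "j \<noteq> i" using player_cases_opponent[of j i] by blast
    then show "val i (y + snd ((cand(i := s)) j) y) + 1 * (if j = i then - (c G + lambda G * \<bar>snd ((cand(i := s)) j) y\<bar>)
        else c_tilde G + lambda_tilde G * \<bar>snd ((cand(i := s)) j) y\<bar>) \<le> val i y"
    proof cases
      case 1
      have "snd s y \<in> impulses i" using strat[of i] y 1 by (auto simp: is_strategy_def)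
      then show ?thesis using val_obstacle[of "snd s y" i y] 1 by simp
    next
      case 2
      then show ?thesis using val_opponent_impulse[of y i] y by auto
    qed
  qed (use ab(3,4) in auto)
  then show ?thesis by simp
qed

text \<open>Verification with sign -1 for the negated value. When both players follow the candidate,
  the path between interventions stays in the closed interval of the thresholds, where the touching
  function equals the value; own impulses, too, are now value matching.\<close>

lemma candidate_payoff_ge:
  assumes adm: "admissible G M W x cand"
  shows "val i x \<le> payoff G M W i x cand"
proof -
  interpret controlled_brownian_motion M F W "game.sigma G" x cand
    by unfold_locales (rule cand_strategy)
  obtain C where C: "0 \<le> C" "\<And>y. \<bar>val i y\<bar> \<le> C * (1 + lambda G * \<bar>y\<bar>)" using val_growth[where i = i] by blast
  obtain \<alpha> \<beta> where ab: "\<alpha> \<in> borel_measurable borel" "\<beta> \<in> borel_measurable borel"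
    "\<And>a. a \<in> region i \<Longrightarrow> val i a = \<alpha> a + \<beta> a + running_payoff G i a / rho G"
    "\<And>a b. a \<in> {xb 1..xb 2} \<Longrightarrow> b \<in> {xb 1..xb 2} \<Longrightarrow>
      val i b = \<alpha> a * exp (\<theta> * (b - a)) + \<beta> a * exp (- \<theta> * (b - a)) + running_payoff G i b / rho G"
    using val_tangents by metis
  have "(- 1) * payoff G M W i x cand \<le> - val i x"
  proof (rule verification[where V = "\<lambda>y. - val i y" and \<alpha> = "\<lambda>a. - \<alpha> a" and \<beta> = "\<lambda>a. - \<beta> a" and D = "{xb 1..xb 2}" and C = C,
        OF params refl adm])
    show "- val i a = - \<alpha> a + - \<beta> a + - 1 * running_payoff G i a / rho G" if "a \<in> {xb 1..xb 2}" for a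
      using ab(3)[of a] that cand_opponent_region(3)[of i] by auto
    show "- val i b \<le> - \<alpha> a * exp (\<theta> * (b - a)) + - \<beta> a * exp (- \<theta> * (b - a)) + - 1 * running_payoff G i b / rho G"
      if "a \<in> {xb 1..xb 2}" "b \<in> {xb 1..xb 2}" for a b
      using ab(4)[OF that] by simp
    fix j y assume y: "y \<notin> fst (cand j)"
    show "- val i (y + snd (cand j) y) + - 1 * (if j = i then - (c G + lambda G * \<bar>snd (cand j) y\<bar>)
        else c_tilde G + lambda_tilde G * \<bar>snd (cand j) y\<bar>) \<le> - val i y"
      using val_own_impulse(2)[of y i] val_opponent_impulse[of y i] y player_cases_opponent[of j i] by auto
  qed (use ab(1,2) val_measurable[of i] C in auto)
  then show ?thesis by simp
qed

end

section \<open>Admissibility of the candidate play\<close>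

lemma nn_integral_exp_finite:
  assumes r: "0 < r" and K: "0 \<le> K"
  shows "(\<integral>\<^sup>+ s\<in>{0..}. ennreal (K * exp (- r * s)) \<partial>lborel) < \<infinity>"
proof -
  have lim: "((\<lambda>s. - (K / r) * exp (- r * s)) \<longlongrightarrow> - (K / r) * 0) at_top"
    using r by (intro tendsto_mult tendsto_const filterlim_compose[OF exp_at_bot]
        filterlim_tendsto_neg_mult_at_bot[OF tendsto_const]) (auto simp: filterlim_ident)
  have "(\<integral>\<^sup>+ s. ennreal (K * exp (- r * s)) * indicator {0..} s \<partial>lborel) = ennreal (- (K / r) * 0 - (- (K / r) * exp (- r * 0)))"
    by (rule nn_integral_FTC_atLeast[OF _ _ _ lim])
      (use r K in \<open>auto intro!: derivative_eq_intros\<close>)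
  then show ?thesis by (simp add: mult.commute)
qed

lemma (in complete_measure) integrable_nonneg_AE_cong:
  assumes ae: "AE \<omega> in M. f \<omega> = g \<omega>"
  shows "integrable_nonneg M f \<longleftrightarrow> integrable_nonneg M g"
  unfolding integrable_nonneg_def borel_measurable_AE_cong_iff[OF ae] nn_integral_cong_AE[OF ae] ..

lemma (in prob_space) integrable_nonneg_bounded:
  assumes "f \<in> borel_measurable M" "AE \<omega> in M. f \<omega> \<le> K" "K < \<infinity>"
  shows "integrable_nonneg M f"
  unfolding integrable_nonneg_def
proof
  have "(\<integral>\<^sup>+ \<omega>. f \<omega> \<partial>M) \<le> (\<integral>\<^sup>+ \<omega>. K \<partial>M)" using assms(2) by (rule nn_integral_mono_AE)
  then show "(\<integral>\<^sup>+ \<omega>. f \<omega> \<partial>M) < \<infinity>" using assms(3) by (simp add: emeasure_space_1)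
qed (rule assms(1))

text \<open>Reduces the supremum over an uncountable time set to a countable one, as its
  measurability requires.\<close>

lemma rational_sup_right_continuous:
  fixes f :: "real \<Rightarrow> real"
  assumes rc: "\<And>t. 0 \<le> t \<Longrightarrow> (f \<longlongrightarrow> f t) (at_right t)"
  shows "(\<Squnion>t\<in>{0..}. ennreal (f t)) = (\<Squnion>t\<in>{0..} \<inter> \<rat>. ennreal (f t))"
proof (rule antisym)
  show "(\<Squnion>t\<in>{0..}. ennreal (f t)) \<le> (\<Squnion>t\<in>{0..} \<inter> \<rat>. ennreal (f t))"
  proof (rule SUP_least)
    fix t :: real assume "t \<in> {0..}"
    then have t: "0 \<le> t" by simp
    have "\<exists>q\<in>\<rat>. t < q \<and> q < t + inverse (real (Suc n))" for n
      using Rats_dense_in_real[of t "t + inverse (real (Suc n))"] by auto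
    then obtain q where q: "\<And>n. q n \<in> \<rat>" "\<And>n. t < q n" "\<And>n. q n < t + inverse (real (Suc n))" by metis
    have "(\<lambda>n. t + inverse (real (Suc n))) \<longlonglongrightarrow> t + 0" by (intro tendsto_intros LIMSEQ_inverse_real_of_nat)
    then have "q \<longlonglongrightarrow> t"
      using q(2,3) by (intro tendsto_sandwich[of "\<lambda>_. t" q sequentially "\<lambda>n. t + inverse (real (Suc n))"])
        (auto intro!: always_eventually less_imp_le)
    then have "filterlim q (at_right t) sequentially"
      unfolding filterlim_at
    proof (intro conjI always_eventually allI)
      show "q n \<in> {t<..}" "q n \<noteq> t" for n using q(2)[of n] by auto
    qed
    then have "(\<lambda>n. ennreal (f (q n))) \<longlonglongrightarrow> ennreal (f t)"
      by (intro tendsto_ennrealI filterlim_compose[OF rc[OF t]])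
    then show "ennreal (f t) \<le> (\<Squnion>t\<in>{0..} \<inter> \<rat>. ennreal (f t))"
    proof (rule LIMSEQ_le_const2)
      have "q n \<in> {0..} \<inter> \<rat>" for n using q(1)[of n] q(2)[of n] t by auto
      then show "\<exists>N. \<forall>n\<ge>N. ennreal (f (q n)) \<le> (\<Squnion>t\<in>{0..} \<inter> \<rat>. ennreal (f t))"
        by (intro exI[of _ 0] allI impI SUP_upper)
    qed
  qed
qed (rule SUP_subset_mono, auto)

context controlled_brownian_motion begin

text \<open>The discount factor of the \<open>k\<close>-th intervention, zero if it never happens.
  The sum over positive \<open>k\<close> is the discounted number of interventions.\<close>

definition weight :: "real \<Rightarrow> nat \<Rightarrow> 'a \<Rightarrow> real" where
  "weight r k \<omega> = total_gain r (\<lambda>_ _. 1) k \<omega>"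

lemma weight_nonneg: "0 \<le> weight r k \<omega>"
  by (simp add: weight_def total_gain_def)

lemma total_gain_measurable:
  assumes "g Player1 \<in> borel_measurable borel" "g Player2 \<in> borel_measurable borel"
  shows "total_gain r g (Suc k) \<in> borel_measurable M"
proof (rule borel_measurable_LIMSEQ_real)
  show "gain r g (Suc k) (real n) \<in> borel_measurable M" for n by (rule gain_measurable[OF assms]) simp
  show "(\<lambda>n. gain r g (Suc k) (real n) \<omega>) \<longlonglongrightarrow> total_gain r g (Suc k) \<omega>" for \<omega>
  proof (cases "tau (Suc k) \<omega>")
    case (real t)
    obtain N :: nat where N: "t \<le> real N" using real_arch_simple by blast
    show ?thesis
      by (rule tendsto_eventually, unfold eventually_sequentially, rule exI[of _ N]) (use N real in \<open>auto simp: gain_eq\<close>)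
  qed (use tau_nonneg[of \<omega> "Suc k"] in \<open>auto simp: gain_eq total_gain_def\<close>)
qed

lemma player_cost_total_gain:
  assumes "\<omega> \<in> space M"
  shows "pcost \<omega> r a b j (Suc k) = total_gain r (\<lambda>i d. if i = j then a + b * \<bar>d\<bar> else 0) (Suc k) \<omega>"
proof -
  interpret P: controlled_path sig x \<pi> "\<lambda>t. W t \<omega>" by (rule controlled_path[OF assms])
  show ?thesis by (simp add: P.player_cost_def P.cost_def total_gain_def)
qed

text \<open>If all intervention times stayed below \<open>T\<close>, each weight would be at least
  \<open>exp (- r * T)\<close>, and the series would diverge.\<close>

lemma tau_unbounded:
  assumes r: "0 < r" and fin: "(\<Sum>k. ennreal (weight r (Suc k) \<omega>)) < \<infinity>"
  shows "\<exists>k. ereal T < tau k \<omega>"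
proof (rule ccontr)
  assume "\<not> (\<exists>k. ereal T < tau k \<omega>)"
  then have bd: "tau k \<omega> \<le> ereal T" for k by (auto simp: not_less)
  have "exp (- r * T) \<le> weight r (Suc k) \<omega>" for k
  proof -
    obtain t where t: "tau (Suc k) \<omega> = ereal t" "t \<le> T"
      using bd[of "Suc k"] tau_nonneg[of \<omega> "Suc k"] by (cases "tau (Suc k) \<omega>") auto
    then show ?thesis using r by (simp add: weight_def total_gain_def)
  qed
  moreover have "summable (\<lambda>k. weight r (Suc k) \<omega>)"
    using fin by (intro summable_suminf_not_top weight_nonneg) auto
  then have "(\<lambda>k. weight r (Suc k) \<omega>) \<longlonglongrightarrow> 0" by (rule summable_LIMSEQ_zero)
  ultimately have "exp (- r * T) \<le> 0" by (intro LIMSEQ_le_const) auto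
  then show False by simp
qed

end

locale candidate_play = equilibrium_game G \<xi> st M F W for G \<xi> st and M :: "'a measure" and F W +
  fixes x :: real
begin

sublocale controlled_brownian_motion M F W "game.sigma G" x cand
  by unfold_locales (rule cand_strategy)

definition bnd :: real where "bnd = \<bar>x\<bar> + \<bar>xb 1\<bar> + \<bar>xb 2\<bar>"

lemma cand_region: "fst (cand Player1) \<inter> fst (cand Player2) \<subseteq> {xb 1..xb 2}" by auto

text \<open>Both targets lie between the thresholds, so every stage after an intervention starts
  there and remains there up to the next one. Only stage 0 may start outside, and it then ends at
  time 0; hence the summand \<open>\<bar>x\<bar>\<close> in \<open>bnd\<close>.\<close>

lemma pos_bounded:
  assumes \<omega>: "\<omega> \<in> space M" and s: "tau k \<omega> \<le> ereal s" "ereal s \<le> tau (Suc k) \<omega>"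
  shows "\<bar>pos k s \<omega>\<bar> \<le> bnd"
proof -
  interpret P: controlled_path "game.sigma G" x cand "\<lambda>t. W t \<omega>" by (rule controlled_path[OF \<omega>])
  obtain t where t: "tau k \<omega> = ereal t" "t \<le> s"
    using s(1) tau_nonneg[of \<omega> k] by (cases "tau k \<omega>") auto
  have in_D: "\<bar>y\<bar> \<le> bnd" if "y \<in> {xb 1..xb 2}" for y using that by (auto simp: bnd_def)
  show ?thesis
  proof (cases "pos k t \<omega> \<in> {xb 1..xb 2}")
    case True
    show ?thesis by (rule in_D[OF P.stays_in_region[OF _ cand_region t(1) True t(2) s(2)]]) simp
  next
    case False
    have "k = 0"
    proof (rule ccontr)
      assume "k \<noteq> 0"
      then obtain j where k: "k = Suc j" by (cases k) auto
      have "pos k t \<omega> = pos j t \<omega> + snd (cand (actor k \<omega>)) (pos j t \<omega>)"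
        using t(1) P.jump_Suc[of j t] unfolding k by (simp add: P.pos_Suc)
      then have "pos k t \<omega> = xs 1 \<or> pos k t \<omega> = xs 2" by (cases "actor k \<omega>") auto
      then show False using False order by auto
    qed
    moreover have "tau (Suc k) \<omega> = tau k \<omega>"
      by (rule P.immediate_intervention[OF _ cand_region t(1) False]) simp
    ultimately have "s = 0" using s by simp
    then show ?thesis using \<open>k = 0\<close> path_zero[OF \<omega>] by (simp add: bnd_def)
  qed
qed

lemma jump_bounded:
  assumes \<omega>: "\<omega> \<in> space M" and fin: "tau (Suc k) \<omega> < \<infinity>"
  shows "\<bar>jump (Suc k) \<omega>\<bar> \<le> 2 * bnd"
proof -
  interpret P: controlled_path "game.sigma G" x cand "\<lambda>t. W t \<omega>" by (rule controlled_path[OF \<omega>])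
  obtain t where t: "tau (Suc k) \<omega> = ereal t" using fin tau_nonneg[of \<omega> "Suc k"] by (cases "tau (Suc k) \<omega>") auto
  have "\<bar>pos k t \<omega>\<bar> \<le> bnd" using P.tm_le_Suc[of k] t by (intro pos_bounded[OF \<omega>]) auto
  moreover have "jump (Suc k) \<omega> = xs 1 - pos k t \<omega> \<or> jump (Suc k) \<omega> = xs 2 - pos k t \<omega>"
    using P.jump_Suc[OF t] by (cases "actor (Suc k) \<omega>") auto
  moreover have "\<bar>xs 1\<bar> \<le> bnd" "\<bar>xs 2\<bar> \<le> bnd" using order by (auto simp: bnd_def)
  ultimately show ?thesis by auto
qed

text \<open>The discounted number of interventions is integrable: apply the supermartingale estimate to
  \<open>cosh (\<theta> (y - m))\<close>, which strictly decreases at each intervention.\<close>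

lemma weights_finite: "(\<integral>\<^sup>+ \<omega>. (\<Sum>k. ennreal (weight (rho G) (Suc k) \<omega>)) \<partial>M) < \<infinity>"
proof -
  define r where "r = rho G"
  define m where "m = (xb 1 + xb 2) / 2"
  \<comment> \<open>Clamping keeps the test function bounded and gives it its maximal value at every
    point where a player intervenes, including an initial state far outside.\<close>
  define cl where "cl y = max (xb 1) (min (xb 2) y)" for y
  define V where "V y = cosh (\<theta> * (cl y - m))" for y
  define Vmax where "Vmax = cosh (\<theta> * (xb 2 - m))"
  \<comment> \<open>The guaranteed drop of the test function at an intervention, from its maximum at
    a threshold to its value at a target strictly inside.\<close>
  define \<gamma> where "\<gamma> = Vmax - max (cosh (\<theta> * (xs 1 - m))) (cosh (\<theta> * (xs 2 - m)))"
  have r: "0 < r" "r = (game.sigma G * \<theta>)\<^sup>2 / 2" 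
    unfolding r_def by (rule param_facts(1), rule sigma_theta[OF params])
  have cosh_lt: "cosh (\<theta> * (y - m)) < Vmax" if "xb 1 < y" "y < xb 2" for y
  proof -
    have "\<bar>y - m\<bar> < xb 2 - m" using that by (auto simp: m_def abs_if field_simps)
    then have "\<theta> * \<bar>y - m\<bar> < \<theta> * (xb 2 - m)" using param_facts(7) by simp
    then have "cosh (\<theta> * \<bar>y - m\<bar>) < Vmax" unfolding Vmax_def
      using param_facts(7) by (intro cosh_real_strict_mono) auto
    moreover have "cosh (\<theta> * \<bar>y - m\<bar>) = cosh (\<theta> * (y - m))"
      using cosh_real_abs[of "\<theta> * (y - m)"] param_facts(7) by (simp add: abs_mult)
    ultimately show ?thesis by simp
  qed
  have \<gamma>: "0 < \<gamma>" unfolding \<gamma>_def using cosh_lt[of "xs 1"] cosh_lt[of "xs 2"] order by auto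
  have ends: "cosh (\<theta> * (xb 1 - m)) = Vmax"
    unfolding Vmax_def using cosh_minus[of "\<theta> * (xb 1 - m)"] by (simp add: m_def field_simps)
  have V_le: "V y \<le> Vmax" "0 \<le> V y" for y
  proof -
    have "xb 1 \<le> cl y" "cl y \<le> xb 2" using order by (auto simp: cl_def)
    then consider "cl y = xb 1" | "cl y = xb 2" | "xb 1 < cl y" "cl y < xb 2" by linarith
    then show "V y \<le> Vmax"
    proof cases
      case 1
      then show ?thesis using ends by (simp add: V_def)
    next
      case 2
      then show ?thesis by (simp add: V_def Vmax_def)
    next
      case 3
      then show ?thesis using cosh_lt[of "cl y"] by (simp add: V_def)
    qed
    show "0 \<le> V y" by (simp add: V_def)
  qed
  have cl_id: "cl y = y" if "y \<in> {xb 1..xb 2}" for y using that by (auto simp: cl_def)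
  have V_M: "V \<in> borel_measurable borel"
    unfolding V_def cl_def by (intro borel_measurable_continuous_onI continuous_intros)
  \<comment> \<open>There is no running payoff here (\<open>p = q = 0\<close>), and the hyperbolic
    cosine is its own touching function at every \<open>a\<close>.\<close>
  have eq: "V b = exp (\<theta> * (a - m)) / 2 * exp (\<theta> * (b - a)) + exp (- \<theta> * (a - m)) / 2 * exp (- \<theta> * (b - a)) + (0 + 0 * b) / r"
    if "b \<in> {xb 1..xb 2}" for a b
  proof -
    have "exp (\<theta> * (a - m)) * exp (\<theta> * (b - a)) = exp (\<theta> * (b - m))"
      "exp (- \<theta> * (a - m)) * exp (- \<theta> * (b - a)) = exp (- (\<theta> * (b - m)))"
      by (simp_all add: exp_add[symmetric] algebra_simps)
    then show ?thesis by (simp add: V_def cl_id[OF that] cosh_field_def add_divide_distrib)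
  qed
  have interv: "V (y + snd (cand j) y) + (\<lambda>_ _. \<gamma>) j (snd (cand j) y) \<le> V y" if "y \<notin> fst (cand j)" for j y
  proof -
    have "V y = Vmax" using that order ends by (cases j) (auto simp: V_def cl_def Vmax_def)
    moreover have "V (xs 1) = cosh (\<theta> * (xs 1 - m))" "V (xs 2) = cosh (\<theta> * (xs 2 - m))"
      using order by (auto simp: V_def cl_id)
    ultimately show ?thesis by (cases j) (auto simp: \<gamma>_def)
  qed
  define K where "K = Vmax + \<gamma>"
  have acc: "expectation (accrued V (\<lambda>_ _. \<gamma>) r 0 0 k T) \<le> V x" "integrable M (accrued V (\<lambda>_ _. \<gamma>) r 0 0 k T)"
    if T: "0 < T" for k T
  proof -
    have eV: "\<bar>exp (- r * tauc j T \<omega>) * V y\<bar> \<le> K" for j \<omega> y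
    proof -
      have "exp (- r * tauc j T \<omega>) * V y \<le> 1 * Vmax"
        using V_le[of y] r(1) T by (intro mult_mono) (auto simp: capped_nonneg)
      then show ?thesis using V_le(2)[of y] \<gamma> by (simp add: K_def abs_mult)
    qed
    have "integrable M (accrued V (\<lambda>_ _. \<gamma>) r 0 0 k T) \<and> expectation (accrued V (\<lambda>_ _. \<gamma>) r 0 0 k T) \<le> V x"
    proof (rule accrued_le[OF r T _ cand_region _ _ V_M _ _ _ _ interv, where Dom = "\<lambda>_. K"
          and \<alpha> = "\<lambda>a. exp (\<theta> * (a - m)) / 2" and \<beta> = "\<lambda>a. exp (- \<theta> * (a - m)) / 2"])
      show "V a = exp (\<theta> * (a - m)) / 2 + exp (- \<theta> * (a - m)) / 2 + (0 + 0 * a) / r" if "a \<in> {xb 1..xb 2}" for a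
        using eq[OF that, of a] by simp
      show "V b \<le> exp (\<theta> * (a - m)) / 2 * exp (\<theta> * (b - a)) + exp (- \<theta> * (a - m)) / 2 * exp (- \<theta> * (b - a)) + (0 + 0 * b) / r"
        if "b \<in> {xb 1..xb 2}" for a b using eq[OF that, of a] by simp
      show "AE \<omega> in M. \<bar>exp (- r * tauc k T \<omega>) * V (pos k (tauc k T \<omega>) \<omega>)\<bar> \<le> K" for k
        using eV by simp
      show "AE \<omega> in M. \<bar>exp (- r * tauc (Suc k) T \<omega>) * V (pos k (tauc (Suc k) T \<omega>) \<omega>)\<bar> \<le> K" for k
        using eV by blast
      have K0: "\<gamma> \<le> K" "0 \<le> K" using V_le[of x] \<gamma> by (auto simp: K_def)
      show "AE \<omega> in M. 0 \<le> a \<omega> \<and> a \<omega> \<le> tauc (Suc k) T \<omega> \<longrightarrow>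
          \<bar>LINT s:{a \<omega>..<tauc (Suc k) T \<omega>}|lborel. exp (- r * s) * (0 + 0 * pos k s \<omega>)\<bar> \<le> K" for k a
        using K0 by (simp add: set_lebesgue_integral_def)
      show "AE \<omega> in M. \<bar>gain r (\<lambda>_ _. \<gamma>) (Suc k) T \<omega>\<bar> \<le> K" for k
      proof (rule AE_I2)
        fix \<omega>
        have "exp (- r * tauc (Suc k) T \<omega>) * \<gamma> \<le> 1 * \<gamma>"
          using r(1) T \<gamma> by (intro mult_right_mono) (auto simp: capped_nonneg)
        moreover have "0 \<le> exp (- r * tauc (Suc k) T \<omega>) * \<gamma>" using \<gamma> by simp
        ultimately have "\<bar>exp (- r * tauc (Suc k) T \<omega>) * \<gamma>\<bar> \<le> K" using K0(1) by linarith
        then show "\<bar>gain r (\<lambda>_ _. \<gamma>) (Suc k) T \<omega>\<bar> \<le> K" using K0(2) by (simp add: gain_def)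
      qed
    qed auto
    then show "expectation (accrued V (\<lambda>_ _. \<gamma>) r 0 0 k T) \<le> V x" "integrable M (accrued V (\<lambda>_ _. \<gamma>) r 0 0 k T)" by auto
  qed
  \<comment> \<open>The discounted count is truncated both in the number of stages and in the
    horizon, so that it is bounded by a single \<open>accrued\<close>. The horizon
    \<open>Suc n\<close> is positive also for \<open>n = 0\<close>.\<close>
  define f where "f n \<omega> = (\<Sum>j<n. if tau (Suc j) \<omega> \<le> ereal (real (Suc n)) then weight r (Suc j) \<omega> else 0)" for n \<omega>
  have f0: "0 \<le> f n \<omega>" for n \<omega> unfolding f_def by (intro sum_nonneg) (auto simp: weight_nonneg)
  have f_M: "f n \<in> borel_measurable M" for n
  proof -
    have [measurable]: "weight r (Suc j) \<in> borel_measurable M" for j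
      unfolding weight_def[abs_def] by (rule total_gain_measurable) auto
    have [measurable]: "Measurable.pred M (\<lambda>\<omega>. tau j \<omega> \<le> ereal (real (Suc n)))" for j
      using stopping_pred[OF tau_stopping, of "real (Suc n)" j] by (rule measurable_F_M) auto
    show ?thesis unfolding f_def by measurable
  qed
  have f_acc: "\<gamma> * f n \<omega> \<le> accrued V (\<lambda>_ _. \<gamma>) r 0 0 n (real (Suc n)) \<omega>" for n \<omega>
  proof -
    have "\<gamma> * f n \<omega> = (\<Sum>j<n. gain r (\<lambda>_ _. \<gamma>) (Suc j) (real (Suc n)) \<omega>)"
      unfolding f_def sum_distrib_left by (intro sum.cong) (auto simp: gain_eq weight_def total_gain_def)
    also have "\<dots> = (\<Sum>j\<in>{0<..n}. gain r (\<lambda>_ _. \<gamma>) j (real (Suc n)) \<omega>)"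
      by (rule sum.reindex_bij_witness[of _ "\<lambda>j. j - 1" Suc]) auto
    finally show ?thesis using V_le(2) by (simp add: accrued_def set_lebesgue_integral_def)
  qed
  have f_le: "(\<integral>\<^sup>+ \<omega>. ennreal (f n \<omega>) \<partial>M) \<le> ennreal (V x / \<gamma>)" for n
  proof -
    have i: "integrable M (\<lambda>\<omega>. accrued V (\<lambda>_ _. \<gamma>) r 0 0 n (real (Suc n)) \<omega> / \<gamma>)" using acc(2)[of "real (Suc n)" n] by auto
    have "(\<integral>\<^sup>+ \<omega>. ennreal (f n \<omega>) \<partial>M) \<le> (\<integral>\<^sup>+ \<omega>. ennreal (accrued V (\<lambda>_ _. \<gamma>) r 0 0 n (real (Suc n)) \<omega> / \<gamma>) \<partial>M)"
      using f_acc[of n] \<gamma> by (intro nn_integral_mono ennreal_leI) (simp add: pos_le_divide_eq mult.commute)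
    also have "\<dots> = ennreal (expectation (\<lambda>\<omega>. accrued V (\<lambda>_ _. \<gamma>) r 0 0 n (real (Suc n)) \<omega> / \<gamma>))"
    proof (rule nn_integral_eq_integral[OF i], rule AE_I2)
      fix \<omega> have "0 \<le> \<gamma> * f n \<omega>" using f0 \<gamma> by simp
      then show "0 \<le> accrued V (\<lambda>_ _. \<gamma>) r 0 0 n (real (Suc n)) \<omega> / \<gamma>" using f_acc[of n \<omega>] \<gamma> by simp
    qed
    also have "\<dots> \<le> ennreal (V x / \<gamma>)"
      using acc(1)[of "real (Suc n)" n] \<gamma> by (intro ennreal_leI) (simp add: divide_right_mono)
    finally show ?thesis .
  qed
  \<comment> \<open>Each partial sum is eventually below \<open>f n\<close>, which prepares Fatou's
    lemma.\<close>
  have lim: "(\<Sum>k. ennreal (weight r (Suc k) \<omega>)) \<le> liminf (\<lambda>n. ennreal (f n \<omega>))" for \<omega>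
    unfolding suminf_eq_SUP
  proof (rule SUP_least)
    fix k
    have "\<exists>N::nat. \<forall>n\<ge>N. \<forall>j<k. weight r (Suc j) \<omega> = (if tau (Suc j) \<omega> \<le> ereal (real (Suc n)) then weight r (Suc j) \<omega> else 0)"
    proof (induction k)
      case (Suc k)
      then obtain N1 where N1: "\<forall>n\<ge>N1. \<forall>j<k. weight r (Suc j) \<omega> = (if tau (Suc j) \<omega> \<le> ereal (real (Suc n)) then weight r (Suc j) \<omega> else 0)" by blast
      obtain N2 :: nat where N2: "\<forall>n\<ge>N2. weight r (Suc k) \<omega> = (if tau (Suc k) \<omega> \<le> ereal (real (Suc n)) then weight r (Suc k) \<omega> else 0)"
      proof (cases "tau (Suc k) \<omega>")
        case (real t)
        obtain N :: nat where N: "t \<le> real N" using real_arch_simple by blast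
        show ?thesis by (rule that[of N]) (use N real in auto)
      next
        case PInf
        show ?thesis by (rule that[of 0]) (simp add: weight_def total_gain_def PInf)
      next
        case MInf
        then show ?thesis using tau_nonneg[of \<omega> "Suc k"] by simp
      qed
      show ?case using N1 N2 by (intro exI[of _ "max N1 N2"]) (auto simp: less_Suc_eq)
    qed simp
    then obtain N where N: "\<And>n j. N \<le> n \<Longrightarrow> j < k \<Longrightarrow> weight r (Suc j) \<omega> = (if tau (Suc j) \<omega> \<le> ereal (real (Suc n)) then weight r (Suc j) \<omega> else 0)"
      by blast
    have "(\<Sum>j<k. ennreal (weight r (Suc j) \<omega>)) \<le> ennreal (f n \<omega>)" if n: "max N k \<le> n" for n
    proof -
      have "(\<Sum>j<k. weight r (Suc j) \<omega>) = (\<Sum>j<k. if tau (Suc j) \<omega> \<le> ereal (real (Suc n)) then weight r (Suc j) \<omega> else 0)"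
        using n by (intro sum.cong refl N) auto
      also have "\<dots> \<le> f n \<omega>" unfolding f_def using n by (intro sum_mono2) (auto simp: weight_nonneg)
      finally have "(\<Sum>j<k. weight r (Suc j) \<omega>) \<le> f n \<omega>" .
      then show ?thesis by (simp add: sum_ennreal weight_nonneg ennreal_leI)
    qed
    then have "\<forall>\<^sub>F n in sequentially. (\<Sum>j<k. ennreal (weight r (Suc j) \<omega>)) \<le> ennreal (f n \<omega>)"
      unfolding eventually_sequentially by blast
    then show "(\<Sum>j<k. ennreal (weight r (Suc j) \<omega>)) \<le> liminf (\<lambda>n. ennreal (f n \<omega>))"
      by (rule Liminf_bounded)
  qed
  have "(\<integral>\<^sup>+ \<omega>. (\<Sum>k. ennreal (weight r (Suc k) \<omega>)) \<partial>M) \<le> (\<integral>\<^sup>+ \<omega>. liminf (\<lambda>n. ennreal (f n \<omega>)) \<partial>M)"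
    by (intro nn_integral_mono lim)
  also have "\<dots> \<le> liminf (\<lambda>n. \<integral>\<^sup>+ \<omega>. ennreal (f n \<omega>) \<partial>M)"
    by (rule nn_integral_liminf) (use f_M in measurable)
  also have "\<dots> \<le> liminf (\<lambda>n. ennreal (V x / \<gamma>))"
    by (intro Liminf_mono always_eventually allI f_le)
  also have "\<dots> < \<infinity>" by (simp add: Liminf_const)
  finally show ?thesis by (simp add: r_def)
qed

lemma candidate_admissible: "admissible G M W x cand"
proof -
  have nn: "0 < rho G" "0 \<le> c G" "0 \<le> lambda G" "0 \<le> c_tilde G" "0 \<le> lambda_tilde G"
    using param_facts c_pos by auto
  have B0: "0 \<le> bnd" by (simp add: bnd_def)
  have weight_M [measurable]: "weight (rho G) (Suc k) \<in> borel_measurable M" for k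
    unfolding weight_def[abs_def] by (rule total_gain_measurable) auto
  have sum_M: "(\<lambda>\<omega>. \<Sum>k. ennreal (weight (rho G) (Suc k) \<omega>)) \<in> borel_measurable M" by measurable
  have fin: "AE \<omega> in M. (\<Sum>k. ennreal (weight (rho G) (Suc k) \<omega>)) < \<infinity>"
    using nn_integral_noteq_infinite[OF sum_M] weights_finite by (auto simp: less_top)
  have unb: "AE \<omega> in M. \<omega> \<in> space M \<and> (\<forall>T. \<exists>k. ereal T < tau k \<omega>)"
    using fin AE_space by eventually_elim (use tau_unbounded[OF nn(1)] in auto)
  \<comment> \<open>The stage in force at time \<open>s\<close> is the one just before the first
    intervention after \<open>s\<close>.\<close>
  have stage: "\<exists>k. tau k \<omega> \<le> ereal s \<and> ereal s < tau (Suc k) \<omega>" if "\<forall>T. \<exists>k. ereal T < tau k \<omega>" "0 \<le> s" for \<omega> s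
  proof -
    define n where "n = (LEAST k. ereal s < tau k \<omega>)"
    have n: "ereal s < tau n \<omega>" using that(1) unfolding n_def by (metis LeastI_ex)
    then have "n \<noteq> 0" using that(2) by (intro notI) simp
    then obtain k where k: "n = Suc k" by (cases n) auto
    then have "\<not> ereal s < tau k \<omega>" using not_less_Least[of k "\<lambda>k. ereal s < tau k \<omega>"] unfolding n_def by simp
    then show ?thesis using n k by (auto simp: not_less)
  qed
  have X_bnd: "\<bar>X s \<omega>\<bar> \<le> bnd" if \<omega>: "\<omega> \<in> space M \<and> (\<forall>T. \<exists>k. ereal T < tau k \<omega>)" "0 \<le> s" for \<omega> s
  proof -
    obtain k where k: "tau k \<omega> \<le> ereal s" "ereal s < tau (Suc k) \<omega>" using stage[OF \<omega>(1)[THEN conjunct2] \<omega>(2)] by blast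
    then show ?thesis
      using controlled_path.state_eq_pos[OF controlled_path k(2)] pos_bounded[OF _ k(1) less_imp_le[OF k(2)]] \<omega> by simp
  qed
  have X_rc: "((\<lambda>s. X s \<omega>) \<longlongrightarrow> X t \<omega>) (at_right t)" if \<omega>: "\<omega> \<in> space M \<and> (\<forall>T. \<exists>k. ereal T < tau k \<omega>)" "0 \<le> t" for \<omega> t
  proof -
    interpret P: controlled_path "game.sigma G" x cand "\<lambda>t. W t \<omega>" by (rule controlled_path) (use \<omega> in simp)
    obtain k where k: "ereal t < tau (Suc k) \<omega>" using stage[OF \<omega>(1)[THEN conjunct2] \<omega>(2)] by blast
    obtain b where b: "t < b" "ereal b \<le> tau (Suc k) \<omega>"
      using k gt_ex[of t] by (cases "tau (Suc k) \<omega>") auto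
    have "\<forall>\<^sub>F u in at_right t. u < b" using b(1) by (auto simp: eventually_at_right_field)
    then have "\<forall>\<^sub>F u in at_right t. X u \<omega> = pos k u \<omega>"
    proof eventually_elim
      case (elim u)
      then have "ereal u < tau (Suc k) \<omega>" using less_le_trans[of "ereal u" "ereal b"] b(2) by simp
      then show ?case by (rule P.state_eq_pos)
    qed
    then show ?thesis
      using P.pos_right_continuous[OF \<omega>(2), of k] P.state_eq_pos[OF k] by (simp add: tendsto_cong)
  qed
  have X_M: "X s \<in> borel_measurable M" if s: "0 \<le> s" for s
    unfolding state_def using measurable_F_M[OF pos_adapted[OF s] s] by (rule borel_measurable_lim_metric)
  have costs: "integrable_nonneg M (\<lambda>\<omega>. \<Sum>k. ennreal (discounted (rho G) a b (ctl j k \<omega>)))"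
    if ab: "0 \<le> a" "0 \<le> b" for a b j
  proof -
    let ?g = "\<lambda>i d. if i = j then a + b * \<bar>d\<bar> else 0"
    have eq: "(\<Sum>k. ennreal (discounted (rho G) a b (ctl j k \<omega>)))
      = (\<Sum>k. ennreal (total_gain (rho G) ?g (Suc k) \<omega>))" if \<omega>: "\<omega> \<in> space M" for \<omega>
    proof -
      interpret P: controlled_path "game.sigma G" x cand "\<lambda>t. W t \<omega>" by (rule controlled_path[OF \<omega>])
      have "(\<Sum>k. ennreal (P.player_cost (rho G) a b j k)) = (\<Sum>k. ennreal (P.player_cost (rho G) a b j (Suc k)))"
      proof -
        have "(\<Sum>k. ennreal (P.player_cost (rho G) a b j (k + 1))) + (\<Sum>k<1. ennreal (P.player_cost (rho G) a b j k))
          = (\<Sum>k. ennreal (P.player_cost (rho G) a b j k))"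
          by (rule suminf_offset[OF summableI, symmetric])
        moreover have "P.player_cost (rho G) a b j 0 = 0" by (simp add: P.player_cost_def P.cost_def)
        ultimately show ?thesis by simp
      qed
      then show ?thesis unfolding P.control_sum[OF ab] player_cost_total_gain[OF \<omega>] .
    qed
    have tg_M [measurable]: "total_gain (rho G) ?g (Suc k) \<in> borel_measurable M" for k
      by (rule total_gain_measurable) auto
    have tg_int: "integrable_nonneg M (\<lambda>\<omega>. \<Sum>k. ennreal (total_gain (rho G) ?g (Suc k) \<omega>))"
      unfolding integrable_nonneg_def
    proof
      show "(\<lambda>\<omega>. \<Sum>k. ennreal (total_gain (rho G) ?g (Suc k) \<omega>)) \<in> borel_measurable M" by measurable
      have K: "0 \<le> a + b * (2 * bnd)" using ab B0 by simp
      have "total_gain (rho G) ?g (Suc k) \<omega> \<le> (a + b * (2 * bnd)) * weight (rho G) (Suc k) \<omega>" if \<omega>: "\<omega> \<in> space M" for k \<omega>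
      proof (cases "tau (Suc k) \<omega> < \<infinity>")
        case True
        \<comment> \<open>Impulses of the candidate are bounded, so every cost series is at most a
          constant multiple of the discounted number of interventions.\<close>
        have "b * \<bar>jump (Suc k) \<omega>\<bar> \<le> b * (2 * bnd)" using jump_bounded[OF \<omega> True] ab by (intro mult_left_mono)
        then have "?g (actor (Suc k) \<omega>) (jump (Suc k) \<omega>) \<le> a + b * (2 * bnd)" using K by auto
        then show ?thesis using True by (simp add: total_gain_def weight_def mult.commute del: if_split)
      qed (simp add: total_gain_def weight_def)
      then have le: "ennreal (total_gain (rho G) ?g (Suc k) \<omega>) \<le> ennreal (a + b * (2 * bnd)) * ennreal (weight (rho G) (Suc k) \<omega>)"
        if "\<omega> \<in> space M" for k \<omega>
        unfolding ennreal_mult[OF K weight_nonneg, symmetric] using that by (intro ennreal_leI)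
      have "(\<integral>\<^sup>+ \<omega>. (\<Sum>k. ennreal (total_gain (rho G) ?g (Suc k) \<omega>)) \<partial>M)
        \<le> (\<integral>\<^sup>+ \<omega>. (\<Sum>k. ennreal (a + b * (2 * bnd)) * ennreal (weight (rho G) (Suc k) \<omega>)) \<partial>M)"
        by (rule nn_integral_mono, rule suminf_le[OF le summableI summableI])
      also have "\<dots> = ennreal (a + b * (2 * bnd)) * (\<integral>\<^sup>+ \<omega>. (\<Sum>k. ennreal (weight (rho G) (Suc k) \<omega>)) \<partial>M)"
        using sum_M by (simp add: ennreal_suminf_cmult nn_integral_cmult)
      also have "\<dots> < \<infinity>" using weights_finite by (simp add: ennreal_mult_less_top)
      finally show "(\<integral>\<^sup>+ \<omega>. (\<Sum>k. ennreal (total_gain (rho G) ?g (Suc k) \<omega>)) \<partial>M) < \<infinity>" .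
    qed
    have ae: "AE \<omega> in M. (\<Sum>k. ennreal (discounted (rho G) a b (ctl j k \<omega>)))
      = (\<Sum>k. ennreal (total_gain (rho G) ?g (Suc k) \<omega>))" using eq by (rule AE_I2)
    show ?thesis by (rule integrable_nonneg_AE_cong[OF ae, THEN iffD2, OF tg_int])
  qed
  have running: "integrable_nonneg M (\<lambda>\<omega>. \<integral>\<^sup>+ s\<in>{0..}. ennreal (exp (- rho G * s) * \<bar>X s \<omega> - target G i\<bar>) \<partial>lborel)" for i
  proof (rule integrable_nonneg_bounded)
    let ?K = "bnd + \<bar>target G i\<bar>"
    show "(\<integral>\<^sup>+ s\<in>{0..}. ennreal (?K * exp (- rho G * s)) \<partial>lborel) < \<infinity>"
      using nn B0 by (intro nn_integral_exp_finite) auto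
    show "AE \<omega> in M. (\<integral>\<^sup>+ s\<in>{0..}. ennreal (exp (- rho G * s) * \<bar>X s \<omega> - target G i\<bar>) \<partial>lborel)
        \<le> (\<integral>\<^sup>+ s\<in>{0..}. ennreal (?K * exp (- rho G * s)) \<partial>lborel)"
      using unb
    proof eventually_elim
      case (elim \<omega>)
      show ?case
      proof (rule nn_integral_mono)
        fix s :: real
        have "\<bar>X s \<omega> - target G i\<bar> \<le> ?K" if "0 \<le> s" using X_bnd[OF elim that] by linarith
        then have "exp (- rho G * s) * \<bar>X s \<omega> - target G i\<bar> \<le> ?K * exp (- rho G * s)" if "0 \<le> s"
          using that by (simp add: mult.commute)
        then show "ennreal (exp (- rho G * s) * \<bar>X s \<omega> - target G i\<bar>) * indicator {0..} s
          \<le> ennreal (?K * exp (- rho G * s)) * indicator {0..} s"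
          by (auto simp: indicator_def intro!: ennreal_leI)
      qed
    qed
    note [measurable] = state_joint_measurable
    have "(\<lambda>z. ennreal (exp (- rho G * snd z) * \<bar>X (max 0 (snd z)) (fst z) - target G i\<bar>) * indicator {0..} (snd z))
       \<in> borel_measurable (M \<Otimes>\<^sub>M lborel)" by measurable
    then have "(\<lambda>\<omega>. \<integral>\<^sup>+ s. ennreal (exp (- rho G * s) * \<bar>X (max 0 s) \<omega> - target G i\<bar>) * indicator {0..} s \<partial>lborel) \<in> borel_measurable M"
      by (intro lborel.borel_measurable_nn_integral) (simp add: split_beta')
    moreover have "(\<integral>\<^sup>+ s. ennreal (exp (- rho G * s) * \<bar>X (max 0 s) \<omega> - target G i\<bar>) * indicator {0..} s \<partial>lborel)
      = (\<integral>\<^sup>+ s\<in>{0..}. ennreal (exp (- rho G * s) * \<bar>X s \<omega> - target G i\<bar>) \<partial>lborel)" for \<omega>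
      by (rule nn_integral_cong) (auto simp: indicator_def)
    ultimately show "(\<lambda>\<omega>. \<integral>\<^sup>+ s\<in>{0..}. ennreal (exp (- rho G * s) * \<bar>X s \<omega> - target G i\<bar>) \<partial>lborel) \<in> borel_measurable M"
      by (simp only:)
  qed
  have sup: "integrable_nonneg M (\<lambda>\<omega>. \<Squnion>t\<in>{0..}. ennreal (\<bar>X t \<omega>\<bar> ^ n))" for n
  proof -
    have ae: "AE \<omega> in M. (\<Squnion>t\<in>{0..} \<inter> \<rat>. ennreal (\<bar>X t \<omega>\<bar> ^ n)) = (\<Squnion>t\<in>{0..}. ennreal (\<bar>X t \<omega>\<bar> ^ n))"
      using unb
    proof eventually_elim
      case (elim \<omega>)
      show ?case
        by (rule rational_sup_right_continuous[symmetric]) (intro tendsto_intros X_rc[OF elim])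
    qed
    have "integrable_nonneg M (\<lambda>\<omega>. \<Squnion>t\<in>{0..} \<inter> \<rat>. ennreal (\<bar>X t \<omega>\<bar> ^ n))"
    proof (rule integrable_nonneg_bounded)
      show "(\<lambda>\<omega>. \<Squnion>t\<in>{0..} \<inter> \<rat>. ennreal (\<bar>X t \<omega>\<bar> ^ n)) \<in> borel_measurable M"
      proof (rule borel_measurable_SUP)
        show "countable ({0..} \<inter> \<rat> :: real set)" by (intro countable_Int2 countable_rat)
        fix t :: real assume "t \<in> {0..} \<inter> \<rat>"
        then have [measurable]: "X t \<in> borel_measurable M" by (intro X_M) auto
        show "(\<lambda>\<omega>. ennreal (\<bar>X t \<omega>\<bar> ^ n)) \<in> borel_measurable M" by measurable
      qed
      show "AE \<omega> in M. (\<Squnion>t\<in>{0..} \<inter> \<rat>. ennreal (\<bar>X t \<omega>\<bar> ^ n)) \<le> ennreal (bnd ^ n)"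
        using unb
      proof eventually_elim
        case (elim \<omega>)
        show ?case by (intro SUP_least ennreal_leI power_mono X_bnd[OF elim]) auto
      qed
    qed simp
    then show ?thesis by (rule integrable_nonneg_AE_cong[OF ae, THEN iffD1])
  qed
  have times: "AE \<omega> in M. (\<lambda>k. fst (ctl j k \<omega>)) \<longlonglongrightarrow> \<infinity>" for j
    using unb
  proof eventually_elim
    case (elim \<omega>)
    interpret P: controlled_path "game.sigma G" x cand "\<lambda>t. W t \<omega>" by (rule controlled_path) (use elim in simp)
    show ?case by (rule P.control_times_tendsto) (use elim in blast)
  qed
  show ?thesis unfolding admissible_def
    using cand_strategy running costs[OF nn(2,3)] costs[OF nn(4,5)] sup times by blast
qed

end

section \<open>The equilibrium for an arbitrary Brownian motion\<close>

context equilibrium_game begin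

lemma candidate_equilibrium:
  "nash_equilibrium G M W x cand" "payoff G M W i x cand = val i x"
proof -
  interpret candidate_play G \<xi> st M F W x ..
  \<comment> \<open>The upper bound is \<open>deviation_le\<close> for the trivial deviation, in
    which player \<open>j\<close> keeps the candidate strategy.\<close>
  have eq: "payoff G M W j x cand = val j x" for j
    using candidate_payoff_ge[OF candidate_admissible, of j] deviation_le[of x j "cand j"] candidate_admissible
    by (simp add: antisym)
  then show "payoff G M W i x cand = val i x" .
  show "nash_equilibrium G M W x cand"
    unfolding nash_equilibrium_def eq using candidate_admissible deviation_le by blast
qed

end

text \<open>Every condition is a functional of the path of \<open>W\<close>, integrated or required
  almost surely. No measurability of these functionals is known in advance, so completeness is
  needed for the transfer.\<close>

lemma (in complete_measure) AE_cong_admissible: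
  assumes "AE \<omega> in M. \<forall>t. W t \<omega> = W' t \<omega>"
  shows "admissible G M W x \<pi> \<longleftrightarrow> admissible G M W' x \<pi>"
proof -
  have paths: "AE \<omega> in M. (\<lambda>t. W t \<omega>) = (\<lambda>t. W' t \<omega>)" using assms by eventually_elim (simp add: fun_eq_iff)
  have A: "integrable_nonneg M (\<lambda>\<omega>. h (\<lambda>t. W t \<omega>)) \<longleftrightarrow> integrable_nonneg M (\<lambda>\<omega>. h (\<lambda>t. W' t \<omega>))" for h
    by (rule integrable_nonneg_AE_cong) (use paths in \<open>eventually_elim, simp\<close>)
  have B: "(AE \<omega> in M. P (\<lambda>t. W t \<omega>)) \<longleftrightarrow> (AE \<omega> in M. P (\<lambda>t. W' t \<omega>))" for P
  proof
    assume "AE \<omega> in M. P (\<lambda>t. W t \<omega>)"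
    then show "AE \<omega> in M. P (\<lambda>t. W' t \<omega>)" using paths by eventually_elim simp
  next
    assume "AE \<omega> in M. P (\<lambda>t. W' t \<omega>)"
    then show "AE \<omega> in M. P (\<lambda>t. W t \<omega>)" using paths by eventually_elim simp
  qed
  show ?thesis unfolding admissible_def
    using A[of "\<lambda>w. \<integral>\<^sup>+ s\<in>{0..}. ennreal (exp (- rho G * s) * \<bar>state (game.sigma G) \<pi> x w s - target G i\<bar>) \<partial>lborel" for i]
      A[of "\<lambda>w. \<Sum>k. ennreal (discounted (rho G) a b (control (game.sigma G) \<pi> x w i k))" for a b i]
      A[of "\<lambda>w. \<Squnion>t\<in>{0..}. ennreal (\<bar>state (game.sigma G) \<pi> x w t\<bar> ^ p)" for p]
      B[of "\<lambda>w. (\<lambda>k. fst (control (game.sigma G) \<pi> x w i k)) \<longlonglongrightarrow> \<infinity>" for i]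
    by simp
qed

lemma (in complete_measure) AE_cong_payoff:
  assumes "AE \<omega> in M. \<forall>t. W t \<omega> = W' t \<omega>"
  shows "payoff G M W i x \<pi> = payoff G M W' i x \<pi>"
proof -
  have paths: "AE \<omega> in M. (\<lambda>t. W t \<omega>) = (\<lambda>t. W' t \<omega>)" using assms by eventually_elim (simp add: fun_eq_iff)
  show ?thesis unfolding payoff_def
    by (rule integral_cong_AE_complete) (use paths in \<open>eventually_elim, simp\<close>)
qed

text \<open>Paths that are discontinuous or do not start at 0 are replaced by the zero path. The
  exceptional set is null and thus belongs to \<open>F 0\<close>, so adaptedness survives;
  independence and the law of the increments transfer along almost sure equality.\<close>

lemma (in brownian_motion) continuous_version:
  obtains W' where "continuous_brownian_motion M F W'" "AE \<omega> in M. \<forall>t. W t \<omega> = W' t \<omega>"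
proof -
  define A where "A = {\<omega> \<in> space M. continuous_on {0..} (\<lambda>t. W t \<omega>) \<and> W 0 \<omega> = 0}"
  define W' where "W' t \<omega> = (if \<omega> \<in> A then W t \<omega> else 0)" for t \<omega>
  have ae: "AE \<omega> in M. \<omega> \<in> A"
    using AE_space continuous_paths start_zero unfolding A_def by eventually_elim simp
  then have "space M - A \<in> null_sets M" by (simp add: AE_iff_null_sets set_diff_eq)
  then have null: "space M - A \<in> sets (F t)" if "0 \<le> t" for t
    using null_sets_F F_mono[of 0 t] that by blast
  have A_F: "A \<in> sets (F t)" if t: "0 \<le> t" for t
  proof -
    have "space (F t) - (space M - A) \<in> sets (F t)" using null[OF t] by (rule sets.compl_sets)
    moreover have "space (F t) - (space M - A) = A" using t by (auto simp: A_def)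
    ultimately show ?thesis by simp
  qed
  have eqae: "AE \<omega> in M. \<forall>t. W t \<omega> = W' t \<omega>" using ae by eventually_elim (simp add: W'_def)
  have adapted': "W' t \<in> borel_measurable (F t)" if t: "0 \<le> t" for t
  proof -
    note [measurable] = adapted[OF t] A_F[OF t]
    show ?thesis unfolding W'_def by measurable
  qed
  have W'_M: "W' t \<in> borel_measurable M" if "0 \<le> t" for t using measurable_F_M[OF adapted'[OF that] that] .
  have "continuous_brownian_motion M F W'"
  proof unfold_locales
    show "W' t \<in> borel_measurable (F t)" if "0 \<le> t" for t by (rule adapted'[OF that])
    show "AE \<omega> in M. W' 0 \<omega> = 0" by (rule AE_I2) (auto simp: W'_def A_def)
    show c: "continuous_on {0..} (\<lambda>t. W' t \<omega>)" for \<omega> by (cases "\<omega> \<in> A") (auto simp: W'_def A_def)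
    then show "AE \<omega> in M. continuous_on {0..} (\<lambda>t. W' t \<omega>)" by (intro AE_I2)
    show "W' 0 \<omega> = 0" for \<omega> by (auto simp: W'_def A_def)
    fix s t :: real assume st: "0 \<le> s" "s < t"
    show "indep_set (sets (F s)) (sets (vimage_algebra (space M) (\<lambda>\<omega>. W' t \<omega> - W' s \<omega>) borel))"
    proof -
      have ind: "prob (a \<inter> b) = prob a * prob b" if a: "a \<in> sets (F s)" and b: "b \<in> sets (vimage_algebra (space M) (\<lambda>\<omega>. W' t \<omega> - W' s \<omega>) borel)" for a b
      proof -
        obtain C where C: "C \<in> sets borel" "b = (\<lambda>\<omega>. W' t \<omega> - W' s \<omega>) -` C \<inter> space M"
          using b by (auto simp: sets_vimage_algebra2)
        define b' where "b' = (\<lambda>\<omega>. W t \<omega> - W s \<omega>) -` C \<inter> space M"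
        have b': "b' \<in> sets (vimage_algebra (space M) (\<lambda>\<omega>. W t \<omega> - W s \<omega>) borel)"
          using C by (auto simp: sets_vimage_algebra2 b'_def)
        have m: "a \<in> events" "b \<in> events" "b' \<in> events"
        proof -
          show "a \<in> events" using a sets_F_subset st by blast
          have [measurable]: "W' t \<in> borel_measurable M" "W' s \<in> borel_measurable M" "W t \<in> borel_measurable M" "W s \<in> borel_measurable M"
            using st W'_M measurable_F_M[OF adapted] by auto
          show "b \<in> events" unfolding C(2) using C(1) by measurable
          show "b' \<in> events" unfolding b'_def using C(1) by measurable
        qed
        have bb: "AE \<omega> in M. \<omega> \<in> b \<longleftrightarrow> \<omega> \<in> b'" using eqae AE_space by eventually_elim (simp add: C(2) b'_def)
        have "prob (a \<inter> b) = prob (a \<inter> b')" "prob b = prob b'"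
          using bb m by (auto intro!: finite_measure_eq_AE elim: eventually_mono)
        moreover have "prob (a \<inter> b') = prob a * prob b'"
          by (rule indep_setD[OF independent_increments[OF st] a b'])
        ultimately show ?thesis by simp
      qed
      show ?thesis
      proof (rule indep_setI)
        show "sets (F s) \<subseteq> events" using sets_F_subset st by simp
        show "sets (vimage_algebra (space M) (\<lambda>\<omega>. W' t \<omega> - W' s \<omega>) borel) \<subseteq> events"
        proof
          fix b assume "b \<in> sets (vimage_algebra (space M) (\<lambda>\<omega>. W' t \<omega> - W' s \<omega>) borel)"
          then obtain C where C: "C \<in> sets borel" "b = (\<lambda>\<omega>. W' t \<omega> - W' s \<omega>) -` C \<inter> space M"
            by (auto simp: sets_vimage_algebra2)
          have [measurable]: "W' t \<in> borel_measurable M" "W' s \<in> borel_measurable M" using st W'_M by auto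
          show "b \<in> events" unfolding C(2) using C(1) by measurable
        qed
      qed (rule ind)
    qed
    have dW: "distributed M lborel (\<lambda>\<omega>. W t \<omega> - W s \<omega>) (normal_density 0 (sqrt (t - s)))"
      by (rule normal_increments[OF st])
    show "distributed M lborel (\<lambda>\<omega>. W' t \<omega> - W' s \<omega>) (normal_density 0 (sqrt (t - s)))"
    proof -
      have m: "(\<lambda>\<omega>. W' t \<omega> - W' s \<omega>) \<in> borel_measurable M" "(\<lambda>\<omega>. W t \<omega> - W s \<omega>) \<in> borel_measurable M"
        using st W'_M measurable_F_M[OF adapted] by (auto intro!: borel_measurable_diff)
      have "distr M lborel (\<lambda>\<omega>. W' t \<omega> - W' s \<omega>) = distr M lborel (\<lambda>\<omega>. W t \<omega> - W s \<omega>)"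
        by (rule distr_cong_AE) (use m eqae in \<open>auto elim: eventually_mono\<close>)
      then show ?thesis using dW m unfolding distributed_def by simp
    qed
  qed
  then show ?thesis using eqae by (rule that)
qed

theorem proposition4p7:
  fixes M :: "'a measure" and F :: "real \<Rightarrow> 'a measure" and W :: "real \<Rightarrow> 'a \<Rightarrow> real"
    and G :: game and \<xi> st :: real
  assumes "brownian_motion M F W"
    and "admissible_parameters G"
    and "is_xi G \<xi>"
  shows "\<forall>x. nash_equilibrium G M W x (candidate G \<xi> st) \<and>
             payoff G M W Player1 x (candidate G \<xi> st) = V1_tilde G \<xi> st x \<and>
             payoff G M W Player2 x (candidate G \<xi> st) = V2_tilde G \<xi> st x"
proof -
  interpret B: brownian_motion M F W by (rule assms(1))
  \<comment> \<open>Neither admissibility nor the payoff distinguishes \<open>W\<close> from this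
    version, so the equilibrium for the version is one for \<open>W\<close>.\<close>
  obtain W' where W': "continuous_brownian_motion M F W'" and ae: "AE \<omega> in M. \<forall>t. W t \<omega> = W' t \<omega>"
    by (rule B.continuous_version)
  interpret E: equilibrium_game G \<xi> st M F W'
    using W' assms(2,3) by (intro equilibrium_game.intro candidate_solution.intro)
  show ?thesis
    using E.candidate_equilibrium
    unfolding nash_equilibrium_def B.AE_cong_admissible[OF ae] B.AE_cong_payoff[OF ae]
    by (simp add: E.val_def)
qed

end
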